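(* Let $(\mathcal S,\Omega)$ be a presharp o-minimal structure. Then there exists an FD-filtration $\Omega^{*}$ on $\mathcal S$ such that $\Omega\le\Omega^{*}$, and such that $(\mathcal S,\Omega^{*})$ is a sharply o-minimal structure with sharp cellular decomposition.
   Context: Let $\mathcal S$ be an o-minimal expansion of the real field; "definable" means definable in $\mathcal S$. For $m\ge n$, $\pi_n:\mathbb R^m\to\mathbb R^n$ is the projection to the first $n$ coordinates, and $A^c$ denotes the complement of $A$. An FD-filtration on $\mathcal S$ is a family $\Omega=\{\Omega_{\mathcal F,D}\}_{\mathcal F,D\in\mathbb N}$ of collections of definable sets with $\Omega_{\mathcal F,D}\subset\Omega_{\mathcal F+1,D}\cap\Omega_{\mathcal F,D+1}$, such that every definable set lies in some $\Omega_{\mathcal F,D}$; $X\in\Omega_{\mathcal F,D}$ is read "$X$ has format $\mathcal F$ and degree $D$", and a definable function has format $\mathcal F$ and degree $D$ if its graph does. Reduction: $\Omega\le\Omega'$ if there are a function $a:\mathbb N\to\mathbb N$ and for each $\mathcal F$ a polynomial $P_{\mathcal F}$ with positive coefficients such that $\Omega_{\mathcal F,D}\subset\Omega'_{a(\mathcal F),P_{\mathcal F}(D)}$ for all $\mathcal F,D$; $\Omega,\Omega'$ are equivalent if $\Omega\le\Omega'$ and $\Omega'\le\Omega$. Presharp: $(\mathcal S,\Omega)$ is presharp if for every $\mathcal F$ there is a polynomial $P_{\mathcal F}$ with positive coefficients such that: (P1) if $A\subset\mathbb R$, $A\in\Omega_{\mathcal F,D}$, then $A$ has at most $P_{\mathcal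 F}(D)$ connected components; (P2) if $A\subset\mathbb R^\ell$ and $A\in\Omega_{\mathcal F,D}$ then $\mathcal F\ge\ell$; (P3) if $A\subset\mathbb R^\ell$, $A\in\Omega_{\mathcal F,D}$, then $\pi_{\ell-1}(A),A^c,A\times\mathbb R,\mathbb R\times A\in\Omega_{\mathcal F+1,D}$; (P4),(P5) if $A_1,A_2\subset\mathbb R^\ell$ with $A_i\in\Omega_{\mathcal F_i,D_i}$, then $A_1\cup A_2$ and $A_1\cap A_2$ lie in $\Omega_{\max(\mathcal F_1,\mathcal F_2)+1,D_1+D_2}$; (P6) for $P\in\mathbb R[x_1,\dots,x_\ell]$, $\{P=0\}\in\Omega_{\ell,\deg P}$. Sharply o-minimal: $(\mathcal S,\Omega)$ satisfies (P1), (P2), (P6), and: (#3) if $A\subset\mathbb R^\ell$, $A\in\Omega_{\mathcal F,D}$, then $\mathbb R\times A,A\times\mathbb R\in\Omega_{\mathcal F+1,D}$ and $\pi_{\ell-1}(A),A^c\in\Omega_{\mathcal F,D}$; (#4),(#5) for finitely many $A_1,\dots,A_k\subset\mathbb R^\ell$ with $A_i\in\Omega_{\mathcal F_i,D_i}$, both $\bigcup_iA_i$ and $\bigcap_iA_i$ lie in $\Omega_{\max_i\mathcal F_i,\sum_iD_i}$. Cells: a cell in $\mathbb R$ is a point or an open (possibly infinite) interval; a cell in $\mathbb R^{\ell+1}$ is either the graph of a continuous definable $f:C'\to\mathbb R$ over a cell $C'\subset\mathbb R^\ell$, or a set $\{(x,y):x\in C',f(x)<y<g(x)\}$ with $f<g$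 continuous definable on a cell $C'$ (allowing $f\equiv-\infty$ and/or $g\equiv+\infty$). A (cylindrical) cell decomposition of $\mathbb R$ is a partition into cells; a partition of $\mathbb R^{\ell+1}$ into cells $\{C_j\}$ is a cell decomposition if $\{\pi_\ell(C_j)\}$ is a cell decomposition of $\mathbb R^\ell$. It is compatible with $X$ if each cell is contained in $X$ or disjoint from $X$. Sharp cellular decomposition (#CD): there exist $C:\mathbb N\to\mathbb N$ and for each $\mathcal F$ polynomials (positive coefficients) such that for every collection of $k$ sets $X_j\subset\mathbb R^\ell$ each in $\Omega_{\mathcal F,D}$ there is a cell decomposition of $\mathbb R^\ell$ compatible with all $X_j$ consisting of at most $\mathrm{poly}_{\mathcal F}(D,k)$ cells, each in $\Omega_{C(\mathcal F),\mathrm{poly}_{\mathcal F}(D)}$. *)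

theory Defs
  imports
    "HOL-Analysis.Analysis"
    "HOL-Library.Poly_Mapping"
    "HOL-Library.Disjoint_Sets"
    "HOL-Computational_Algebra.Polynomial"
begin

section \<open>Points, projections, products\<close>

text \<open>
  A point \<open>(x\<^sub>1, \<dots>, x\<^sub>n)\<close> of \<open>\<real>\<^sup>n\<close> is the function with values \<open>x\<^sub>1, \<dots>, x\<^sub>n\<close> at the indices
  \<open>0, \<dots>, n - 1\<close> and \<open>0\<close> from \<open>n\<close> on, as in \<^term>\<open>Euclidean_space n\<close>. Under this encoding one
  set of points can be a subset of several \<open>\<real>\<^sup>n\<close> (the empty set of all of them), so every
  notion below that depends on the ambient space takes the dimension \<open>n\<close> as an argument.
\<close>

type_synonym point = "nat \<Rightarrow> real"

abbreviation Rn :: "nat \<Rightarrow> point set" where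
  "Rn n \<equiv> topspace (Euclidean_space n)"

definition proj :: "nat \<Rightarrow> point \<Rightarrow> point" where
  "proj n x = (\<lambda>i. if i < n then x i else 0)"

text \<open>For \<open>A \<subseteq> \<real>\<^sup>n\<close>: the sets \<open>A \<times> \<real>\<close> and \<open>\<real> \<times> A\<close> in \<open>\<real>\<^bsup>n+1\<^esup>\<close>.\<close>

definition times_R :: "nat \<Rightarrow> point set \<Rightarrow> point set" where
  "times_R n A = {x \<in> Rn (n + 1). proj n x \<in> A}"

definition R_times :: "nat \<Rightarrow> point set \<Rightarrow> point set" where
  "R_times n A = {x \<in> Rn (n + 1). (\<lambda>i. x (i + 1)) \<in> A}"


section \<open>Cells and cell decompositions\<close>

text \<open>
  Here \<open>S n\<close> is the collection of definable subsets of \<open>\<real>\<^sup>n\<close>. In \<open>graph_over n C f\<close> the set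
  \<open>C\<close> is contained in \<open>\<real>\<^sup>n\<close>.
\<close>

definition graph_over :: "nat \<Rightarrow> point set \<Rightarrow> (point \<Rightarrow> real) \<Rightarrow> point set" where
  "graph_over n C f = {x(n := f x) |x. x \<in> C}"

definition cont_definable ::
  "(nat \<Rightarrow> point set set) \<Rightarrow> nat \<Rightarrow> point set \<Rightarrow> (point \<Rightarrow> real) \<Rightarrow> bool" where
  "cont_definable S n C f \<longleftrightarrow>
     continuous_map (subtopology (Euclidean_space n) C) euclideanreal f \<and>
     graph_over n C f \<in> S (n + 1)"

definition lower_bound ::
  "(nat \<Rightarrow> point set set) \<Rightarrow> nat \<Rightarrow> point set \<Rightarrow> (point \<Rightarrow> ereal) \<Rightarrow> bool" where
  "lower_bound S n C f \<longleftrightarrow>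
     (\<forall>x\<in>C. f x = - \<infinity>) \<or> (\<exists>h. cont_definable S n C h \<and> (\<forall>x\<in>C. f x = ereal (h x)))"

definition upper_bound ::
  "(nat \<Rightarrow> point set set) \<Rightarrow> nat \<Rightarrow> point set \<Rightarrow> (point \<Rightarrow> ereal) \<Rightarrow> bool" where
  "upper_bound S n C g \<longleftrightarrow>
     (\<forall>x\<in>C. g x = \<infinity>) \<or> (\<exists>h. cont_definable S n C h \<and> (\<forall>x\<in>C. g x = ereal (h x)))"

inductive basic_cell :: "point set \<Rightarrow> bool" where
  point: "basic_cell {x \<in> Rn 1. x 0 = a}"
| interval: "basic_cell {x \<in> Rn 1. a < ereal (x 0) \<and> ereal (x 0) < b}" if "a < b" for a b :: ereal

inductive cell :: "(nat \<Rightarrow> point set set) \<Rightarrow> nat \<Rightarrow> point set \<Rightarrow> bool"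
  for S :: "nat \<Rightarrow> point set set" where
  basic: "basic_cell C \<Longrightarrow> cell S 1 C"
| graph: "cell S n C \<Longrightarrow> cont_definable S n C f \<Longrightarrow> cell S (n + 1) (graph_over n C f)"
| band: "cell S n C \<Longrightarrow> lower_bound S n C f \<Longrightarrow> upper_bound S n C g \<Longrightarrow> (\<forall>x\<in>C. f x < g x) \<Longrightarrow>
    cell S (n + 1)
      {x \<in> Rn (n + 1). proj n x \<in> C \<and> f (proj n x) < ereal (x n) \<and> ereal (x n) < g (proj n x)}"

text \<open>Cells, and hence cell decompositions, exist only in dimension at least \<open>1\<close>.\<close>

inductive cell_decomposition :: "(nat \<Rightarrow> point set set) \<Rightarrow> nat \<Rightarrow> point set set \<Rightarrow> bool"
  for S :: "nat \<Rightarrow> point set set" where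
  line: "partition_on (Rn 1) \<C> \<Longrightarrow> (\<forall>C\<in>\<C>. cell S 1 C) \<Longrightarrow> cell_decomposition S 1 \<C>"
| step: "partition_on (Rn (n + 1)) \<C> \<Longrightarrow> (\<forall>C\<in>\<C>. cell S (n + 1) C) \<Longrightarrow>
    cell_decomposition S n ((\<lambda>C. proj n ` C) ` \<C>) \<Longrightarrow> cell_decomposition S (n + 1) \<C>"

definition compatible :: "point set set \<Rightarrow> point set \<Rightarrow> bool" where
  "compatible \<C> X \<longleftrightarrow> (\<forall>C\<in>\<C>. C \<subseteq> X \<or> C \<inter> X = {})"


section \<open>O-minimal expansions of the real field\<close>

text \<open>
  A structure is given by its definable sets (with parameters), axiomatised as in van den
  Dries, \<^emph>\<open>Tame Topology and O-minimal Structures\<close>. Parameters are available because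
  \<open>tame\<close> makes every singleton in \<open>\<real>\<close> definable.
\<close>

locale o_minimal =
  fixes S :: "nat \<Rightarrow> point set set"
  assumes subset_Rn: "A \<in> S n \<Longrightarrow> A \<subseteq> Rn n"
    and empty: "{} \<in> S n"
    and union: "A \<in> S n \<Longrightarrow> B \<in> S n \<Longrightarrow> A \<union> B \<in> S n"
    and compl: "A \<in> S n \<Longrightarrow> Rn n - A \<in> S n"
    and times_R: "A \<in> S n \<Longrightarrow> times_R n A \<in> S (n + 1)"
    and R_times: "A \<in> S n \<Longrightarrow> R_times n A \<in> S (n + 1)"
    and diagonal: "n \<ge> 1 \<Longrightarrow> {x \<in> Rn n. x 0 = x (n - 1)} \<in> S n"
    and proj: "A \<in> S (n + 1) \<Longrightarrow> proj n ` A \<in> S n"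
    and less: "{x \<in> Rn 2. x 0 < x 1} \<in> S 2"
    and add: "{x \<in> Rn 3. x 0 + x 1 = x 2} \<in> S 3"
    and mult: "{x \<in> Rn 3. x 0 * x 1 = x 2} \<in> S 3"
    and tame: "A \<in> S 1 \<longleftrightarrow> (\<exists>\<C>. finite \<C> \<and> (\<forall>C\<in>\<C>. basic_cell C) \<and> A = \<Union>\<C>)"


section \<open>FD-filtrations\<close>

text \<open>
  \<open>\<Omega> F D n\<close> is the collection of the subsets of \<open>\<real>\<^sup>n\<close> of format \<open>F\<close> and degree \<open>D\<close>. The
  polynomials in one variable with positive coefficients are rendered by \<^typ>\<open>nat poly\<close>: their
  values have to be natural numbers, as they occur as degrees, and their nonzero coefficients
  are positive.
\<close>

type_synonym filtration = "nat \<Rightarrow> nat \<Rightarrow> nat \<Rightarrow> point set set"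

locale FD_filtration =
  fixes S :: "nat \<Rightarrow> point set set" and \<Omega> :: filtration
  assumes definable: "\<Omega> F D n \<subseteq> S n"
    and increasing: "\<Omega> F D n \<subseteq> \<Omega> (F + 1) D n \<inter> \<Omega> F (D + 1) n"
    and exhaustive: "A \<in> S n \<Longrightarrow> \<exists>F D. A \<in> \<Omega> F D n"

definition reduces :: "filtration \<Rightarrow> filtration \<Rightarrow> bool" where
  "reduces \<Omega> \<Omega>' \<longleftrightarrow>
     (\<exists>a :: nat \<Rightarrow> nat. \<forall>F. \<exists>P :: nat poly. \<forall>D n. \<Omega> F D n \<subseteq> \<Omega>' (a F) (poly P D) n)"

text \<open>
  Real polynomials in several variables are finitely supported maps from monomials to
  coefficients, a monomial being a finitely supported map from variables to exponents. The zero
  polynomial is given degree \<open>0\<close>.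
\<close>

type_synonym mpoly = "(nat \<Rightarrow>\<^sub>0 nat) \<Rightarrow>\<^sub>0 real"

definition in_vars :: "nat \<Rightarrow> mpoly \<Rightarrow> bool" where
  "in_vars n P \<longleftrightarrow> (\<forall>m\<in>Poly_Mapping.keys P. Poly_Mapping.keys m \<subseteq> {..<n})"

definition mpoly_eval :: "mpoly \<Rightarrow> point \<Rightarrow> real" where
  "mpoly_eval P x = (\<Sum>m\<in>Poly_Mapping.keys P.
     Poly_Mapping.lookup P m * (\<Prod>i\<in>Poly_Mapping.keys m. x i ^ Poly_Mapping.lookup m i))"

definition mpoly_degree :: "mpoly \<Rightarrow> nat" where
  "mpoly_degree P = Max (insert 0
     ((\<lambda>m. \<Sum>i\<in>Poly_Mapping.keys m. Poly_Mapping.lookup m i) ` Poly_Mapping.keys P))"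

locale o_minimal_FD = o_minimal S + FD_filtration S \<Omega>
  for S :: "nat \<Rightarrow> point set set" and \<Omega> :: filtration +
  assumes P1: "\<exists>P :: nat poly. \<forall>D. \<forall>A \<in> \<Omega> F D 1.
      finite (components ((\<lambda>x. x 0) ` A)) \<and> card (components ((\<lambda>x. x 0) ` A)) \<le> poly P D"
    and P2: "A \<in> \<Omega> F D n \<Longrightarrow> F \<ge> n"
    and P6: "in_vars n P \<Longrightarrow> {x \<in> Rn n. mpoly_eval P x = 0} \<in> \<Omega> n (mpoly_degree P) n"

locale presharp = o_minimal_FD +
  assumes P3_proj: "A \<in> \<Omega> F D (n + 1) \<Longrightarrow> proj n ` A \<in> \<Omega> (F + 1) D n"
    and P3_compl: "A \<in> \<Omega> F D n \<Longrightarrow> Rn n - A \<in> \<Omega> (F + 1) D n"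
    and P3_times_R: "A \<in> \<Omega> F D n \<Longrightarrow> times_R n A \<in> \<Omega> (F + 1) D (n + 1)"
    and P3_R_times: "A \<in> \<Omega> F D n \<Longrightarrow> R_times n A \<in> \<Omega> (F + 1) D (n + 1)"
    and P4: "A\<^sub>1 \<in> \<Omega> F\<^sub>1 D\<^sub>1 n \<Longrightarrow> A\<^sub>2 \<in> \<Omega> F\<^sub>2 D\<^sub>2 n \<Longrightarrow>
      A\<^sub>1 \<union> A\<^sub>2 \<in> \<Omega> (max F\<^sub>1 F\<^sub>2 + 1) (D\<^sub>1 + D\<^sub>2) n"
    and P5: "A\<^sub>1 \<in> \<Omega> F\<^sub>1 D\<^sub>1 n \<Longrightarrow> A\<^sub>2 \<in> \<Omega> F\<^sub>2 D\<^sub>2 n \<Longrightarrow>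
      A\<^sub>1 \<inter> A\<^sub>2 \<in> \<Omega> (max F\<^sub>1 F\<^sub>2 + 1) (D\<^sub>1 + D\<^sub>2) n"

locale sharply_o_minimal = o_minimal_FD +
  assumes sharp3_proj: "A \<in> \<Omega> F D (n + 1) \<Longrightarrow> proj n ` A \<in> \<Omega> F D n"
    and sharp3_compl: "A \<in> \<Omega> F D n \<Longrightarrow> Rn n - A \<in> \<Omega> F D n"
    and sharp3_times_R: "A \<in> \<Omega> F D n \<Longrightarrow> times_R n A \<in> \<Omega> (F + 1) D (n + 1)"
    and sharp3_R_times: "A \<in> \<Omega> F D n \<Longrightarrow> R_times n A \<in> \<Omega> (F + 1) D (n + 1)"
    and sharp4: "(k :: nat) \<ge> 1 \<Longrightarrow> (\<And>i. i < k \<Longrightarrow> As i \<in> \<Omega> (Fs i) (Ds i) n) \<Longrightarrow>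
      (\<Union>i<k. As i) \<in> \<Omega> (Max (Fs ` {..<k})) (\<Sum>i<k. Ds i) n"
    and sharp5: "(k :: nat) \<ge> 1 \<Longrightarrow> (\<And>i. i < k \<Longrightarrow> As i \<in> \<Omega> (Fs i) (Ds i) n) \<Longrightarrow>
      (\<Inter>i<k. As i) \<in> \<Omega> (Max (Fs ` {..<k})) (\<Sum>i<k. Ds i) n"

text \<open>
  The case \<open>k = 0\<close> has to be excluded, since \<open>n\<close> is bounded in terms of \<open>F\<close> only if some set
  \<open>X j\<close> is present. The bound on the number of cells is a polynomial in \<open>k\<close> whose coefficients
  are polynomials in \<open>D\<close>.
\<close>

definition sharp_cell_decomposition :: "(nat \<Rightarrow> point set set) \<Rightarrow> filtration \<Rightarrow> bool" where
  "sharp_cell_decomposition S \<Omega> \<longleftrightarrow>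
     (\<exists>c :: nat \<Rightarrow> nat. \<forall>F. \<exists>(N :: nat poly poly) (Q :: nat poly).
        \<forall>D k n (X :: nat \<Rightarrow> point set).
          k \<ge> 1 \<longrightarrow> n \<ge> 1 \<longrightarrow> (\<forall>j<k. X j \<in> \<Omega> F D n) \<longrightarrow>
          (\<exists>\<C>. cell_decomposition S n \<C> \<and> (\<forall>j<k. compatible \<C> (X j)) \<and>
                finite \<C> \<and> card \<C> \<le> poly (poly N [:k:]) D \<and>
                \<C> \<subseteq> \<Omega> (c F) (poly Q D) n))"

end

theory Submission
  imports Defs
begin

text \<open>
  A family \<open>\<Z>\<close> of sets controls \<open>A\<close> if every connected set that is contained in or disjoint from
  each member of \<open>\<Z>\<close> is contained in or disjoint from \<open>A\<close>. The new filtration consists of the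
  definable subsets of \<open>\<real>\<^sup>n\<close> controlled by at most \<open>M D\<^sup>M\<close> sets of format \<open>M\<close> and degree \<open>M D\<^sup>M\<close>,
  where \<open>M\<close> depends on \<open>F\<close> and \<open>n\<close> and increases when \<open>n\<close> decreases, so that a projection need not
  raise \<open>F\<close>. Boolean combinations of controlled sets are controlled by the union of the
  controlling families, at no cost in the format. For projections, connected components and
  cells it suffices that \<open>k\<close> sets of format \<open>F\<close> and degree \<open>D\<close> have a compatible cell decomposition
  with polynomially many cells, each controlled by boundedly many sets of bounded format and
  of degree linear in \<open>D\<close>. The cells themselves need not have bounded format, because being the
  \<open>i\<close>-th point of a fibre is not expressed by a formula of bounded length.

  The decomposition is cylindrical. The sections over a base cell run through fibrewise finite
  sets \<open>Y\<close> (fibrewise boundaries), and they are continuous and disjoint wherever the fibre of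
  \<open>Y\<close> varies evenly. The points of a set \<open>Z\<close> at which it does not vary evenly relative to \<open>Z\<close> form a
  set of smaller dimension, so \<open>n + 1\<close> repetitions exhaust \<open>\<real>\<^sup>n\<close>, and each stratum is given by a
  formula of bounded length. The drop in dimension comes from a countability argument over the
  rationals: the sets obtained by repeatedly demanding countable fibres outside of a small set
  form a \<open>\<sigma>\<close>-ideal, and a definable set not in it contains a box. A cell over \<open>C\<close> is clopen in
  \<open>(C \<times> \<real>) \<inter> Y\<close> or in the complement of at most two such \<open>Y\<close>, and is thus controlled by these \<open>Y\<close>
  and the sets that control \<open>C\<close>.
\<close>

section \<open>Uniformly definable families\<close>

text \<open>The obstacle is a mismatch of prices: (P3)-(P5) charge one unit of format for every
  complement, union, intersection and projection, whereas (#3)-(#5) want complements, projections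
  and arbitrarily long unions and intersections at constant format. Control makes Boolean operations
  free, but a projection of a controlled set has no evident controlling family. A decomposition
  upstairs provides one: a controlled set is a union of cells of every decomposition into connected
  cells that is compatible with its controlling sets, and the bases of these cells are controlled in
  their turn.

  The auxiliary sets whose complexity matters are given by formulas whose length depends on the
  dimension, but not on D, on k or on the given sets. Real parameters in them cost nothing, since
  (P6) sees only the degree of a polynomial. Hence the fibres over all points form one uniform
  family, and (P1) bounds the size of the finite ones polynomially in D. This is the only appeal to
  (P1); it is what makes the number of cells polynomial.\<close>

lemma Rn_iff: "x \<in> Rn n \<longleftrightarrow> (\<forall>i\<ge>n. x i = 0)"
  by (simp add: topspace_Euclidean_space)

lemma proj_in_Rn [simp]: "proj n x \<in> Rn n"
  by (simp add: Rn_iff proj_def)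

lemma proj_apply [simp]: "j < n \<Longrightarrow> proj n x j = x j" "n \<le> j \<Longrightarrow> proj n x j = 0"
  by (auto simp: proj_def)

lemma proj_id: "x \<in> Rn n \<Longrightarrow> proj n x = x"
  by (auto simp: Rn_iff proj_def fun_eq_iff)

lemma Rn_upd: "x \<in> Rn n \<Longrightarrow> x(n := y) \<in> Rn (Suc n)"
  by (auto simp: Rn_iff)

lemma Rn_proj_upd: "x \<in> Rn (Suc n) \<Longrightarrow> (proj n x)(n := x n) = x"
  by (auto simp: Rn_iff proj_def fun_eq_iff not_less Suc_le_eq)

lemma proj_upd: "x \<in> Rn n \<Longrightarrow> proj n (x(n := y)) = x"
  by (auto simp: Rn_iff proj_def fun_eq_iff)

definition blk :: "nat \<Rightarrow> nat \<Rightarrow> point \<Rightarrow> point" where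
  "blk n m z = (\<lambda>j. if j < m then z (n + j) else 0)"

lemma blk_in_Rn [simp]: "blk n m z \<in> Rn m"
  by (simp add: Rn_iff blk_def)

lemma blk_apply [simp]: "j < m \<Longrightarrow> blk n m z j = z (n + j)"
  by (simp add: blk_def)

section \<open>Sums of univariate monomials\<close>

text \<open>Exponents beyond 1 occur only for the square that expresses positivity, and exponent 0
  encodes a constant term.\<close>

definition lin :: "(real \<times> nat \<times> nat) list \<Rightarrow> mpoly" where
  "lin ts = (\<Sum>(c, a, k)\<leftarrow>ts. Poly_Mapping.single (Poly_Mapping.single a k) c)"

lemma mpoly_eval_superset:
  assumes "finite K" "Poly_Mapping.keys P \<subseteq> K"
  shows "mpoly_eval P x = (\<Sum>m\<in>K. Poly_Mapping.lookup P m *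
           (\<Prod>i\<in>Poly_Mapping.keys m. x i ^ Poly_Mapping.lookup m i))"
  unfolding mpoly_eval_def
  using assms by (intro sum.mono_neutral_left) (auto simp: in_keys_iff)

lemma mpoly_eval_add: "mpoly_eval (P + Q) x = mpoly_eval P x + mpoly_eval Q x"
proof -
  let ?K = "Poly_Mapping.keys P \<union> Poly_Mapping.keys Q"
  have "Poly_Mapping.keys (P + Q) \<subseteq> ?K"
    by (rule Poly_Mapping.keys_add)
  then show ?thesis
    by (simp add: mpoly_eval_superset[of ?K] lookup_add algebra_simps sum.distrib)
qed

lemma mpoly_eval_single:
  "mpoly_eval (Poly_Mapping.single (Poly_Mapping.single a k) c) x = c * x a ^ k"
  by (cases "c = 0"; cases "k = 0") (auto simp: mpoly_eval_def)

lemma mpoly_eval_lin: "mpoly_eval (lin ts) x = (\<Sum>(c, a, k)\<leftarrow>ts. c * x a ^ k)"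
proof (induction ts)
  case Nil
  show ?case by (simp add: lin_def mpoly_eval_def)
next
  case (Cons t ts)
  have "lin (t # ts) = (case t of (c, a, k) \<Rightarrow> Poly_Mapping.single (Poly_Mapping.single a k) c) + lin ts"
    by (simp add: lin_def)
  then show ?case
    using Cons by (auto simp: mpoly_eval_add mpoly_eval_single split: prod.splits)
qed

lemma keys_lin: "Poly_Mapping.keys (lin ts) \<subseteq> (\<lambda>(c, a, k). Poly_Mapping.single a k) ` set ts"
proof (induction ts)
  case Nil
  show ?case by (simp add: lin_def)
next
  case (Cons t ts)
  obtain c a k where t: "t = (c, a, k)" by (cases t)
  have "lin (t # ts) = Poly_Mapping.single (Poly_Mapping.single a k) c + lin ts"
    by (simp add: lin_def t)
  then have "Poly_Mapping.keys (lin (t # ts)) \<subseteq>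
      Poly_Mapping.keys (Poly_Mapping.single (Poly_Mapping.single a k) c) \<union> Poly_Mapping.keys (lin ts)"
    using Poly_Mapping.keys_add by metis
  also have "\<dots> \<subseteq> insert (Poly_Mapping.single a k) (Poly_Mapping.keys (lin ts))"
    by auto
  finally show ?case using Cons t by auto
qed

lemma in_vars_lin:
  assumes "\<And>c a k. (c, a, k) \<in> set ts \<Longrightarrow> a < n \<or> k = 0"
  shows "in_vars n (lin ts)"
  unfolding in_vars_def
proof
  fix m assume "m \<in> Poly_Mapping.keys (lin ts)"
  then obtain c a k where "(c, a, k) \<in> set ts" "m = Poly_Mapping.single a k"
    using keys_lin by fastforce
  then show "Poly_Mapping.keys m \<subseteq> {..<n}" using assms by (cases "k = 0") auto
qed

lemma mpoly_degree_lin: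
  assumes "\<And>c a k. (c, a, k) \<in> set ts \<Longrightarrow> k \<le> d"
  shows "mpoly_degree (lin ts) \<le> d"
proof -
  have "(\<Sum>i\<in>Poly_Mapping.keys m. Poly_Mapping.lookup m i) \<le> d"
    if "m \<in> Poly_Mapping.keys (lin ts)" for m
  proof -
    obtain c a k where "(c, a, k) \<in> set ts" "m = Poly_Mapping.single a k"
      using keys_lin \<open>m \<in> _\<close> by fastforce
    then show ?thesis using assms by (cases "k = 0") auto
  qed
  then show ?thesis by (auto simp: mpoly_degree_def)
qed

context FD_filtration begin

lemma Omega_mono:
  assumes "F \<le> F'" "D \<le> D'"
  shows "\<Omega> F D n \<subseteq> \<Omega> F' D' n"
proof -
  have "\<Omega> F D n \<subseteq> \<Omega> F' D n"
    using assms(1) by (rule lift_Suc_mono_le[rotated]) (use increasing in auto)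
  also have "\<dots> \<subseteq> \<Omega> F' D' n"
    using assms(2) by (rule lift_Suc_mono_le[rotated]) (use increasing in auto)
  finally show ?thesis .
qed

text \<open>The sets defined by the predicates \<open>P i\<close> have bounded format, and degree linear in the degree
  \<open>dg i\<close> of the data \<open>i\<close>. Real parameters may occur in \<open>i\<close>, since they affect neither.\<close>

definition UD :: "'i set \<Rightarrow> ('i \<Rightarrow> nat) \<Rightarrow> nat \<Rightarrow> ('i \<Rightarrow> point \<Rightarrow> bool) \<Rightarrow> bool" where
  "UD I dg n P \<longleftrightarrow> (\<exists>G K. \<forall>i\<in>I. {x \<in> Rn n. P i x} \<in> \<Omega> G (K * Suc (dg i)) n)"

lemma UD_I:
  assumes "\<And>i. i \<in> I \<Longrightarrow> {x \<in> Rn n. P i x} \<in> \<Omega> G (K * Suc (dg i)) n"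
  shows "UD I dg n P"
  using assms unfolding UD_def by blast

lemma UD_definable: "UD I dg n P \<Longrightarrow> i \<in> I \<Longrightarrow> {x \<in> Rn n. P i x} \<in> S n"
  unfolding UD_def using definable by blast

lemma UD_cong:
  assumes "UD I dg n P" "\<And>i x. i \<in> I \<Longrightarrow> x \<in> Rn n \<Longrightarrow> P i x \<longleftrightarrow> Q i x"
  shows "UD I dg n Q"
proof -
  have "{x \<in> Rn n. P i x} = {x \<in> Rn n. Q i x}" if "i \<in> I" for i
    using assms(2) that by blast
  then show ?thesis using assms(1) by (auto simp: UD_def)
qed

end

section \<open>Logical connectives, quantifiers and atomic formulas\<close>

context presharp begin

lemma UD_not: "UD I dg n P \<Longrightarrow> UD I dg n (\<lambda>i x. \<not> P i x)"
proof -
  assume "UD I dg n P"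
  then obtain G K where GK: "\<And>i. i \<in> I \<Longrightarrow> {x \<in> Rn n. P i x} \<in> \<Omega> G (K * Suc (dg i)) n"
    by (auto simp: UD_def)
  have "{x \<in> Rn n. \<not> P i x} = Rn n - {x \<in> Rn n. P i x}" for i by auto
  then show ?thesis using P3_compl[OF GK] by (intro UD_I) auto
qed

lemma UD_conj:
  assumes "UD I dg n P" "UD I dg n Q"
  shows "UD I dg n (\<lambda>i x. P i x \<and> Q i x)"
proof -
  obtain G K where 1: "\<And>i. i \<in> I \<Longrightarrow> {x \<in> Rn n. P i x} \<in> \<Omega> G (K * Suc (dg i)) n"
    using assms(1) by (auto simp: UD_def)
  obtain G' K' where 2: "\<And>i. i \<in> I \<Longrightarrow> {x \<in> Rn n. Q i x} \<in> \<Omega> G' (K' * Suc (dg i)) n"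
    using assms(2) by (auto simp: UD_def)
  have "{x \<in> Rn n. P i x \<and> Q i x} = {x \<in> Rn n. P i x} \<inter> {x \<in> Rn n. Q i x}" for i by auto
  then show ?thesis
    using P5[OF 1 2] by (intro UD_I[of _ _ _ "max G G' + 1" "K + K'"]) (auto simp: algebra_simps)
qed

lemma UD_disj: "UD I dg n P \<Longrightarrow> UD I dg n Q \<Longrightarrow> UD I dg n (\<lambda>i x. P i x \<or> Q i x)"
  using UD_not[OF UD_conj[OF UD_not UD_not]] by (rule UD_cong) auto

lemma UD_imp: "UD I dg n P \<Longrightarrow> UD I dg n Q \<Longrightarrow> UD I dg n (\<lambda>i x. P i x \<longrightarrow> Q i x)"
  using UD_disj[OF UD_not] by (rule UD_cong) auto

text \<open>The bound variable becomes the last coordinate in one dimension more. This shape of the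
  premise allows nested formulas to be taken apart by \<open>intro\<close> from the outside
  in.\<close>

lemma UD_ex:
  assumes "UD I dg (Suc n) (\<lambda>i z. Q i (proj n z) (z n))"
  shows "UD I dg n (\<lambda>i x. \<exists>y. Q i x y)"
proof -
  obtain G K where 1: "\<And>i. i \<in> I \<Longrightarrow> {z \<in> Rn (Suc n). Q i (proj n z) (z n)} \<in> \<Omega> G (K * Suc (dg i)) (Suc n)"
    using assms by (auto simp: UD_def)
  have "{x \<in> Rn n. \<exists>y. Q i x y} = proj n ` {z \<in> Rn (Suc n). Q i (proj n z) (z n)}" for i
  proof (intro set_eqI iffI)
    fix x assume "x \<in> {x \<in> Rn n. \<exists>y. Q i x y}"
    then obtain y where "x \<in> Rn n" "Q i x y" by blast
    then show "x \<in> proj n ` {z \<in> Rn (Suc n). Q i (proj n z) (z n)}"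
      by (intro image_eqI[of _ _ "x(n := y)"]) (auto simp: proj_upd Rn_upd)
  qed auto
  then show ?thesis using P3_proj[of _ _ _ n] 1 by (intro UD_I[of _ _ _ "G + 1" K]) auto
qed

lemma UD_all:
  assumes "UD I dg (Suc n) (\<lambda>i z. Q i (proj n z) (z n))"
  shows "UD I dg n (\<lambda>i x. \<forall>y. Q i x y)"
  using UD_not[OF UD_ex[OF UD_not[OF assms]]] by (rule UD_cong) auto

lemma UD_const: "UD I dg n (\<lambda>i x. P i)"
proof (rule UD_I[of _ _ _ "n + 1" 1])
  fix i
  \<comment> \<open>The whole space is the zero set of the zero polynomial, whose degree is 0 by
    convention.\<close>
  have 1: "Rn n \<in> \<Omega> n 0 n"
    using P6[of n 0] by (simp add: in_vars_def mpoly_eval_def mpoly_degree_def)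
  have 2: "{} \<in> \<Omega> (n + 1) 0 n" using P3_compl[OF 1] by simp
  have "Rn n \<in> \<Omega> (n + 1) (1 * Suc (dg i)) n" "{} \<in> \<Omega> (n + 1) (1 * Suc (dg i)) n"
    using subsetD[OF Omega_mono 1] subsetD[OF Omega_mono 2] by auto
  then show "{x \<in> Rn n. P i} \<in> \<Omega> (n + 1) (1 * Suc (dg i)) n" by (cases "P i") auto
qed

lemma UD_ball_finite:
  assumes "finite A" "\<And>a. a \<in> A \<Longrightarrow> UD I dg n (P a)"
  shows "UD I dg n (\<lambda>i x. \<forall>a\<in>A. P a i x)"
  using assms
proof (induction A rule: finite_induct)
  case empty
  show ?case using UD_const[of I dg n "\<lambda>_. True"] by (rule UD_cong) auto
next
  case (insert b A)
  then have "UD I dg n (\<lambda>i x. P b i x \<and> (\<forall>a\<in>A. P a i x))"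
    by (intro UD_conj) auto
  then show ?case by (rule UD_cong) auto
qed

lemma UD_bex_finite:
  assumes "finite A" "\<And>a. a \<in> A \<Longrightarrow> UD I dg n (P a)"
  shows "UD I dg n (\<lambda>i x. \<exists>a\<in>A. P a i x)"
  using UD_not[OF UD_ball_finite[OF assms(1) UD_not[OF assms(2)]]] by (rule UD_cong) auto

lemma UD_all_less:
  fixes m :: nat
  assumes "\<And>a. a < m \<Longrightarrow> UD I dg n (P a)"
  shows "UD I dg n (\<lambda>i x. \<forall>a<m. P a i x)"
proof -
  have "UD I dg n (\<lambda>i x. \<forall>a\<in>{..<m}. P a i x)"
    using assms by (intro UD_ball_finite) auto
  then show ?thesis by (rule UD_cong) auto
qed

text \<open>The list of terms, with its real coefficients, may vary with \<open>i\<close>, because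
  (P6) bounds format and degree by the dimension and the degree of the polynomial. For
  \<open>k = 0\<close> the variable index is irrelevant.\<close>

lemma UD_lin_eq_0:
  assumes "\<And>i c a k. i \<in> I \<Longrightarrow> (c, a, k) \<in> set (ts i) \<Longrightarrow> (a < n \<or> k = 0) \<and> k \<le> d"
  shows "UD I dg n (\<lambda>i x. (\<Sum>(c, a, k)\<leftarrow>ts i. c * x a ^ k) = 0)"
proof (rule UD_I[of _ _ _ n d])
  fix i assume i: "i \<in> I"
  have "in_vars n (lin (ts i))" by (rule in_vars_lin) (use assms[OF i] in auto)
  note P6[OF this]
  moreover have "mpoly_degree (lin (ts i)) \<le> d" by (rule mpoly_degree_lin) (use assms[OF i] in auto)
  then have "mpoly_degree (lin (ts i)) \<le> d * Suc (dg i)" by simp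
  ultimately show "{x \<in> Rn n. (\<Sum>(c, a, k)\<leftarrow>ts i. c * x a ^ k) = 0} \<in> \<Omega> n (d * Suc (dg i)) n"
    using Omega_mono[of n n] unfolding mpoly_eval_lin by blast
qed

text \<open>A real number is positive iff it is the square of a nonzero one.\<close>

lemma UD_lin_pos:
  assumes "\<And>i c a. i \<in> I \<Longrightarrow> (c, a) \<in> set (ts i) \<Longrightarrow> a < n"
  shows "UD I dg n (\<lambda>i x. b i + (\<Sum>(c, a)\<leftarrow>ts i. c * x a) > 0)"
proof -
  \<comment> \<open>Coordinate \<open>n\<close> holds the square root; the constant
    \<open>b i\<close> enters with exponent 0.\<close>
  let ?us = "\<lambda>i. (b i, 0, 0) # (-1, n, 2) # map (\<lambda>(c, a). (c, a, 1)) (ts i)"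
  have "UD I dg (Suc n) (\<lambda>i x. (\<Sum>(c, a, k)\<leftarrow>?us i. c * x a ^ k) = 0)"
    by (rule UD_lin_eq_0[where d = 2]) (use assms in \<open>fastforce simp: less_Suc_eq\<close>)
  moreover have "UD I dg (Suc n) (\<lambda>i x. (\<Sum>(c, a, k)\<leftarrow>[(1, n, 1)]. c * x a ^ k) = 0)"
    by (rule UD_lin_eq_0[where d = 1]) auto
  ultimately have *: "UD I dg (Suc n) (\<lambda>i x. (\<Sum>(c, a, k)\<leftarrow>?us i. c * x a ^ k) = 0 \<and>
      (\<Sum>(c, a, k)\<leftarrow>[(1, n, 1)]. c * x a ^ k) \<noteq> 0)"
    by (intro UD_conj UD_not)
  have eq: "(\<Sum>(c, a, k)\<leftarrow>?us i. c * x a ^ k) =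
      b i + (\<Sum>(c, a)\<leftarrow>ts i. c * proj n x a) - (x n)\<^sup>2" if "i \<in> I" for i x
  proof -
    have "(\<Sum>(c, a, k)\<leftarrow>map (\<lambda>(c, a). (c, a, 1)) (ts i). c * x a ^ k) = (\<Sum>(c, a)\<leftarrow>ts i. c * proj n x a)"
      unfolding map_map using assms[OF that]
      by (intro arg_cong[of _ _ sum_list] map_cong) (auto split: prod.splits)
    then show ?thesis by simp
  qed
  have "UD I dg n (\<lambda>i x. \<exists>y. b i + (\<Sum>(c, a)\<leftarrow>ts i. c * x a) - y\<^sup>2 = 0 \<and> y \<noteq> 0)"
  proof (rule UD_ex, rule UD_cong[OF *])
    fix i and x :: point assume i: "i \<in> I"
    show "((\<Sum>(c, a, k)\<leftarrow>?us i. c * x a ^ k) = 0 \<and> (\<Sum>(c, a, k)\<leftarrow>[(1, n, 1)]. c * x a ^ k) \<noteq> 0) \<longleftrightarrow>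
        (b i + (\<Sum>(c, a)\<leftarrow>ts i. c * proj n x a) - (x n)\<^sup>2 = 0 \<and> x n \<noteq> 0)"
      unfolding eq[OF i] by simp
  qed
  then show ?thesis
  proof (rule UD_cong)
    fix i x
    show "(\<exists>y. b i + (\<Sum>(c, a)\<leftarrow>ts i. c * x a) - y\<^sup>2 = 0 \<and> y \<noteq> 0) \<longleftrightarrow> b i + (\<Sum>(c, a)\<leftarrow>ts i. c * x a) > 0"
      (is "(\<exists>y. ?v - _ = 0 \<and> _) \<longleftrightarrow> _")
    proof
      assume "?v > 0"
      then show "\<exists>y. ?v - y\<^sup>2 = 0 \<and> y \<noteq> 0" by (intro exI[of _ "sqrt ?v"]) auto
    next
      assume "\<exists>y. ?v - y\<^sup>2 = 0 \<and> y \<noteq> 0"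
      then obtain y where "?v = y\<^sup>2" "y \<noteq> 0" by auto
      then show "?v > 0" by simp
    qed
  qed
qed

text \<open>\<open>RT n s\<close> and \<open>CT n m t\<close>: the real number \<open>s z\<close> and the point \<open>t z\<close> of \<open>\<real>\<^bsup>m\<^esup>\<close> are made of
  coordinates of \<open>z\<close>. These are the terms that may be substituted into atomic formulas.\<close>

definition RT :: "nat \<Rightarrow> (point \<Rightarrow> real) \<Rightarrow> bool" where
  "RT n s \<longleftrightarrow> (\<exists>a<n. \<forall>z\<in>Rn n. s z = z a)"

definition CT :: "nat \<Rightarrow> nat \<Rightarrow> (point \<Rightarrow> point) \<Rightarrow> bool" where
  "CT n m t \<longleftrightarrow> (\<forall>z\<in>Rn n. t z \<in> Rn m) \<and> (\<forall>j<m. RT n (\<lambda>z. t z j))"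

lemma RT_var: "a < n \<Longrightarrow> RT n (\<lambda>z. z a)"
  unfolding RT_def by blast

lemma UD_less: "RT n s \<Longrightarrow> RT n t \<Longrightarrow> UD I dg n (\<lambda>i z. s z < t z)"
proof -
  assume "RT n s" "RT n t"
  then obtain a b where a: "a < n" "\<And>z. z \<in> Rn n \<Longrightarrow> s z = z a" and b: "b < n" "\<And>z. z \<in> Rn n \<Longrightarrow> t z = z b"
    unfolding RT_def by metis
  have "UD I dg n (\<lambda>i x. 0 + (\<Sum>(c, a)\<leftarrow>[(1, b), (-1, a)]. c * x a) > 0)"
    by (rule UD_lin_pos) (use a b in auto)
  then show ?thesis by (rule UD_cong) (auto simp: a b)
qed

lemma UD_less_add: "RT n s \<Longrightarrow> RT n t \<Longrightarrow> RT n r \<Longrightarrow> UD I dg n (\<lambda>i z. s z < t z + r z)"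
proof -
  assume "RT n s" "RT n t" "RT n r"
  then obtain a b d where a: "a < n" "\<And>z. z \<in> Rn n \<Longrightarrow> s z = z a" and b: "b < n" "\<And>z. z \<in> Rn n \<Longrightarrow> t z = z b"
    and d: "d < n" "\<And>z. z \<in> Rn n \<Longrightarrow> r z = z d"
    unfolding RT_def by metis
  have "UD I dg n (\<lambda>i x. 0 + (\<Sum>(c, a)\<leftarrow>[(1, b), (-1, a), (1, d)]. c * x a) > 0)"
    by (rule UD_lin_pos) (use a b d in auto)
  then show ?thesis by (rule UD_cong) (auto simp: a b d)
qed

lemma UD_abs_less:
  "RT n s \<Longrightarrow> RT n t \<Longrightarrow> RT n r \<Longrightarrow> UD I dg n (\<lambda>i z. \<bar>s z - t z\<bar> < r z)"
  using UD_conj[OF UD_less_add[of n s t r] UD_less_add[of n t s r]] by (rule UD_cong) auto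

lemma UD_eq: "RT n s \<Longrightarrow> RT n t \<Longrightarrow> UD I dg n (\<lambda>i z. s z = t z)"
  using UD_conj[OF UD_not[OF UD_less[of n s t]] UD_not[OF UD_less[of n t s]]]
  by (rule UD_cong) auto

lemma UD_const_less: "RT n s \<Longrightarrow> UD I dg n (\<lambda>i z. c i < s z)"
proof -
  assume "RT n s"
  then obtain a where a: "a < n" "\<And>z. z \<in> Rn n \<Longrightarrow> s z = z a"
    unfolding RT_def by metis
  have "UD I dg n (\<lambda>i x. - c i + (\<Sum>(c, a)\<leftarrow>[(1, a)]. c * x a) > 0)"
    by (rule UD_lin_pos) (use a in auto)
  then show ?thesis by (rule UD_cong) (auto simp: a)
qed

lemma UD_less_const: "RT n s \<Longrightarrow> UD I dg n (\<lambda>i z. s z < c i)"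
proof -
  assume "RT n s"
  then obtain a where a: "a < n" "\<And>z. z \<in> Rn n \<Longrightarrow> s z = z a"
    unfolding RT_def by metis
  have "UD I dg n (\<lambda>i x. c i + (\<Sum>(c, a)\<leftarrow>[(-1, a)]. c * x a) > 0)"
    by (rule UD_lin_pos) (use a in auto)
  then show ?thesis by (rule UD_cong) (auto simp: a)
qed

lemma UD_eq_const: "RT n s \<Longrightarrow> UD I dg n (\<lambda>i z. s z = c i)"
  using UD_conj[OF UD_not[OF UD_less_const[of n s _ _ c]] UD_not[OF UD_const_less[of n s _ _ c]]]
  by (rule UD_cong) auto

section \<open>Blocks of variables and substitution\<close>

lemma UD_ex_block:
  assumes "UD I dg (n + m) (\<lambda>i z. Q i (proj n z) (blk n m z))"
  shows "UD I dg n (\<lambda>i x. \<exists>y\<in>Rn m. Q i x y)"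
  using assms
proof (induction m arbitrary: Q)
  case 0
  have "blk n 0 z = (\<lambda>_. 0)" for z by (auto simp: blk_def)
  moreover have "Rn 0 = {\<lambda>_. 0}" by (auto simp: Rn_iff fun_eq_iff)
  ultimately show ?case using 0 by (auto elim!: UD_cong simp: proj_id)
next
  case (Suc m)
  have "UD I dg (n + m) (\<lambda>i x. \<exists>y. Q i (proj n x) ((blk n m x)(m := y)))"
  proof (rule UD_ex, rule UD_cong)
    show "UD I dg (Suc (n + m)) (\<lambda>i z. Q i (proj n z) (blk n (Suc m) z))"
      using Suc.prems by simp
    fix i and x :: point assume "x \<in> Rn (Suc (n + m))"
    have "proj n (proj (n + m) x) = proj n x" by (auto simp: proj_def fun_eq_iff)
    moreover have "(blk n m (proj (n + m) x))(m := x (n + m)) = blk n (Suc m) x"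
      by (auto simp: blk_def fun_eq_iff)
    ultimately show "Q i (proj n x) (blk n (Suc m) x) =
        Q i (proj n (proj (n + m) x)) ((blk n m (proj (n + m) x))(m := x (n + m)))" by simp
  qed
  from Suc.IH[OF this] show ?case
  proof (rule UD_cong)
    fix i x
    show "(\<exists>y\<in>Rn m. \<exists>t. Q i x (y(m := t))) \<longleftrightarrow> (\<exists>y\<in>Rn (Suc m). Q i x y)"
      by (metis Rn_upd Rn_proj_upd proj_in_Rn)
  qed
qed

lemma UD_all_block:
  assumes "UD I dg (n + m) (\<lambda>i z. Q i (proj n z) (blk n m z))"
  shows "UD I dg n (\<lambda>i x. \<forall>y\<in>Rn m. Q i x y)"
  using UD_not[OF UD_ex_block[OF UD_not[OF assms]]] by (rule UD_cong) auto

text \<open>Every fresh coordinate in front costs one product \<open>R_times\<close>, hence one unit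
  of format, which is harmless since \<open>k\<close> is fixed by the formula.\<close>

lemma UD_shift:
  assumes "UD I dg m P"
  shows "UD I dg (m + k) (\<lambda>i z. P i (\<lambda>j. z (j + k)))"
proof (induction k)
  case 0
  show ?case using assms by simp
next
  case (Suc k)
  then obtain G K where GK: "\<And>i. i \<in> I \<Longrightarrow>
      {x \<in> Rn (m + k). P i (\<lambda>j. x (j + k))} \<in> \<Omega> G (K * Suc (dg i)) (m + k)"
    by (auto simp: UD_def)
  have "{x \<in> Rn (m + Suc k). P i (\<lambda>j. x (j + Suc k))} =
      R_times (m + k) {x \<in> Rn (m + k). P i (\<lambda>j. x (j + k))}" for i
    by (auto simp: R_times_def Rn_iff add.commute)
  then show ?case using P3_R_times[OF GK] by (intro UD_I[of _ _ _ "G + 1" K]) auto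
qed

text \<open>Substitution is written as a quantifier: some \<open>y\<close> that equals the tuple of
  the chosen coordinates satisfies \<open>P\<close>. So permuted and repeated coordinates require no
  closure property beyond those of the structure.\<close>

lemma UD_subst:
  assumes "UD I dg m P" "CT n m t"
  shows "UD I dg n (\<lambda>i z. P i (t z))"
proof -
  obtain \<sigma> where \<sigma>: "\<And>j. j < m \<Longrightarrow> \<sigma> j < n" "\<And>j z. j < m \<Longrightarrow> z \<in> Rn n \<Longrightarrow> t z j = z (\<sigma> j)"
    using assms(2) unfolding CT_def RT_def by metis
  \<comment> \<open>The copy of \<open>P\<close> lives on the coordinates from \<open>n\<close> on,
    tied to the first \<open>n\<close> by equations.\<close>
  have "UD I dg (n + m) (\<lambda>i z. P i (\<lambda>j. z (j + n)) \<and> (\<forall>j<m. z (n + j) = z (\<sigma> j)))"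
    using UD_shift[OF assms(1), of n] \<sigma>(1)
    by (intro UD_conj UD_all_less UD_eq RT_var) (auto simp: add.commute intro: trans_less_add2)
  then have "UD I dg n (\<lambda>i x. \<exists>y\<in>Rn m. P i y \<and> (\<forall>j<m. y j = x (\<sigma> j)))"
  proof (rule UD_ex_block[OF UD_cong])
    fix i z assume "z \<in> Rn (n + m)"
    then have "(\<lambda>j. z (j + n)) = blk n m z"
      by (auto simp: blk_def fun_eq_iff Rn_iff add.commute)
    then show "(P i (\<lambda>j. z (j + n)) \<and> (\<forall>j<m. z (n + j) = z (\<sigma> j))) \<longleftrightarrow>
        (P i (blk n m z) \<and> (\<forall>j<m. blk n m z j = proj n z (\<sigma> j)))"
      using \<sigma>(1) by simp
  qed
  then show ?thesis
  proof (rule UD_cong)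
    fix i x assume x: "x \<in> Rn n"
    have tx: "t x \<in> Rn m" using assms(2) x by (auto simp: CT_def)
    have *: "y = t x" if "y \<in> Rn m" "\<forall>j<m. y j = x (\<sigma> j)" for y
    proof
      fix j
      show "y j = t x j"
        using that tx \<sigma>(2)[OF _ x] by (cases "j < m") (simp_all add: Rn_iff)
    qed
    have "\<forall>j<m. t x j = x (\<sigma> j)" using \<sigma>(2)[OF _ x] by blast
    with * tx show "(\<exists>y\<in>Rn m. P i y \<and> (\<forall>j<m. y j = x (\<sigma> j))) \<longleftrightarrow> P i (t x)"
      by blast
  qed
qed

text \<open>The instance of \<open>UD_subst\<close> for membership: its pattern is rigid enough for
  \<open>intro\<close>, whereas a free predicate would match every formula.\<close>

lemma UD_mem:
  assumes "UD I dg m (\<lambda>i z. z \<in> X i)" "CT n m t"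
  shows "UD I dg n (\<lambda>i z. t z \<in> X i)"
  by (rule UD_subst[OF assms])

lemma CT_upd:
  assumes "CT n m t" "RT n s"
  shows "CT n (Suc m) (\<lambda>z. (t z)(m := s z))"
  using assms unfolding CT_def by (auto simp: Rn_upd less_Suc_eq)

lemma CT_id: "CT n n (\<lambda>z. z)"
  by (auto simp: CT_def intro: RT_var)

lemma CT_blk: "n + m \<le> N \<Longrightarrow> CT N m (blk n m)"
  unfolding CT_def by (auto intro!: RT_var)

end

section \<open>Small sets and dimension\<close>

lemma proj_proj [simp]: "n \<le> m \<Longrightarrow> proj n (proj m z) = proj n z"
  by (auto simp: proj_def fun_eq_iff)

lemma blk_proj [simp]: "n + m \<le> N \<Longrightarrow> blk n m (proj N z) = blk n m z"
  by (auto simp: blk_def proj_def fun_eq_iff)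

lemma finite_pos_lower_bound:
  fixes f :: "nat \<Rightarrow> real"
  assumes "\<And>j. j < n \<Longrightarrow> f j > 0"
  shows "\<exists>d>0. \<forall>j<n. d \<le> f j"
  using assms
proof (induction n)
  case 0
  show ?case by (intro exI[of _ 1]) auto
next
  case (Suc n)
  then obtain d where "d > 0" "\<forall>j<n. d \<le> f j" by auto
  then show ?case
    using Suc.prems[of n] by (intro exI[of _ "min d (f n)"]) (auto simp: less_Suc_eq min_le_iff_disj)
qed

text \<open>The endpoints are rational so that only countably many intervals are in play when small
  sets are united.\<close>

lemma finite_isolated:
  fixes t :: real
  assumes "finite T" "e > 0"
  shows "\<exists>p q :: rat. of_rat p < t \<and> t < of_rat q \<and> t - e < of_rat p \<and> of_rat q < t + e \<and>
           (\<forall>t'\<in>T. of_rat p < t' \<and> t' < of_rat q \<longrightarrow> t' = t)"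
proof -
  have "\<exists>d>0. \<forall>t'\<in>T - {t}. d \<le> dist t t'"
    using finite_set_avoid[OF assms(1), of t] by auto
  then obtain d where d: "d > 0" "\<forall>t'\<in>T - {t}. d \<le> dist t t'" by blast
  obtain p where p: "t - min d e < of_rat p" "of_rat p < t"
    using of_rat_dense[of "t - min d e" t] d assms(2) by auto
  obtain q where q: "t < of_rat q" "of_rat q < t + min d e"
    using of_rat_dense[of t "t + min d e"] d assms(2) by auto
  have "t' = t" if "t' \<in> T" "of_rat p < t'" "t' < of_rat q" for t'
  proof (rule ccontr)
    assume "t' \<noteq> t"
    then have "d \<le> dist t t'" using that d by auto
    then show False using that p q by (auto simp: dist_real_def)
  qed
  then show ?thesis using p q by (intro exI[of _ p] exI[of _ q]) auto
qed

definition fib :: "nat \<Rightarrow> point set \<Rightarrow> point \<Rightarrow> real set" where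
  "fib n T x = {y. x(n := y) \<in> T}"

section \<open>Definable subsets of the line\<close>

lemma basic_cell_line:
  assumes "basic_cell C"
  shows "(\<exists>a. {y. (\<lambda>_. 0)(0 := y) \<in> C} = {a}) \<or>
         (\<exists>a b :: ereal. a < b \<and> {y. (\<lambda>_. 0)(0 := y) \<in> C} = {y. a < ereal y \<and> ereal y < b})"
  using assms
proof cases
  case (point a)
  have "{y. (\<lambda>_. 0)(0 := y) \<in> C} = {a}" unfolding point(1) by (auto simp: Rn_iff)
  then show ?thesis by blast
next
  case (interval a b)
  have "{y. (\<lambda>_. 0)(0 := y) \<in> C} = {y. a < ereal y \<and> ereal y < b}"
    unfolding interval(1) by (auto simp: Rn_iff)
  then show ?thesis using interval(2) by blast
qed

lemma ereal_interval_real: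
  assumes "(a::ereal) < b"
  shows "\<exists>p q :: real. p < q \<and> {p<..<q} \<subseteq> {y. a < ereal y \<and> ereal y < b}"
proof -
  obtain p where p: "a < ereal p" "ereal p < b" using ereal_dense2[OF assms] by auto
  obtain q where q: "ereal p < ereal q" "ereal q < b" using ereal_dense2[OF p(2)] by auto
  have "a < ereal y \<and> ereal y < b" if "p < y" "y < q" for y
    using that p q by (meson ereal_less_eq(3) less_imp_le order.strict_trans2 order.strict_trans1)
  then show ?thesis using q by (intro exI[of _ p] exI[of _ q]) auto
qed

lemma frontier_ereal_interval:
  fixes a b :: ereal
  shows "finite (frontier {y. a < ereal y \<and> ereal y < b})"
proof -
  have "open {y. a < ereal y \<and> ereal y < b}"
    by (intro open_Collect_conj open_Collect_less continuous_intros)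
  moreover have "closure {y. a < ereal y \<and> ereal y < b} \<subseteq> {y. a \<le> ereal y \<and> ereal y \<le> b}"
  proof (rule closure_minimal)
    show "closed {y. a \<le> ereal y \<and> ereal y \<le> b}"
      by (intro closed_Collect_conj closed_Collect_le continuous_intros)
  qed (auto intro: less_imp_le)
  ultimately have "frontier {y. a < ereal y \<and> ereal y < b} \<subseteq> {y. ereal y = a \<or> ereal y = b}"
    by (auto simp: frontier_def interior_open)
  also have "\<dots> \<subseteq> {real_of_ereal a, real_of_ereal b}" by auto
  finally show ?thesis by (rule finite_subset) auto
qed

lemma finite_frontier_Union:
  "finite \<A> \<Longrightarrow> (\<And>A. A \<in> \<A> \<Longrightarrow> finite (frontier A)) \<Longrightarrow> finite (frontier (\<Union>\<A>))"
proof (induction \<A> rule: finite_induct)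
  case (insert A \<A>)
  have "frontier (\<Union>(insert A \<A>)) \<subseteq> frontier A \<union> frontier (\<Union>\<A>)"
    using frontier_Un_subset by auto
  then show ?case using insert by (auto intro: finite_subset)
qed auto

context o_minimal begin

lemma line_definable:
  assumes "A \<in> S 1" and B: "B = {y. (\<lambda>_. 0)(0 := y) \<in> A}"
  shows "finite B \<or> (\<exists>p q. p < q \<and> {p<..<q} \<subseteq> B)" "finite (frontier B)"
proof -
  obtain \<C> where \<C>: "finite \<C>" "\<forall>C\<in>\<C>. basic_cell C" "A = \<Union>\<C>"
    using assms(1) unfolding tame by blast
  define l where "l C = {y::real. (\<lambda>_. 0)(0 := y) \<in> C}" for C :: "point set"
  have BU: "B = \<Union>(l ` \<C>)" by (auto simp: B \<C> l_def)
  have cell: "(\<exists>a. l C = {a}) \<or> (\<exists>a b :: ereal. a < b \<and> l C = {y. a < ereal y \<and> ereal y < b})"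
    if "C \<in> \<C>" for C
    using basic_cell_line that \<C>(2) by (simp add: l_def)
  show "finite B \<or> (\<exists>p q. p < q \<and> {p<..<q} \<subseteq> B)"
  proof (cases "\<forall>C\<in>\<C>. \<exists>a. l C = {a}")
    case True
    then have "finite B" unfolding BU using \<C>(1) by (intro finite_Union) auto
    then show ?thesis ..
  next
    case False
    then obtain C and a b :: ereal where "C \<in> \<C>" "a < b" "l C = {y. a < ereal y \<and> ereal y < b}"
      using cell by blast
    then show ?thesis using ereal_interval_real[of a b] BU by blast
  qed
  show "finite (frontier B)"
    unfolding BU using \<C>(1) cell frontier_ereal_interval
    by (intro finite_frontier_Union) (auto, metis finite.emptyI finite_insert frontier_closed finite_subset closed_singleton frontier_subset_closed)
qed

end

definition pick :: "nat \<Rightarrow> (nat \<Rightarrow> nat) \<Rightarrow> point \<Rightarrow> point" where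
  "pick d \<iota> z = (\<lambda>j. if j < d then z (\<iota> j) else 0)"

lemma pick_in_Rn [simp]: "pick d \<iota> z \<in> Rn d"
  by (simp add: pick_def Rn_iff)

lemma pick_eq_iff: "u \<in> Rn d \<Longrightarrow> pick d \<iota> z = u \<longleftrightarrow> (\<forall>j<d. z (\<iota> j) = u j)"
  unfolding pick_def Rn_iff fun_eq_iff by (metis not_le)

section \<open>The ideal of small sets\<close>

text \<open>An iterated Fubini product of the ideal of countable sets. It is defined for arbitrary
  sets, because countable unions of definable sets may fail to be definable.\<close>

primrec small :: "nat \<Rightarrow> point set \<Rightarrow> bool" where
  "small 0 T \<longleftrightarrow> T = {}"
| "small (Suc d) T \<longleftrightarrow> small d {u \<in> Rn d. uncountable (fib d T u)}"

lemma small_mono: "small d T \<Longrightarrow> T' \<subseteq> T \<Longrightarrow> small d T'"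
proof (induction d arbitrary: T T')
  case (Suc d)
  have "{u \<in> Rn d. uncountable (fib d T' u)} \<subseteq> {u \<in> Rn d. uncountable (fib d T u)}"
  proof -
    have "fib d T' u \<subseteq> fib d T u" for u using Suc.prems(2) by (auto simp: fib_def)
    then show ?thesis using countable_subset by blast
  qed
  then show ?case using Suc by auto
qed auto

lemma small_UN:
  "countable A \<Longrightarrow> (\<And>a. a \<in> A \<Longrightarrow> small d (T a)) \<Longrightarrow> small d (\<Union>a\<in>A. T a)"
proof (induction d arbitrary: T)
  case (Suc d)
  have "fib d (\<Union>a\<in>A. T a) u = (\<Union>a\<in>A. fib d (T a) u)" for u
    by (auto simp: fib_def)
  then have "{u \<in> Rn d. uncountable (fib d (\<Union>a\<in>A. T a) u)} \<subseteq>
      (\<Union>a\<in>A. {u \<in> Rn d. uncountable (fib d (T a) u)})"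
    using Suc.prems(1) by auto
  moreover have "small d (\<Union>a\<in>A. {u \<in> Rn d. uncountable (fib d (T a) u)})"
    using Suc by auto
  ultimately show ?case by (auto intro: small_mono)
qed auto

lemma small_Un:
  assumes "small d T" "small d T'"
  shows "small d (T \<union> T')"
proof -
  have "small d (\<Union>b\<in>UNIV. if b then T else T')"
    using assms by (intro small_UN) (auto intro: uncountable_infinite)
  then show ?thesis by (rule small_mono) (auto split: if_splits)
qed

context presharp begin

text \<open>Plain definability is the case of a one-element index set, so the same closure rules
  serve for both.\<close>

abbreviation (input) DF :: "nat \<Rightarrow> (point \<Rightarrow> bool) \<Rightarrow> bool" where
  "DF n P \<equiv> UD (UNIV :: unit set) (\<lambda>_. 0) n (\<lambda>_. P)"

lemma DF_iff: "DF n P \<longleftrightarrow> {x \<in> Rn n. P x} \<in> S n"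
proof
  show "DF n P \<Longrightarrow> {x \<in> Rn n. P x} \<in> S n"
    using UD_definable[of UNIV "\<lambda>_. 0" n "\<lambda>_. P" "()"] by simp
next
  assume "{x \<in> Rn n. P x} \<in> S n"
  then obtain F D where "{x \<in> Rn n. P x} \<in> \<Omega> F D n" using exhaustive by blast
  then show "DF n P" by (intro UD_I[of _ _ _ F D]) auto
qed

lemma DF_mem: "A \<in> S n \<Longrightarrow> DF n (\<lambda>x. x \<in> A)"
proof -
  assume "A \<in> S n"
  moreover from this have "{x \<in> Rn n. x \<in> A} = A" using subset_Rn by blast
  ultimately show ?thesis by (simp add: DF_iff)
qed

lemma CT_proj_self:
  assumes "n \<le> N"
  shows "CT N n (proj n)"
proof -
  have "RT N (\<lambda>z. proj n z j)" if "j < n" for j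
    using RT_var[of j N] that assms by simp
  then show ?thesis by (simp add: CT_def)
qed

text \<open>With these rules a definability proof follows the syntax of the formula;
  \<open>UD_terms\<close> settles the coordinate terms that remain.\<close>

lemmas UD_intros = UD_not UD_conj UD_disj UD_imp UD_ex UD_all UD_all_less UD_ex_block UD_all_block
  UD_abs_less UD_less UD_eq UD_const_less UD_less_const UD_eq_const CT_upd

lemmas UD_terms = RT_var CT_proj_self CT_id CT_blk

text \<open>The coordinates of \<open>p i\<close> enter as constants in linear equations, hence as
  parameters, so the bounds are uniform over all base points.\<close>

lemma UD_fib:
  assumes X: "UD I dg (Suc n) (\<lambda>i z. z \<in> X i)" and p: "\<And>i. i \<in> I \<Longrightarrow> p i \<in> Rn n"
  shows "UD I dg 1 (\<lambda>i w. w 0 \<in> fib n (X i) (p i))"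
proof -
  have "UD I dg 1 (\<lambda>i w. \<exists>x\<in>Rn n. (\<forall>j<n. x j = p i j) \<and> x(n := w 0) \<in> X i)"
    by (intro UD_intros UD_mem[OF X]) (simp_all add: UD_terms)
  then show ?thesis
  proof (rule UD_cong)
    fix i and w :: point assume "i \<in> I"
    have "x = p i" if "x \<in> Rn n" "\<forall>j<n. x j = p i j" for x
    proof
      fix j show "x j = p i j"
        using that p[OF \<open>i \<in> I\<close>] by (cases "j < n") (simp_all add: Rn_iff)
    qed
    then show "(\<exists>x\<in>Rn n. (\<forall>j<n. x j = p i j) \<and> x(n := w 0) \<in> X i) \<longleftrightarrow> w 0 \<in> fib n (X i) (p i)"
      using p[OF \<open>i \<in> I\<close>] by (auto simp: fib_def)
  qed
qed

lemma line_DF: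
  assumes "DF 1 (\<lambda>w. w 0 \<in> B)"
  shows "finite B \<or> (\<exists>p q. p < q \<and> {p<..<q} \<subseteq> B)" "finite (frontier B)"
proof -
  have "{x \<in> Rn 1. x 0 \<in> B} \<in> S 1" using assms by (simp add: DF_iff)
  moreover have "B = {y. (\<lambda>_. 0)(0 := y) \<in> {x \<in> Rn 1. x 0 \<in> B}}" by (auto simp: Rn_iff)
  ultimately show "finite B \<or> (\<exists>p q. p < q \<and> {p<..<q} \<subseteq> B)" "finite (frontier B)"
    using line_definable by blast+
qed

lemma fib_definable:
  assumes "T \<in> S (Suc n)" "x \<in> Rn n"
  shows "finite (fib n T x) \<or> (\<exists>p q. p < q \<and> {p<..<q} \<subseteq> fib n T x)" "finite (frontier (fib n T x))"
  using line_DF[OF UD_fib[OF DF_mem[OF assms(1)]]] assms(2) by auto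

text \<open>An uncountable definable fibre contains a rational interval, so countably many definable
  sets cover the base.\<close>

lemma not_small_contains_box:
  assumes "T \<in> S d" "\<not> small d T"
  shows "\<exists>a b. (\<forall>j<d. a j < b j) \<and> {x \<in> Rn d. \<forall>j<d. a j < x j \<and> x j < b j} \<subseteq> T"
  using assms
proof (induction d arbitrary: T)
  case 0
  then obtain x where x: "x \<in> T" by auto
  have "y = x" if "y \<in> Rn 0" for y
    using that x subset_Rn[OF 0(1)] by (force simp: Rn_iff)
  then have "Rn 0 \<subseteq> T" using x by blast
  then show ?case by auto
next
  case (Suc d)
  define V where "V r = {u \<in> Rn d. \<forall>y. of_rat (fst r) < y \<and> y < of_rat (snd r) \<longrightarrow> u(d := y) \<in> T}"
    for r :: "rat \<times> rat"
  let ?A = "{r :: rat \<times> rat. fst r < snd r}"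
  have "{u \<in> Rn d. uncountable (fib d T u)} \<subseteq> (\<Union>r\<in>?A. V r)"
  proof
    fix u assume u: "u \<in> {u \<in> Rn d. uncountable (fib d T u)}"
    then have "\<not> finite (fib d T u)" by (auto dest: countable_finite)
    then obtain p q where pq: "p < q" "{p<..<q} \<subseteq> fib d T u"
      using fib_definable(1)[OF Suc.prems(1), of u] u by blast
    obtain r where r: "p < of_rat r" "of_rat r < q" using of_rat_dense pq(1) by blast
    obtain s where s: "of_rat r < (of_rat s :: real)" "of_rat s < q" using of_rat_dense r(2) by blast
    have "u \<in> V (r, s)" using u pq(2) r s by (auto simp: V_def fib_def subset_iff)
    then show "u \<in> (\<Union>r\<in>?A. V r)" using s(1) by (force simp: of_rat_less)
  qed
  moreover have "\<not> small d {u \<in> Rn d. uncountable (fib d T u)}" using Suc.prems(2) by simp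
  ultimately have "\<not> small d (\<Union>r\<in>?A. V r)" using small_mono by blast
  then obtain r where r: "fst r < snd r" "\<not> small d (V r)"
    using small_UN[of ?A d V] by blast
  have "DF d (\<lambda>u. \<forall>y. of_rat (fst r) < y \<and> y < of_rat (snd r) \<longrightarrow> u(d := y) \<in> T)"
    by (intro UD_intros UD_mem[OF DF_mem[OF Suc.prems(1)]]) (simp_all add: UD_terms)
  then have "V r \<in> S d" by (simp add: DF_iff V_def)
  then obtain a b where ab: "\<forall>j<d. a j < b j" "{x \<in> Rn d. \<forall>j<d. a j < x j \<and> x j < b j} \<subseteq> V r"
    using Suc.IH r(2) by blast
  have "{x \<in> Rn (Suc d). \<forall>j<Suc d. (a(d := of_rat (fst r))) j < x j \<and> x j < (b(d := of_rat (snd r))) j} \<subseteq> T"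
  proof
    fix x assume x: "x \<in> {x \<in> Rn (Suc d). \<forall>j<Suc d. (a(d := of_rat (fst r))) j < x j \<and> x j < (b(d := of_rat (snd r))) j}"
    then have "proj d x \<in> V r" using ab(2) by (fastforce simp: less_Suc_eq)
    then have "(proj d x)(d := x d) \<in> T" using x by (auto simp: V_def)
    then show "x \<in> T" using x Rn_proj_upd by simp
  qed
  then show ?case
    using ab(1) r(1) by (intro exI[of _ "a(d := of_rat (fst r))"] exI[of _ "b(d := of_rat (snd r))"])
      (auto simp: less_Suc_eq of_rat_less)
qed

end

section \<open>Frontiers, uneven points and the drop in dimension\<close>

text \<open>Lists of pairs of rationals form a countable type, so a union over all boxes is a
  countable union.\<close>

definition inbox :: "nat \<Rightarrow> (rat \<times> rat) list \<Rightarrow> point \<Rightarrow> bool" where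
  "inbox n R z \<longleftrightarrow> (\<forall>i<n. of_rat (fst (R ! i)) < z i \<and> z i < of_rat (snd (R ! i)))"

text \<open>For definable \<open>Z\<close>, smallness of all projections to \<open>\<real>\<^bsup>d\<^esup>\<close> means \<open>dim Z < d\<close>.\<close>

definition dim_less :: "nat \<Rightarrow> nat \<Rightarrow> point set \<Rightarrow> bool" where
  "dim_less n d Z \<longleftrightarrow> (\<forall>\<iota>. (\<forall>j<d. \<iota> j < n) \<longrightarrow> small d (pick d \<iota> ` Z))"

lemma dim_less_mono: "dim_less n d Z \<Longrightarrow> Z' \<subseteq> Z \<Longrightarrow> dim_less n d Z'"
  unfolding dim_less_def by (meson image_mono small_mono)

lemma dim_less_UN:
  assumes "countable A" "\<And>a. a \<in> A \<Longrightarrow> dim_less n d (T a)"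
  shows "dim_less n d (\<Union>a\<in>A. T a)"
  using assms unfolding dim_less_def image_UN by (intro allI impI small_UN) auto

text \<open>The points of \<open>V\<close> that adhere to \<open>Z - V\<close>, that is, those not
  interior to \<open>V\<close> relative to \<open>Z\<close>. Nearness is spelled out in coordinates
  to make this a formula.\<close>

definition inner_frontier :: "nat \<Rightarrow> point set \<Rightarrow> point set \<Rightarrow> point set" where
  "inner_frontier n Z V =
     {x \<in> Rn n. x \<in> V \<and> (\<forall>e. 0 < e \<longrightarrow> (\<exists>x'\<in>Rn n. x' \<in> Z \<and> (\<forall>j<n. \<bar>x' j - x j\<bar> < e) \<and> \<not> x' \<in> V))}"

text \<open>If \<open>e\<close> is at most half the smallest gap in the fibre over
  \<open>x0\<close>, this says that the two fibres are in bijection by a map that moves points by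
  less than \<open>e\<close>. It is stated without the bijection, as a first-order formula.\<close>

definition fib_close :: "nat \<Rightarrow> point set \<Rightarrow> point \<Rightarrow> real \<Rightarrow> point \<Rightarrow> bool" where
  "fib_close n Y x0 e x \<longleftrightarrow>
     (\<forall>y. x(n := y) \<in> Y \<longrightarrow> (\<exists>y0. x0(n := y0) \<in> Y \<and> \<bar>y - y0\<bar> < e)) \<and>
     (\<forall>y0. x0(n := y0) \<in> Y \<longrightarrow> (\<exists>y. x(n := y) \<in> Y \<and> \<bar>y - y0\<bar> < e \<and>
        (\<forall>y'. x(n := y') \<in> Y \<longrightarrow> \<bar>y' - y0\<bar> < e \<longrightarrow> y' = y)))"

text \<open>The threshold \<open>e0\<close> is due to the uniqueness clause of
  \<open>fib_close\<close>, which fails as soon as \<open>e\<close> exceeds the gaps of the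
  fibre.\<close>

definition evenly :: "nat \<Rightarrow> point set \<Rightarrow> point set \<Rightarrow> point \<Rightarrow> bool" where
  "evenly n Z Y x0 \<longleftrightarrow> (\<exists>e0. 0 < e0 \<and> (\<forall>e. 0 < e \<longrightarrow> e < e0 \<longrightarrow> (\<exists>d. 0 < d \<and>
     (\<forall>x\<in>Rn n. x \<in> Z \<longrightarrow> (\<forall>j<n. \<bar>x j - x0 j\<bar> < d) \<longrightarrow> fib_close n Y x0 e x))))"

context presharp begin

lemma inner_frontier_definable:
  assumes "Z \<in> S n" "V \<in> S n"
  shows "inner_frontier n Z V \<in> S n"
proof -
  have "DF n (\<lambda>x. x \<in> V \<and> (\<forall>e. 0 < e \<longrightarrow> (\<exists>x'\<in>Rn n. x' \<in> Z \<and> (\<forall>j<n. \<bar>x' j - x j\<bar> < e) \<and> \<not> x' \<in> V)))"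
    by (intro UD_intros UD_mem[OF DF_mem[OF assms(1)]] UD_mem[OF DF_mem[OF assms(2)]])
      (simp_all add: UD_terms)
  then show ?thesis by (simp add: DF_iff inner_frontier_def)
qed

text \<open>Over a box of \<open>\<real>\<^bsup>d\<^esup>\<close> on which a rational box isolates one point of the fibre of \<open>Z\<close>, that
  point cannot be in the inner frontier of \<open>V\<close>.\<close>

lemma dim_less_inner_frontier:
  assumes Z: "Z \<in> S n" and V: "V \<in> S n" "V \<subseteq> Z" and dim: "dim_less n (Suc d) Z"
  shows "dim_less n d (inner_frontier n Z V)"
  unfolding dim_less_def
proof (intro allI impI)
  fix \<iota> :: "nat \<Rightarrow> nat" assume \<iota>: "\<forall>j<d. \<iota> j < n"
  define E where "E = inner_frontier n Z V"
  have E: "E \<in> S n" unfolding E_def by (rule inner_frontier_definable[OF Z V(1)])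
  have ZR: "Z \<subseteq> Rn n" by (rule subset_Rn[OF Z])
  have EV: "E \<subseteq> V" by (auto simp: E_def inner_frontier_def)
  \<comment> \<open>\<open>T i\<close> appends coordinate \<open>i\<close> to the \<open>d\<close>
    chosen ones. The hypothesis on dimension makes its fibres countable outside of the small set
    \<open>N i\<close>, hence finite by o-minimality.\<close>
  define T where "T i = pick (Suc d) (\<iota>(d := i)) ` Z" for i
  define N where "N i = {u \<in> Rn d. uncountable (fib d (T i) u)}" for i
  \<comment> \<open>Over \<open>u\<close> in \<open>U R\<close> the box \<open>R\<close> contains
    exactly one point of \<open>Z\<close>, and this point belongs to the inner frontier.\<close>
  define U where "U R = {u \<in> Rn d. \<exists>z\<in>Rn n. z \<in> E \<and> inbox n R z \<and> (\<forall>j<d. z (\<iota> j) = u j) \<and>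
    (\<forall>z'\<in>Rn n. z' \<in> Z \<longrightarrow> inbox n R z' \<longrightarrow> (\<forall>j<d. z' (\<iota> j) = u j) \<longrightarrow> (\<forall>j<n. z' j = z j))}" for R
  have fibT: "fib d (T i) u = {t. \<exists>z\<in>Rn n. z \<in> Z \<and> (\<forall>j<d. z (\<iota> j) = u j) \<and> z i = t}" if "u \<in> Rn d" for i u
  proof -
    have *: "u(d := t) = pick (Suc d) (\<iota>(d := i)) z \<longleftrightarrow> (\<forall>j<d. z (\<iota> j) = u j) \<and> z i = t" for t z
    proof -
      have "pick (Suc d) (\<iota>(d := i)) z = u(d := t) \<longleftrightarrow> (\<forall>j<d. z (\<iota> j) = u j) \<and> z i = t"
        unfolding pick_eq_iff[OF Rn_upd[OF that]] All_less_Suc by (simp add: conj_commute)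
      then show ?thesis by (metis (no_types))
    qed
    have "fib d (T i) u = {t. \<exists>z\<in>Z. (\<forall>j<d. z (\<iota> j) = u j) \<and> z i = t}"
      unfolding fib_def T_def image_iff * ..
    then show ?thesis using ZR by blast
  qed
  have fibT_fin: "finite (fib d (T i) u)" if "u \<in> Rn d" "u \<notin> N i" "i < n" for i u
  proof -
    have "DF 1 (\<lambda>w. \<exists>z\<in>Rn n. z \<in> Z \<and> (\<forall>j<d. z (\<iota> j) = u j) \<and> z i = w 0)"
      by (intro UD_intros UD_mem[OF DF_mem[OF Z]]) (use \<iota> that(3) in \<open>simp_all add: UD_terms\<close>)
    then have "DF 1 (\<lambda>w. w 0 \<in> fib d (T i) u)" by (simp add: fibT[OF that(1)])
    from line_DF(1)[OF this] show ?thesis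
    proof
      assume "\<exists>p q. p < q \<and> {p<..<q} \<subseteq> fib d (T i) u"
      then have "uncountable (fib d (T i) u)"
        by (meson countable_subset uncountable_open_interval)
      then show ?thesis using that by (simp add: N_def)
    qed
  qed
  have "pick d \<iota> ` E \<subseteq> (\<Union>i<n. N i) \<union> (\<Union>R. U R)"
  proof
    fix u assume "u \<in> pick d \<iota> ` E"
    then obtain z where z: "z \<in> E" "u = pick d \<iota> z" by blast
    have uR: "u \<in> Rn d" by (simp add: z)
    have zu: "\<forall>j<d. z (\<iota> j) = u j" using pick_eq_iff[OF uR] z(2) by blast
    show "u \<in> (\<Union>i<n. N i) \<union> (\<Union>R. U R)"
    proof (cases "u \<in> (\<Union>i<n. N i)")
      case False
      have "\<exists>r :: rat \<times> rat. of_rat (fst r) < z i \<and> z i < of_rat (snd r) \<and>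
          (\<forall>t\<in>fib d (T i) u. of_rat (fst r) < t \<and> t < of_rat (snd r) \<longrightarrow> t = z i)" if "i < n" for i
        using finite_isolated[OF fibT_fin[OF uR], of i 1 "z i"] False that by force
      then obtain r :: "nat \<Rightarrow> rat \<times> rat" where r: "\<And>i. i < n \<Longrightarrow> of_rat (fst (r i)) < z i \<and> z i < of_rat (snd (r i)) \<and>
          (\<forall>t\<in>fib d (T i) u. of_rat (fst (r i)) < t \<and> t < of_rat (snd (r i)) \<longrightarrow> t = z i)"
        by metis
      have "u \<in> U (map r [0..<n])"
        unfolding U_def inbox_def
      proof (intro CollectI conjI uR bexI[of _ z] ballI impI allI)
        fix z' j assume *: "z' \<in> Rn n" "z' \<in> Z" "\<forall>i<n. of_rat (fst (map r [0..<n] ! i)) < z' i \<and> z' i < of_rat (snd (map r [0..<n] ! i))"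
          "\<forall>j<d. z' (\<iota> j) = u j" "j < n"
        have "z' j \<in> fib d (T j) u" using * fibT[OF uR] by blast
        then show "z' j = z j" using r[OF \<open>j < n\<close>] * by auto
      qed (use z zu r EV V ZR in auto)
      then show ?thesis by blast
    qed blast
  qed
  moreover have "small d (\<Union>i<n. N i)"
  proof (rule small_UN)
    fix i assume "i \<in> {..<n}"
    then have "small (Suc d) (T i)"
      using dim \<iota> unfolding dim_less_def T_def by (auto simp: less_Suc_eq)
    then show "small d (N i)" by (simp add: N_def)
  qed simp
  moreover have "small d (U R)" for R
  proof (rule ccontr)
    assume "\<not> small d (U R)"
    moreover have "DF d (\<lambda>u. \<exists>z\<in>Rn n. z \<in> E \<and> inbox n R z \<and> (\<forall>j<d. z (\<iota> j) = u j) \<and>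
      (\<forall>z'\<in>Rn n. z' \<in> Z \<longrightarrow> inbox n R z' \<longrightarrow> (\<forall>j<d. z' (\<iota> j) = u j) \<longrightarrow> (\<forall>j<n. z' j = z j)))"
      unfolding inbox_def
      by (intro UD_intros UD_mem[OF DF_mem[OF Z]] UD_mem[OF DF_mem[OF E]])
        (use \<iota> in \<open>simp_all add: UD_terms trans_less_add1\<close>)
    then have "U R \<in> S d" by (simp add: DF_iff U_def)
    ultimately obtain a b where ab: "\<forall>j<d. a j < b j" "{x \<in> Rn d. \<forall>j<d. a j < x j \<and> x j < b j} \<subseteq> U R"
      using not_small_contains_box by blast
    define u where "u = proj d (\<lambda>j. (a j + b j) / 2)"
    have u: "\<forall>j<d. a j < u j \<and> u j < b j" using ab(1) by (simp add: u_def)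
    then have "u \<in> U R" using ab(2) by (auto simp: u_def)
    then obtain z where z: "z \<in> E" "inbox n R z" "\<forall>j<d. z (\<iota> j) = u j" by (auto simp: U_def)
    \<comment> \<open>\<open>e1\<close> keeps nearby points in the box \<open>R\<close>;
      \<open>e2\<close> keeps their images under \<open>pick\<close> in the box found in
      \<open>U R\<close>.\<close>
    have "\<exists>e>0. \<forall>j<n. e \<le> min (z j - of_rat (fst (R ! j))) (of_rat (snd (R ! j)) - z j)"
      using z(2) by (intro finite_pos_lower_bound) (auto simp: inbox_def)
    then obtain e1 where e1: "e1 > 0" "\<forall>j<n. e1 \<le> z j - of_rat (fst (R ! j)) \<and> e1 \<le> of_rat (snd (R ! j)) - z j"
      by auto
    have "\<exists>e>0. \<forall>j<d. e \<le> min (u j - a j) (b j - u j)"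
      using u by (intro finite_pos_lower_bound) auto
    then obtain e2 where e2: "e2 > 0" "\<forall>j<d. e2 \<le> u j - a j \<and> e2 \<le> b j - u j"
      by auto
    have "\<forall>e. 0 < e \<longrightarrow> (\<exists>x'\<in>Rn n. x' \<in> Z \<and> (\<forall>j<n. \<bar>x' j - z j\<bar> < e) \<and> \<not> x' \<in> V)"
      using z(1) by (simp add: E_def inner_frontier_def)
    then obtain x' where x': "x' \<in> Rn n" "x' \<in> Z" "\<forall>j<n. \<bar>x' j - z j\<bar> < min e1 e2" "x' \<notin> V"
      using e1(1) e2(1) by (metis min_less_iff_conj)
    have "inbox n R x'" unfolding inbox_def
    proof (intro allI impI)
      fix i assume "i < n"
      then show "of_rat (fst (R ! i)) < x' i \<and> x' i < of_rat (snd (R ! i))"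
        using x'(3) e1(2) by (smt (verit, best) min.cobounded1)
    qed
    moreover have "a j < pick d \<iota> x' j \<and> pick d \<iota> x' j < b j" if "j < d" for j
    proof -
      have "\<bar>x' (\<iota> j) - z (\<iota> j)\<bar> < e2" using x'(3) \<iota> that by auto
      then show ?thesis using e2(2) z(3) that by (force simp: pick_def)
    qed
    then have "pick d \<iota> x' \<in> U R" using ab(2) by auto
    \<comment> \<open>The only point of \<open>Z\<close> in \<open>R\<close> over the image of
      \<open>x'\<close> lies in \<open>E\<close>, so it is \<open>x'\<close> itself, although
      \<open>x'\<close> is outside of \<open>V\<close>.\<close>
    then obtain z'' where z'': "z'' \<in> Rn n" "z'' \<in> E"
      "\<forall>z'\<in>Rn n. z' \<in> Z \<longrightarrow> inbox n R z' \<longrightarrow> (\<forall>j<d. z' (\<iota> j) = pick d \<iota> x' j) \<longrightarrow> (\<forall>j<n. z' j = z'' j)"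
      unfolding U_def by blast
    moreover have "\<forall>j<d. x' (\<iota> j) = pick d \<iota> x' j" by (simp add: pick_def)
    ultimately have "\<forall>j<n. x' j = z'' j" using x' by blast
    then have "x' = z''"
      using x'(1) z''(1) by (metis (no_types, lifting) Rn_iff ext not_le)
    then show False using x'(4) z''(2) EV by blast
  qed
  then have "small d (\<Union>R. U R)" by (intro small_UN) auto
  ultimately show "small d (pick d \<iota> ` inner_frontier n Z V)"
    unfolding E_def[symmetric] by (meson small_Un small_mono)
qed

lemma UD_evenly:
  assumes Z: "UD I dg n (\<lambda>i x. x \<in> Z i)" and Y: "UD I dg (Suc n) (\<lambda>i z. z \<in> Y i)"
  shows "UD I dg n (\<lambda>i x. evenly n (Z i) (Y i) x)"
  unfolding evenly_def fib_close_def
  by (intro UD_intros UD_mem[OF Z] UD_mem[OF Y]) (simp_all add: UD_terms)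

text \<open>If \<open>x0\<close> is not even, then for some list of rational intervals around the points of its
  fibre, \<open>x0\<close> is in the inner frontier of the set of \<open>x\<close> whose fibre has one point in each
  of these intervals. There are only countably many such lists.\<close>

lemma dim_less_uneven:
  assumes Z: "Z \<in> S n" and Y: "Y \<in> S (Suc n)" and fin: "\<And>x. x \<in> Z \<Longrightarrow> finite (fib n Y x)"
    and dim: "dim_less n (Suc d) Z"
  shows "dim_less n d {x \<in> Z. \<not> evenly n Z Y x}"
proof -
  \<comment> \<open>The last clause prevents additional fibre points from appearing near
    \<open>x0\<close> outside of the intervals.\<close>
  define V where "V q = {x \<in> Rn n. x \<in> Z \<and>
      (\<forall>r\<in>set q. \<exists>y. x(n := y) \<in> Y \<and> of_rat (fst r) < y \<and> y < of_rat (snd r) \<and>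
         (\<forall>y'. x(n := y') \<in> Y \<longrightarrow> of_rat (fst r) < y' \<longrightarrow> y' < of_rat (snd r) \<longrightarrow> y' = y)) \<and>
      (\<forall>y. x(n := y) \<in> Y \<longrightarrow> (\<exists>r\<in>set q. of_rat (fst r) < y \<and> y < of_rat (snd r)))}"
    for q :: "(rat \<times> rat) list"
  have V: "V q \<in> S n" for q
    unfolding V_def DF_iff[symmetric]
    by (intro UD_intros UD_ball_finite UD_bex_finite UD_mem[OF DF_mem[OF Z]] UD_mem[OF DF_mem[OF Y]])
      (simp_all add: UD_terms)
  have "x0 \<in> (\<Union>q. inner_frontier n Z (V q))" if x0: "x0 \<in> Z" "\<not> evenly n Z Y x0" for x0
  proof (rule ccontr)
    assume *: "x0 \<notin> (\<Union>q. inner_frontier n Z (V q))"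
    have x0R: "x0 \<in> Rn n" using subset_Rn[OF Z] x0 by blast
    define F where "F = fib n Y x0"
    have F: "finite F" using fin x0 by (simp add: F_def)
    have memF: "x0(n := y) \<in> Y \<longleftrightarrow> y \<in> F" for y by (simp add: F_def fib_def)
    have "\<exists>d>0. \<forall>t\<in>(\<lambda>(y, y'). y - y') ` (F \<times> F). t \<noteq> 0 \<longrightarrow> d \<le> dist 0 t"
      using F by (intro finite_set_avoid) auto
    then obtain g where g: "g > 0" "\<And>y y'. y \<in> F \<Longrightarrow> y' \<in> F \<Longrightarrow> y \<noteq> y' \<Longrightarrow> g \<le> \<bar>y - y'\<bar>"
      by fastforce
    have "evenly n Z Y x0"
      unfolding evenly_def
    \<comment> \<open>\<open>g\<close> is a lower bound for the gaps in the fibre over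
      \<open>x0\<close>; with \<open>2 * e < g\<close> no two points of it can share a neighbour at
      distance less than \<open>e\<close>.\<close>
    proof (rule exI[of _ "g / 2"], intro conjI allI impI)
      fix e :: real assume e: "0 < e" "e < g / 2"
      have "\<exists>r :: rat \<times> rat. of_rat (fst r) < y \<and> y < of_rat (snd r) \<and> y - e < of_rat (fst r) \<and>
          of_rat (snd r) < y + e" for y :: real
        using finite_isolated[OF F e(1), of y] by force
      then obtain r :: "real \<Rightarrow> rat \<times> rat" where r: "\<And>y. of_rat (fst (r y)) < y" "\<And>y. y < of_rat (snd (r y))"
        "\<And>y. y - e < of_rat (fst (r y))" "\<And>y. of_rat (snd (r y)) < y + e"
        by metis
      define q where "q = map r (sorted_list_of_set F)"
      have q: "set q = r ` F" using F by (simp add: q_def)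
      have uniq: "y' = y" if "y \<in> F" "y' \<in> F" "\<bar>y' - y\<bar> < g" for y y'
        using g(2)[OF that(2,1)] that(3) by force
      have "x0 \<in> V q"
        unfolding V_def q
      proof (intro CollectI conjI x0R x0(1) ballI allI impI)
        fix s assume "s \<in> r ` F"
        then obtain y where y: "y \<in> F" "s = r y" by blast
        have "y' = y" if "y' \<in> F" "of_rat (fst s) < y'" "y' < of_rat (snd s)" for y'
        proof -
          have "\<bar>y' - y\<bar> < g" using that(2,3) r(3)[of y] r(4)[of y] e unfolding y(2) by linarith
          then show ?thesis using uniq that(1) y(1) by blast
        qed
        then show "\<exists>y. x0(n := y) \<in> Y \<and> of_rat (fst s) < y \<and> y < of_rat (snd s) \<and>
            (\<forall>y'. x0(n := y') \<in> Y \<longrightarrow> of_rat (fst s) < y' \<longrightarrow> y' < of_rat (snd s) \<longrightarrow> y' = y)"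
          unfolding memF using y r(1,2) by blast
      qed (use r memF in blast)
      have "\<exists>d>0. \<forall>x'\<in>Rn n. x' \<in> Z \<longrightarrow> (\<forall>j<n. \<bar>x' j - x0 j\<bar> < d) \<longrightarrow> x' \<in> V q"
      proof -
        have "\<not> (\<forall>e. 0 < e \<longrightarrow> (\<exists>x'\<in>Rn n. x' \<in> Z \<and> (\<forall>j<n. \<bar>x' j - x0 j\<bar> < e) \<and> \<not> x' \<in> V q))"
        proof
          assume "\<forall>e. 0 < e \<longrightarrow> (\<exists>x'\<in>Rn n. x' \<in> Z \<and> (\<forall>j<n. \<bar>x' j - x0 j\<bar> < e) \<and> \<not> x' \<in> V q)"
          then have "x0 \<in> inner_frontier n Z (V q)"
            unfolding inner_frontier_def by (intro CollectI conjI x0R \<open>x0 \<in> V q\<close>)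
          then show False using * by blast
        qed
        then obtain d where "0 < d" and "\<not> (\<exists>x'\<in>Rn n. x' \<in> Z \<and> (\<forall>j<n. \<bar>x' j - x0 j\<bar> < d) \<and> \<not> x' \<in> V q)"
          by blast
        then show ?thesis by (intro exI[of _ d]) blast
      qed
      then obtain d where d: "d > 0" "\<And>x. x \<in> Rn n \<Longrightarrow> x \<in> Z \<Longrightarrow> (\<forall>j<n. \<bar>x j - x0 j\<bar> < d) \<Longrightarrow> x \<in> V q"
        by blast
      show "\<exists>d. 0 < d \<and> (\<forall>x\<in>Rn n. x \<in> Z \<longrightarrow> (\<forall>j<n. \<bar>x j - x0 j\<bar> < d) \<longrightarrow> fib_close n Y x0 e x)"
        unfolding fib_close_def
      proof (rule exI[of _ d], intro conjI ballI impI allI d(1))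
        fix x y assume x: "x \<in> Rn n" "x \<in> Z" "\<forall>j<n. \<bar>x j - x0 j\<bar> < d" and y: "x(n := y) \<in> Y"
        then obtain y0 where "y0 \<in> F" "of_rat (fst (r y0)) < y" "y < of_rat (snd (r y0))"
          using d(2)[OF x] unfolding V_def q by blast
        then show "\<exists>y0. x0(n := y0) \<in> Y \<and> \<bar>y - y0\<bar> < e"
          unfolding memF using r(3)[of y0] r(4)[of y0] by (intro exI[of _ y0]) auto
      next
        fix x y0 assume x: "x \<in> Rn n" "x \<in> Z" "\<forall>j<n. \<bar>x j - x0 j\<bar> < d" and y0: "x0(n := y0) \<in> Y"
        have xV: "x \<in> V q" by (rule d(2)[OF x])
        have "r y0 \<in> set q" using y0 q memF by blast
        then obtain y where y: "x(n := y) \<in> Y" "of_rat (fst (r y0)) < y" "y < of_rat (snd (r y0))"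
          "\<And>y'. x(n := y') \<in> Y \<Longrightarrow> of_rat (fst (r y0)) < y' \<Longrightarrow> y' < of_rat (snd (r y0)) \<Longrightarrow> y' = y"
          using xV unfolding V_def by blast
        have "y' = y" if y': "x(n := y') \<in> Y" "\<bar>y' - y0\<bar> < e" for y'
        proof -
          \<comment> \<open>The nearby point \<open>y'\<close> lies in the interval of some
            \<open>y1\<close>, and two distances below \<open>e\<close> leave no gap between
            \<open>y1\<close> and \<open>y0\<close>.\<close>
          obtain y1 where y1: "y1 \<in> F" "of_rat (fst (r y1)) < y'" "y' < of_rat (snd (r y1))"
            using xV y'(1) unfolding V_def q by blast
          then have "\<bar>y1 - y0\<bar> < g" using r(3)[of y1] r(4)[of y1] y'(2) e by linarith
          then have "y1 = y0" using uniq y1(1) y0 memF by blast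
          then show ?thesis using y(4) y' y1 by blast
        qed
        then show "\<exists>y. x(n := y) \<in> Y \<and> \<bar>y - y0\<bar> < e \<and>
            (\<forall>y'. x(n := y') \<in> Y \<longrightarrow> \<bar>y' - y0\<bar> < e \<longrightarrow> y' = y)"
        proof (intro exI[of _ y] conjI allI impI y(1))
          show "\<bar>y - y0\<bar> < e" using y(2,3) r(3)[of y0] r(4)[of y0] by linarith
        qed blast
      qed
    qed (use g in auto)
    then show False using x0 by blast
  qed
  then have "{x \<in> Z. \<not> evenly n Z Y x} \<subseteq> (\<Union>q. inner_frontier n Z (V q))" by blast
  moreover have "dim_less n d (\<Union>q. inner_frontier n Z (V q))"
    using dim by (intro dim_less_UN dim_less_inner_frontier[OF Z V]) (auto simp: V_def)
  ultimately show ?thesis using dim_less_mono by blast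
qed

text \<open>Among \<open>n + 1\<close> indices below \<open>n\<close> two coincide, so the image
  lies in a hyperplane \<open>x a = x b\<close>; this contains no box, as varying one of the two
  coordinates leaves it.\<close>

lemma dim_less_Rn: "dim_less n (Suc n) (Rn n)"
  unfolding dim_less_def
proof (intro allI impI)
  fix \<iota> :: "nat \<Rightarrow> nat" assume "\<forall>j<Suc n. \<iota> j < n"
  then have "\<iota> ` {..<Suc n} \<subseteq> {..<n}" by auto
  then have "card (\<iota> ` {..<Suc n}) < card {..<Suc n}"
    using card_mono[of "{..<n}" "\<iota> ` {..<Suc n}"] by simp
  then have "\<not> inj_on \<iota> {..<Suc n}" by (rule pigeonhole)
  then obtain a b where ab: "a < Suc n" "b < Suc n" "a \<noteq> b" "\<iota> a = \<iota> b"
    by (auto simp: inj_on_def)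
  define D where "D = {x \<in> Rn (Suc n). x a = x b}"
  have D: "D \<in> S (Suc n)" unfolding D_def DF_iff[symmetric]
    using ab by (intro UD_intros) (simp_all add: UD_terms)
  have no_box: False if l: "\<forall>j<Suc n. l j < u j" and D: "{x \<in> Rn (Suc n). \<forall>j<Suc n. l j < x j \<and> x j < u j} \<subseteq> D" for l u :: point
  proof -
    have *: "proj (Suc n) x \<in> D" if "\<forall>j<Suc n. l j < x j \<and> x j < u j" for x :: point
      using D that by auto
    define x where "x = (\<lambda>j. (l j + u j) / 2)"
    have x: "\<forall>j<Suc n. l j < x j \<and> x j < u j" using l by (simp add: x_def)
    define y where "y = x(a := (l a + x a) / 2)"
    have "l a < y a \<and> y a < x a" using x ab(1) by (force simp: y_def)
    then have "\<forall>j<Suc n. l j < y j \<and> y j < u j" using x by (auto simp: y_def)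
    then have "x a = x b" "y a = y b" using *[of x] *[of y] x ab by (auto simp: D_def)
    then show False using \<open>l a < y a \<and> y a < x a\<close> ab(3) by (simp add: y_def)
  qed
  have "small (Suc n) D" using not_small_contains_box[OF D] no_box by blast
  moreover have "pick (Suc n) \<iota> z a = pick (Suc n) \<iota> z b" for z
    using ab by (simp add: pick_def)
  then have "pick (Suc n) \<iota> ` Rn n \<subseteq> D"
    unfolding D_def using pick_in_Rn by blast
  ultimately show "small (Suc n) (pick (Suc n) \<iota> ` Rn n)" by (rule small_mono)
qed

end

section \<open>Strata of evenness\<close>

text \<open>Evenness is tested relative to the current stratum, so a point that is bad in \<real>^n
  may become good later. The fibres of \<open>Y\<close> vary evenly over each difference of
  consecutive strata, relative to the larger one.\<close>

primrec strata :: "nat \<Rightarrow> point set \<Rightarrow> nat \<Rightarrow> point set" where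
  "strata n Y 0 = Rn n"
| "strata n Y (Suc j) = {x \<in> Rn n. x \<in> strata n Y j \<and> \<not> evenly n (strata n Y j) Y x}"

lemma strata_subset_Rn: "strata n Y j \<subseteq> Rn n"
  by (cases j) (simp, simp only: strata.simps, rule Collect_restrict)

context presharp begin

lemma UD_strata:
  assumes Y: "UD I dg (Suc n) (\<lambda>i z. z \<in> Y i)"
  shows "UD I dg n (\<lambda>i x. x \<in> strata n (Y i) j)"
proof (induction j)
  case 0
  show ?case using UD_const[of I dg n "\<lambda>_. True"] by (rule UD_cong) simp
next
  case (Suc j)
  have "UD I dg n (\<lambda>i x. x \<in> strata n (Y i) j \<and> \<not> evenly n (strata n (Y i) j) (Y i) x)"
    by (intro UD_conj UD_not UD_evenly Suc.IH Y)
  then show ?case by (rule UD_cong) simp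
qed

lemma strata_definable: "Y \<in> S (Suc n) \<Longrightarrow> strata n Y j \<in> S n"
proof -
  assume "Y \<in> S (Suc n)"
  then have "{x \<in> Rn n. x \<in> strata n Y j} \<in> S n"
    unfolding DF_iff[symmetric] by (intro UD_strata DF_mem)
  moreover have "{x \<in> Rn n. x \<in> strata n Y j} = strata n Y j" using strata_subset_Rn by blast
  ultimately show ?thesis by simp
qed

text \<open>Each step lowers the dimension bound by one, starting from \<open>n + 1\<close>; at 0 it
  says that the image under \<open>pick 0\<close> is empty, which leaves only the empty set.\<close>

lemma strata_empty:
  assumes Y: "Y \<in> S (Suc n)" and fin: "\<And>x. x \<in> Rn n \<Longrightarrow> finite (fib n Y x)"
  shows "strata n Y (Suc n) = {}"
proof -
  have "dim_less n (Suc n - j) (strata n Y j)" if "j \<le> Suc n" for j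
    using that
  proof (induction j)
    case 0
    show ?case by (simp add: dim_less_Rn)
  next
    case (Suc j)
    then have "dim_less n (Suc (Suc n - Suc j)) (strata n Y j)" by (simp add: Suc_diff_le)
    from dim_less_uneven[OF strata_definable[OF Y] Y _ this]
    have "dim_less n (Suc n - Suc j) {x \<in> strata n Y j. \<not> evenly n (strata n Y j) Y x}"
      using fin subset_Rn[OF strata_definable[OF Y]] by blast
    then show ?case by (rule dim_less_mono) auto
  qed
  from this[of "Suc n"] show ?thesis by (auto simp: dim_less_def)
qed

end

section \<open>Continuous sections over connected sets\<close>

lemma finite_uniform_pos:
  assumes "finite A" "\<And>a. a \<in> A \<Longrightarrow> \<exists>d>0. Q a (d :: real)"
    and "\<And>a d d'. a \<in> A \<Longrightarrow> Q a d \<Longrightarrow> 0 < d' \<Longrightarrow> d' \<le> d \<Longrightarrow> Q a d'"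
  shows "\<exists>d>0. \<forall>a\<in>A. Q a d"
  using assms
proof (induction A rule: finite_induct)
  case empty
  show ?case by (intro exI[of _ 1]) auto
next
  case (insert b A)
  then obtain d where d: "d > 0" "\<forall>a\<in>A. Q a d" by blast
  obtain d' where d': "d' > 0" "Q b d'" using insert.prems(1) by blast
  have "Q a (min d d')" if "a \<in> insert b A" for a
    using that insert.prems(2)[of a d "min d d'"] insert.prems(2)[of a d' "min d d'"] d d' by auto
  then show ?case using d(1) d'(1) by (intro exI[of _ "min d d'"]) auto
qed

section \<open>Neighbourhoods given by finitely many coordinates\<close>

lemma open_near: "open {x' :: point. \<forall>j<n. \<bar>x' j - x j\<bar> < d}"
proof -
  have "{x' :: point. \<forall>j<n. \<bar>x' j - x j\<bar> < d} = (\<Inter>j\<in>{..<n}. {x'. \<bar>x' j - x j\<bar> < d})" by auto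
  moreover have "open {x' :: point. \<bar>x' j - x j\<bar> < d}" for j
    by (intro open_Collect_less continuous_intros; simp)
  ultimately show ?thesis by (simp add: open_INT)
qed

text \<open>The link between the coordinatewise nearness that occurs in formulas and the product
  topology on \<open>point\<close>.\<close>

lemma eventually_nearI:
  assumes "d > 0" "\<And>x'. x' \<in> C \<Longrightarrow> (\<forall>j<n. \<bar>x' j - x j\<bar> < d) \<Longrightarrow> P x'"
  shows "eventually P (at (x :: point) within C)"
  unfolding eventually_at_topological
proof (intro exI[of _ "{x'. \<forall>j<n. \<bar>x' j - x j\<bar> < d}"] conjI ballI impI)
  show "open {x' :: point. \<forall>j<n. \<bar>x' j - x j\<bar> < d}" by (rule open_near)
  show "x \<in> {x'. \<forall>j<n. \<bar>x' j - x j\<bar> < d}" using assms(1) by simp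
  fix x' assume "x' \<in> {x'. \<forall>j<n. \<bar>x' j - x j\<bar> < d}" "x' \<in> C"
  then show "P x'" using assms(2) by blast
qed

lemma connected_local_const_near:
  assumes "connected C" "x \<in> C" "y \<in> C"
    and "\<And>x. x \<in> C \<Longrightarrow> \<exists>d>0. \<forall>x'\<in>C. (\<forall>j<n. \<bar>x' j - x j\<bar> < d) \<longrightarrow> f x' = f x"
  shows "f (x :: point) = f y"
proof (rule connected_local_const[OF assms(1-3)], rule ballI)
  fix a assume "a \<in> C"
  then obtain d where "d > 0" "\<forall>x'\<in>C. (\<forall>j<n. \<bar>x' j - a j\<bar> < d) \<longrightarrow> f x' = f a" using assms(4) by blast
  then show "\<forall>\<^sub>F b in at a within C. f a = f b" by (intro eventually_nearI[of d C n]) auto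
qed

lemma continuous_on_near:
  assumes "\<And>x e. x \<in> C \<Longrightarrow> e > 0 \<Longrightarrow> \<exists>d>0. \<forall>x'\<in>C. (\<forall>j<n. \<bar>x' j - x j\<bar> < d) \<longrightarrow> \<bar>f x' - f x\<bar> < e"
  shows "continuous_on C (f :: point \<Rightarrow> real)"
  unfolding continuous_on_def tendsto_iff dist_real_def
proof (intro ballI allI impI)
  fix x and e :: real assume "x \<in> C" "e > 0"
  then obtain d where "d > 0" "\<forall>x'\<in>C. (\<forall>j<n. \<bar>x' j - x j\<bar> < d) \<longrightarrow> \<bar>f x' - f x\<bar> < e"
    using assms by blast
  then show "\<forall>\<^sub>F x' in at x within C. \<bar>f x' - f x\<bar> < e" by (intro eventually_nearI[of d C n]) auto
qed

lemma sorted_list_of_set_strict_mono_image: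
  assumes "finite (A :: 'a :: linorder set)" "strict_mono_on A b"
  shows "sorted_list_of_set (b ` A) = map b (sorted_list_of_set A)"
proof -
  have "sorted_wrt (<) (map b (sorted_list_of_set A))"
    using assms by (intro sorted_wrt_map_mono[of "(<)"]) (auto simp: strict_mono_onD)
  then have "sorted_list_of_set (set (map b (sorted_list_of_set A))) = map b (sorted_list_of_set A)"
    by (meson distinct_sorted_list_of_set sorted_list_of_set.idem_if_sorted_distinct strict_sorted_iff)
  then show ?thesis using assms(1) by simp
qed

lemma evenly_mono:
  assumes "evenly n Z Y x0" "C \<subseteq> Z"
  shows "evenly n C Y x0"
proof -
  obtain e0 where e0: "0 < e0" "\<forall>e. 0 < e \<longrightarrow> e < e0 \<longrightarrow> (\<exists>d. 0 < d \<and>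
     (\<forall>x\<in>Rn n. x \<in> Z \<longrightarrow> (\<forall>j<n. \<bar>x j - x0 j\<bar> < d) \<longrightarrow> fib_close n Y x0 e x))"
    using assms(1) unfolding evenly_def by (elim exE conjE)
  show ?thesis unfolding evenly_def
  proof (rule exI[of _ e0], intro conjI e0(1) allI impI)
    fix e assume "0 < e" "e < e0"
    then obtain d where d: "0 < d" "\<forall>x\<in>Rn n. x \<in> Z \<longrightarrow> (\<forall>j<n. \<bar>x j - x0 j\<bar> < d) \<longrightarrow> fib_close n Y x0 e x"
      using e0(2) by (elim allE[of _ e] impE exE conjE)
    then show "\<exists>d. 0 < d \<and> (\<forall>x\<in>Rn n. x \<in> C \<longrightarrow> (\<forall>j<n. \<bar>x j - x0 j\<bar> < d) \<longrightarrow> fib_close n Y x0 e x)"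
      using assms(2) by (intro exI[of _ d]) (simp add: subset_iff)
  qed
qed

text \<open>Pairwise unions suffice: a point of the fibre of \<open>Y \<union> Y'\<close> near \<open>y0\<close> stays in every
  member of the family that contains \<open>y0\<close>.\<close>

lemma even_family:
  assumes Ys: "finite Ys" and C: "C \<subseteq> Rn n" and fin: "finite (fib n (\<Union>Ys) x0)"
    and even: "\<And>Y Y'. Y \<in> Ys \<Longrightarrow> Y' \<in> Ys \<Longrightarrow> evenly n C (Y \<union> Y') x0" and e: "e > 0"
  shows "\<exists>d>0. \<forall>x\<in>C. (\<forall>j<n. \<bar>x j - x0 j\<bar> < d) \<longrightarrow>
    (\<exists>b. strict_mono_on (fib n (\<Union>Ys) x0) b \<and> fib n (\<Union>Ys) x = b ` fib n (\<Union>Ys) x0 \<and>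
       (\<forall>y\<in>fib n (\<Union>Ys) x0. \<bar>b y - y\<bar> < e \<and> (\<forall>Y\<in>Ys. x(n := b y) \<in> Y \<longleftrightarrow> x0(n := y) \<in> Y)))"
proof -
  define F where "F x = fib n (\<Union>Ys) x" for x
  have F: "y \<in> F x \<longleftrightarrow> (\<exists>Y\<in>Ys. x(n := y) \<in> Y)" for x y by (simp add: F_def fib_def)
  let ?near = "\<lambda>d x. \<forall>j<n. \<bar>x j - x0 j\<bar> < d"
  define Q where "Q p e d \<longleftrightarrow> (\<forall>x\<in>Rn n. x \<in> C \<longrightarrow> ?near d x \<longrightarrow> fib_close n (fst p \<union> snd p) x0 e x)" for p e d
  have "\<exists>e1>0. \<forall>p\<in>Ys \<times> Ys. \<forall>e. 0 < e \<longrightarrow> e < e1 \<longrightarrow> (\<exists>d>0. Q p e d)"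
  proof (rule finite_uniform_pos)
    fix p assume "p \<in> Ys \<times> Ys"
    then have "evenly n C (fst p \<union> snd p) x0" using even by auto
    then show "\<exists>e1>0. \<forall>e. 0 < e \<longrightarrow> e < e1 \<longrightarrow> (\<exists>d>0. Q p e d)"
      unfolding evenly_def Q_def by blast
  qed (use Ys in auto)
  then obtain e1 where e1: "e1 > 0" "\<And>p e. p \<in> Ys \<times> Ys \<Longrightarrow> 0 < e \<Longrightarrow> e < e1 \<Longrightarrow> \<exists>d>0. Q p e d"
    by blast
  have "\<exists>d>0. \<forall>t\<in>(\<lambda>(y, y'). y - y') ` (F x0 \<times> F x0). t \<noteq> 0 \<longrightarrow> d \<le> dist 0 t"
    using fin by (intro finite_set_avoid) (auto simp: F_def)
  then obtain g where g: "g > 0" "\<And>y y'. y \<in> F x0 \<Longrightarrow> y' \<in> F x0 \<Longrightarrow> y \<noteq> y' \<Longrightarrow> g \<le> \<bar>y - y'\<bar>"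
    by fastforce
  \<comment> \<open>The divisor 3 yields \<open>2 * a < g\<close>, so no point is within
    \<open>a\<close> of two points of the fibre over \<open>x0\<close>, and keeps \<open>a\<close>
    below both \<open>e\<close> and \<open>e1\<close>.\<close>
  define a where "a = min e (min e1 g) / 3"
  have a: "a > 0" "a < e" "a < e1" "2 * a < g" using e e1 g by (auto simp: a_def min_def)
  have "\<exists>d>0. \<forall>p\<in>Ys \<times> Ys. Q p a d"
  proof (rule finite_uniform_pos)
    show "finite (Ys \<times> Ys)" using Ys by simp
    show "\<exists>d>0. Q p a d" if "p \<in> Ys \<times> Ys" for p by (rule e1(2)[OF that a(1,3)])
    fix p d d' assume "Q p a d" "d' \<le> d"
    moreover have "?near d x" if "?near d' x" for x using that \<open>d' \<le> d\<close> by force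
    ultimately show "Q p a d'" unfolding Q_def by blast
  qed
  then obtain d1 where d1: "d1 > 0" "\<And>p. p \<in> Ys \<times> Ys \<Longrightarrow> Q p a d1" by blast
  show ?thesis unfolding F_def[symmetric]
  proof (rule exI[of _ d1], intro conjI d1(1) ballI impI)
    fix x assume x: "x \<in> C" "?near d1 x"
    have close: "fib_close n (Y \<union> Y') x0 a x" if "Y \<in> Ys" "Y' \<in> Ys" for Y Y'
      using d1(2)[of "(Y, Y')"] that x C unfolding Q_def by auto
    have B1: "\<exists>y0. x0(n := y0) \<in> Y \<and> \<bar>y - y0\<bar> < a" if "Y \<in> Ys" "x(n := y) \<in> Y" for Y y
      using close[OF that(1,1)] that(2) unfolding fib_close_def Un_absorb by blast
    have B2: "\<exists>y. x(n := y) \<in> Y \<and> \<bar>y - y0\<bar> < a" if "Y \<in> Ys" "x0(n := y0) \<in> Y" for Y y0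
      using close[OF that(1,1)] that(2) unfolding fib_close_def Un_absorb by blast
    have pull: "x0(n := y0) \<in> Y" if h: "Y \<in> Ys" "x(n := y) \<in> Y" "y0 \<in> F x0" "\<bar>y - y0\<bar> < a" for Y y y0
    proof -
      obtain y1 where y1: "x0(n := y1) \<in> Y" "\<bar>y - y1\<bar> < a" using B1[OF h(1,2)] by blast
      have "y1 = y0"
      proof (rule ccontr)
        assume "y1 \<noteq> y0"
        then have "g \<le> \<bar>y1 - y0\<bar>" using g(2) y1(1) h(1,3) F by blast
        then show False using y1(2) h(4) a(4) by linarith
      qed
      then show ?thesis using y1 by simp
    qed
    \<comment> \<open>Two points near \<open>y0\<close> may come from different members of the
      family; it is the evenness of the union of these two members that identifies them.\<close>
    have uniq: "y = y'" if h: "y0 \<in> F x0" "y \<in> F x" "y' \<in> F x" "\<bar>y - y0\<bar> < a" "\<bar>y' - y0\<bar> < a" for y y' y0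
    proof -
      obtain Y where Y: "Y \<in> Ys" "x(n := y) \<in> Y" using h F by blast
      obtain Y' where Y': "Y' \<in> Ys" "x(n := y') \<in> Y'" using h F by blast
      have "x0(n := y0) \<in> Y \<union> Y'" using pull[OF Y h(1,4)] by blast
      then obtain y1 where "\<forall>y''. x(n := y'') \<in> Y \<union> Y' \<longrightarrow> \<bar>y'' - y0\<bar> < a \<longrightarrow> y'' = y1"
        using close[OF Y(1) Y'(1)] unfolding fib_close_def by blast
      then show ?thesis using Y Y' h by blast
    qed
    have "\<exists>y. y \<in> F x \<and> \<bar>y - y0\<bar> < a" if "y0 \<in> F x0" for y0
    proof -
      obtain Y where Y: "Y \<in> Ys" "x0(n := y0) \<in> Y" using \<open>y0 \<in> F x0\<close> unfolding F by (rule bexE)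
      from B2[OF Y] show ?thesis using Y(1) F by blast
    qed
    then have "\<forall>y0\<in>F x0. \<exists>y. y \<in> F x \<and> \<bar>y - y0\<bar> < a" by (rule ballI)
    then obtain b where b': "\<forall>y0\<in>F x0. b y0 \<in> F x \<and> \<bar>b y0 - y0\<bar> < a" by (rule bchoice[THEN exE])
    have b: "b y0 \<in> F x" "\<bar>b y0 - y0\<bar> < a" if "y0 \<in> F x0" for y0
      using b' that by simp_all
    have mono: "strict_mono_on (F x0) b"
    proof (rule strict_mono_onI)
      fix y y' assume y: "y \<in> F x0" "y' \<in> F x0" "y < y'"
      then have "g \<le> y' - y" using g(2)[of y' y] by auto
      then show "b y < b y'" using b(2)[OF y(1)] b(2)[OF y(2)] a(4) by linarith
    qed
    have mem: "x(n := b y) \<in> Y \<longleftrightarrow> x0(n := y) \<in> Y" if h: "y \<in> F x0" "Y \<in> Ys" for y Y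
    proof
      show "x(n := b y) \<in> Y \<Longrightarrow> x0(n := y) \<in> Y" by (rule pull[OF h(2) _ h(1) b(2)[OF h(1)]])
      assume "x0(n := y) \<in> Y"
      then obtain y1 where y1: "x(n := y1) \<in> Y" "\<bar>y1 - y\<bar> < a" using B2[OF h(2)] by blast
      have "y1 \<in> F x" using y1(1) h(2) F by blast
      then have "y1 = b y" using uniq[OF h(1) _ b(1)[OF h(1)] y1(2) b(2)[OF h(1)]] by blast
      then show "x(n := b y) \<in> Y" using y1(1) by simp
    qed
    have "F x = b ` F x0"
    proof
      show "F x \<subseteq> b ` F x0"
      proof
        fix y assume y: "y \<in> F x"
        then obtain Y where Y: "Y \<in> Ys" "x(n := y) \<in> Y" using F by blast
        then obtain y0 where y0: "x0(n := y0) \<in> Y" "\<bar>y - y0\<bar> < a" using B1 by blast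
        then have "y0 \<in> F x0" using Y F by blast
        then have "y = b y0" using uniq[of y0 y "b y0"] b[of y0] y y0(2) by blast
        then show "y \<in> b ` F x0" using \<open>y0 \<in> F x0\<close> by (rule image_eqI)
      qed
    qed (use b in blast)
    then show "\<exists>b. strict_mono_on (F x0) b \<and> F x = b ` F x0 \<and>
       (\<forall>y\<in>F x0. \<bar>b y - y\<bar> < e \<and> (\<forall>Y\<in>Ys. x(n := b y) \<in> Y \<longleftrightarrow> x0(n := y) \<in> Y))"
    proof (intro exI[of _ b] conjI mono ballI)
      fix y assume "y \<in> F x0"
      then show "\<bar>b y - y\<bar> < e" using b(2) a(2) by (meson order.strict_trans)
    qed (use mem in simp_all)
  qed
qed

text \<open>The sections are the entries of the sorted fibres. The size of the fibre and the
  membership of the i-th entry in each \<open>Y\<close> are locally constant by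
  \<open>even_family\<close>, hence constant on the connected set \<open>C\<close>.\<close>

lemma sections:
  assumes Ys: "finite Ys" and C: "C \<subseteq> Rn n" "connected C" "c \<in> C"
    and fin: "\<And>x. x \<in> C \<Longrightarrow> finite (fib n (\<Union>Ys) x)"
    and even: "\<And>Y Y' x. Y \<in> Ys \<Longrightarrow> Y' \<in> Ys \<Longrightarrow> x \<in> C \<Longrightarrow> evenly n C (Y \<union> Y') x"
  obtains \<xi> where
    "\<And>x. x \<in> C \<Longrightarrow> fib n (\<Union>Ys) x = (\<lambda>i. \<xi> i x) ` {..<card (fib n (\<Union>Ys) c)}"
    "\<And>i j x. i < j \<Longrightarrow> j < card (fib n (\<Union>Ys) c) \<Longrightarrow> x \<in> C \<Longrightarrow> \<xi> i x < \<xi> j x"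
    "\<And>i. i < card (fib n (\<Union>Ys) c) \<Longrightarrow> continuous_on C (\<xi> i)"
    "\<And>i Y x. i < card (fib n (\<Union>Ys) c) \<Longrightarrow> Y \<in> Ys \<Longrightarrow> x \<in> C \<Longrightarrow> x(n := \<xi> i x) \<in> Y \<longleftrightarrow> c(n := \<xi> i c) \<in> Y"
proof -
  define F where "F x = fib n (\<Union>Ys) x" for x
  define l where "l x = sorted_list_of_set (F x)" for x
  have fin': "finite (F x)" if "x \<in> C" for x using fin[OF that] by (simp add: F_def)
  define R where "R x e x' \<longleftrightarrow> length (l x') = length (l x) \<and>
      (\<forall>i<length (l x). \<bar>l x' ! i - l x ! i\<bar> < e \<and> (\<forall>Y\<in>Ys. x'(n := l x' ! i) \<in> Y \<longleftrightarrow> x(n := l x ! i) \<in> Y))"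
    for x and e :: real and x'
  have loc: "\<exists>d>0. \<forall>x'\<in>C. (\<forall>j<n. \<bar>x' j - x j\<bar> < d) \<longrightarrow> R x e x'" if x: "x \<in> C" and e: "e > 0" for x e
  proof -
    define M where "M x' \<longleftrightarrow> (\<exists>b. strict_mono_on (F x) b \<and> F x' = b ` F x \<and>
       (\<forall>y\<in>F x. \<bar>b y - y\<bar> < e \<and> (\<forall>Y\<in>Ys. x'(n := b y) \<in> Y \<longleftrightarrow> x(n := y) \<in> Y)))" for x'
    have "\<exists>d>0. \<forall>x'\<in>C. (\<forall>j<n. \<bar>x' j - x j\<bar> < d) \<longrightarrow> M x'"
      unfolding M_def F_def by (rule even_family[OF Ys C(1) fin[OF x] even[OF _ _ x] e])
    then obtain d where d: "d > 0" "\<And>x'. x' \<in> C \<Longrightarrow> (\<forall>j<n. \<bar>x' j - x j\<bar> < d) \<Longrightarrow> M x'" by blast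
    have "R x e x'"
      if x': "x' \<in> C" "\<forall>j<n. \<bar>x' j - x j\<bar> < d" for x'
    proof -
      obtain b where b': "strict_mono_on (F x) b \<and> F x' = b ` F x \<and>
          (\<forall>y\<in>F x. \<bar>b y - y\<bar> < e \<and> (\<forall>Y\<in>Ys. x'(n := b y) \<in> Y \<longleftrightarrow> x(n := y) \<in> Y))"
        using d(2)[OF x'] unfolding M_def by (rule exE)
      note b = b'[THEN conjunct1] b'[THEN conjunct2, THEN conjunct1]
        b'[THEN conjunct2, THEN conjunct2, THEN bspec]
      have lx': "l x' = map b (l x)"
        unfolding l_def b(2) by (rule sorted_list_of_set_strict_mono_image[OF fin'[OF x] b(1)])
      have "set (l x) = F x" using fin'[OF x] by (simp add: l_def)
      then have "l x ! i \<in> F x" if "i < length (l x)" for i using that nth_mem by blast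
      then show ?thesis using b(3) by (simp add: lx' R_def)
    qed
    then show ?thesis using d(1) by blast
  qed
  have len: "length (l x) = card (F c)" if "x \<in> C" for x
  proof -
    have "length (l x) = length (l c)"
    proof (rule connected_local_const_near[OF C(2) that C(3), of n])
      fix x assume x: "x \<in> C"
      have "R x 1 x' \<Longrightarrow> length (l x') = length (l x)" for x' by (simp add: R_def)
      then show "\<exists>d>0. \<forall>x'\<in>C. (\<forall>j<n. \<bar>x' j - x j\<bar> < d) \<longrightarrow> length (l x') = length (l x)"
        using loc[OF x zero_less_one] by blast
    qed
    then show ?thesis by (simp add: l_def)
  qed
  show ?thesis
  proof (rule that[of "\<lambda>i x. l x ! i"])
    fix x assume x: "x \<in> C"
    have "F x = set (l x)" using fin'[OF x] by (simp add: l_def)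
    also have "\<dots> = (\<lambda>i. l x ! i) ` {..<card (F c)}"
      unfolding len[OF x, symmetric] by (auto simp: set_conv_nth)
    finally show "fib n (\<Union>Ys) x = (\<lambda>i. l x ! i) ` {..<card (fib n (\<Union>Ys) c)}" by (simp add: F_def)
  next
    fix i j x assume "i < j" "j < card (fib n (\<Union>Ys) c)" "x \<in> C"
    then show "l x ! i < l x ! j"
      using len[of x] sorted_wrt_nth_less[of "(<)" "l x" i j] by (simp add: F_def l_def)
  next
    fix i assume i: "i < card (fib n (\<Union>Ys) c)"
    show "continuous_on C (\<lambda>x. l x ! i)"
    proof (rule continuous_on_near[where n = n])
      fix x and e :: real assume x: "x \<in> C" "e > 0"
      have "i < length (l x)" using i len[OF x(1)] by (simp add: F_def)
      then have "R x e x' \<Longrightarrow> \<bar>l x' ! i - l x ! i\<bar> < e" for x' by (simp add: R_def)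
      then show "\<exists>d>0. \<forall>x'\<in>C. (\<forall>j<n. \<bar>x' j - x j\<bar> < d) \<longrightarrow> \<bar>l x' ! i - l x ! i\<bar> < e"
        using loc[OF x] by blast
    qed
    fix Y x assume Y: "Y \<in> Ys" and x: "x \<in> C"
    show "x(n := l x ! i) \<in> Y \<longleftrightarrow> c(n := l c ! i) \<in> Y"
    proof (rule connected_local_const_near[OF C(2) x C(3), of n])
      fix x assume x: "x \<in> C"
      have "i < length (l x)" using i len[OF x(1)] by (simp add: F_def)
      then have "R x 1 x' \<Longrightarrow> (x'(n := l x' ! i) \<in> Y) = (x(n := l x ! i) \<in> Y)" for x'
        using Y by (simp add: R_def)
      then show "\<exists>d>0. \<forall>x'\<in>C. (\<forall>j<n. \<bar>x' j - x j\<bar> < d) \<longrightarrow>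
          (x'(n := l x' ! i) \<in> Y) = (x(n := l x ! i) \<in> Y)"
        using loc[OF x zero_less_one] by blast
    qed
  qed
qed

section \<open>Stacks of cells over a connected set\<close>

text \<open>For \<open>A \<subseteq> Rn n\<close> this means that \<open>A\<close> is a union of
  connected components of atoms of the partition generated by \<open>\<Z>\<close>. Testing with
  connected sets avoids naming the atoms, of which there may be exponentially many.\<close>

definition controls :: "nat \<Rightarrow> point set set \<Rightarrow> point set \<Rightarrow> bool" where
  "controls n \<Z> A \<longleftrightarrow> (\<forall>K. connected K \<longrightarrow> K \<subseteq> Rn n \<longrightarrow> (\<forall>Z\<in>\<Z>. K \<subseteq> Z \<or> K \<inter> Z = {}) \<longrightarrow> K \<subseteq> A \<or> K \<inter> A = {})"

lemma controlsI:
  assumes "\<And>K z z'. connected K \<Longrightarrow> K \<subseteq> Rn n \<Longrightarrow> (\<And>Z. Z \<in> \<Z> \<Longrightarrow> K \<subseteq> Z \<or> K \<inter> Z = {}) \<Longrightarrow>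
    z \<in> K \<Longrightarrow> z \<in> A \<Longrightarrow> z' \<in> K \<Longrightarrow> z' \<in> A"
  shows "controls n \<Z> A"
  unfolding controls_def
proof (intro allI impI)
  fix K assume K: "connected K" "K \<subseteq> Rn n" "\<forall>Z\<in>\<Z>. K \<subseteq> Z \<or> K \<inter> Z = {}"
  show "K \<subseteq> A \<or> K \<inter> A = {}"
  proof (cases "K \<inter> A = {}")
    case False
    then obtain z where z: "z \<in> K" "z \<in> A" by blast
    have "K \<subseteq> A"
      using assms[OF K(1,2) bspec[OF K(3)] z] by (rule subsetI)
    then show ?thesis ..
  qed simp
qed

lemma controlsD:
  assumes "controls n \<Z> A" "connected K" "K \<subseteq> Rn n" "\<And>Z. Z \<in> \<Z> \<Longrightarrow> K \<subseteq> Z \<or> K \<inter> Z = {}"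
  shows "K \<subseteq> A \<or> K \<inter> A = {}"
proof -
  have "connected K \<longrightarrow> K \<subseteq> Rn n \<longrightarrow> (\<forall>Z\<in>\<Z>. K \<subseteq> Z \<or> K \<inter> Z = {}) \<longrightarrow> K \<subseteq> A \<or> K \<inter> A = {}"
    using assms(1) unfolding controls_def by (rule spec)
  from mp[OF mp[OF mp[OF this assms(2)] assms(3)] ballI[OF assms(4)]] show ?thesis .
qed

lemma continuous_on_proj: "continuous_on K (proj n)"
proof -
  have "continuous_on K (\<lambda>x. proj n x i)" for i
    by (cases "i < n") (simp_all add: continuous_on_subset[OF continuous_on_product_coordinates])
  then show ?thesis by (rule continuous_on_coordinatewise_then_product)
qed

lemma continuous_on_shift: "continuous_on K (\<lambda>x :: point. \<lambda>i. x (i + 1))"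
  by (rule continuous_on_coordinatewise_then_product) (simp add: continuous_on_subset[OF continuous_on_product_coordinates])

text \<open>Continuous images of connected sets are connected. The two maps of interest are those
  that forget the last and the first coordinate.\<close>

lemma controls_preimage:
  assumes A: "controls n \<Z> A" and f: "\<And>K. continuous_on K f" "\<And>x. x \<in> Rn m \<Longrightarrow> f x \<in> Rn n"
  shows "controls m ((\<lambda>Z. {x \<in> Rn m. f x \<in> Z}) ` \<Z>) {x \<in> Rn m. f x \<in> A}"
proof (rule controlsI)
  fix K z z' assume K: "connected K" "K \<subseteq> Rn m"
    and comp: "\<And>Z. Z \<in> (\<lambda>Z. {x \<in> Rn m. f x \<in> Z}) ` \<Z> \<Longrightarrow> K \<subseteq> Z \<or> K \<inter> Z = {}"
    and z: "z \<in> K" "z \<in> {x \<in> Rn m. f x \<in> A}" "z' \<in> K"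
  have "f ` K \<subseteq> A \<or> f ` K \<inter> A = {}"
  proof (rule controlsD[OF A])
    show "connected (f ` K)" by (rule connected_continuous_image[OF f(1) K(1)])
    show "f ` K \<subseteq> Rn n" using f(2) K(2) by blast
    fix Z assume "Z \<in> \<Z>"
    then have "K \<subseteq> {x \<in> Rn m. f x \<in> Z} \<or> K \<inter> {x \<in> Rn m. f x \<in> Z} = {}" using comp by blast
    then show "f ` K \<subseteq> Z \<or> f ` K \<inter> Z = {}" using K(2) by blast
  qed
  then show "z' \<in> {x \<in> Rn m. f x \<in> A}" using z K(2) by blast
qed

lemma times_R_eq: "times_R n = (\<lambda>Z. {x \<in> Rn (Suc n). proj n x \<in> Z})"
  by (simp add: times_R_def fun_eq_iff)

lemma R_times_eq: "R_times n = (\<lambda>Z. {x \<in> Rn (Suc n). (\<lambda>i. x (i + 1)) \<in> Z})"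
  by (simp add: R_times_def fun_eq_iff)

lemma controls_times_R: "controls n \<Z> A \<Longrightarrow> controls (Suc n) (times_R n ` \<Z>) (times_R n A)"
  unfolding times_R_eq by (rule controls_preimage) (auto simp: continuous_on_proj)

lemma controls_R_times: "controls n \<Z> A \<Longrightarrow> controls (Suc n) (R_times n ` \<Z>) (R_times n A)"
  unfolding R_times_eq
proof (rule controls_preimage)
  show "continuous_on K (\<lambda>x i. x (i + 1))" for K :: "point set" by (rule continuous_on_shift)
qed (auto simp: Rn_iff)

lemma connected_nonzero_pos:
  assumes "connected K" "continuous_on K (f :: 'a :: topological_space \<Rightarrow> real)" "\<And>z. z \<in> K \<Longrightarrow> f z \<noteq> 0"
    and "z \<in> K" "f z > 0" "z' \<in> K"
  shows "f z' > 0"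
proof (rule ccontr)
  assume "\<not> f z' > 0"
  then have "f z' < 0" using assms(3,6) by force
  moreover have "connected (f ` K)" by (rule connected_continuous_image[OF assms(2,1)])
  ultimately have "0 \<in> f ` K"
    using connectedD_interval[of "f ` K" "f z'" "f z" 0] assms(4-6) by auto
  then show False using assms(3) by auto
qed

lemma frontier_free_dichotomy:
  fixes A :: "real set"
  assumes "connected I" "I \<inter> frontier A = {}"
  shows "I \<subseteq> A \<or> I \<inter> A = {}"
  using connected_Int_frontier[OF assms(1), of A] assms(2) by blast

text \<open>A fibre of \<open>X\<close> can be recovered from finitely much information: its
  boundary points, which of them are in \<open>X\<close> (\<open>bdry n X \<inter> X\<close>), after
  which of them \<open>X\<close> continues upwards (\<open>rgt\<close>), and whether
  \<open>X\<close> contains a neighbourhood of -\<infinity> (\<open>bot\<close>).\<close>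

definition bdry :: "nat \<Rightarrow> point set \<Rightarrow> point set" where
  "bdry n X = {z \<in> Rn (Suc n). z n \<in> frontier (fib n X (proj n z))}"

definition rgt :: "nat \<Rightarrow> point set \<Rightarrow> point set" where
  "rgt n X = {z \<in> bdry n X. \<exists>b. z n < b \<and> (\<forall>t. z n < t \<longrightarrow> t < b \<longrightarrow> (proj n z)(n := t) \<in> X)}"

definition bot :: "nat \<Rightarrow> point set \<Rightarrow> point set" where
  "bot n X = {x \<in> Rn n. \<exists>m. \<forall>t. t < m \<longrightarrow> x(n := t) \<in> X}"

section \<open>Graphs and bands over a connected base\<close>

text \<open>The outcome of \<open>sections\<close>. The individual sections are not assumed
  definable; this follows from the definability of \<open>C\<close> and \<open>Ys\<close> in
  \<open>Gr_definable\<close>.\<close>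

locale section_stack = presharp S \<Omega> for S \<Omega> +
  fixes n :: nat and C :: "point set" and Ys :: "point set set" and r :: nat and \<xi> :: "nat \<Rightarrow> point \<Rightarrow> real"
    and c :: point
  assumes C_definable: "C \<in> S n" and C_connected: "connected C" and c: "c \<in> C"
    and finite_Ys: "finite Ys" and Ys_definable: "Ys \<subseteq> S (Suc n)"
    and fib_sections: "x \<in> C \<Longrightarrow> fib n (\<Union>Ys) x = (\<lambda>i. \<xi> i x) ` {..<r}"
    and sections_less: "i < j \<Longrightarrow> j < r \<Longrightarrow> x \<in> C \<Longrightarrow> \<xi> i x < \<xi> j x"
    and sections_continuous: "i < r \<Longrightarrow> continuous_on C (\<xi> i)"
    and sections_mem: "i < r \<Longrightarrow> Y \<in> Ys \<Longrightarrow> x \<in> C \<Longrightarrow> x(n := \<xi> i x) \<in> Y \<longleftrightarrow> c(n := \<xi> i c) \<in> Y"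
begin

lemma C_subset: "C \<subseteq> Rn n"
  by (rule subset_Rn[OF C_definable])

text \<open>Band \<open>i\<close> lies between the sections \<open>i - 1\<close> and
  \<open>i\<close>, for \<open>i = 0, ..., r\<close>. The outer two are unbounded, and for
  \<open>r = 0\<close> the only band is the full cylinder.\<close>

definition lo :: "nat \<Rightarrow> point \<Rightarrow> ereal" where
  "lo i = (if i = 0 then (\<lambda>_. - \<infinity>) else (\<lambda>x. ereal (\<xi> (i - 1) x)))"

definition hi :: "nat \<Rightarrow> point \<Rightarrow> ereal" where
  "hi i = (if i = r then (\<lambda>_. \<infinity>) else (\<lambda>x. ereal (\<xi> i x)))"

definition Gr :: "nat \<Rightarrow> point set" where
  "Gr i = graph_over n C (\<xi> i)"

definition Bd :: "nat \<Rightarrow> point set" where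
  "Bd i = {x \<in> Rn (n + 1). proj n x \<in> C \<and> lo i (proj n x) < ereal (x n) \<and> ereal (x n) < hi i (proj n x)}"

definition stack :: "point set set" where
  "stack = Gr ` {..<r} \<union> Bd ` {..r}"

lemma sections_le: "i \<le> j \<Longrightarrow> j < r \<Longrightarrow> x \<in> C \<Longrightarrow> \<xi> i x \<le> \<xi> j x"
  using sections_less[of i j x] by (cases "i = j") auto

lemma sections_less_iff: "i < r \<Longrightarrow> j < r \<Longrightarrow> x \<in> C \<Longrightarrow> \<xi> i x < \<xi> j x \<longleftrightarrow> i < j"
  using sections_less[of i j x] sections_le[of j i x] by (cases "i < j") auto

lemma Gr_iff: "z \<in> Gr i \<longleftrightarrow> z \<in> Rn (Suc n) \<and> proj n z \<in> C \<and> z n = \<xi> i (proj n z)"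
proof
  assume "z \<in> Gr i"
  then obtain x where x: "x \<in> C" "z = x(n := \<xi> i x)" by (auto simp: Gr_def graph_over_def)
  then have "x \<in> Rn n" using C_subset by blast
  then show "z \<in> Rn (Suc n) \<and> proj n z \<in> C \<and> z n = \<xi> i (proj n z)"
    using x Rn_upd proj_upd by simp
next
  assume z: "z \<in> Rn (Suc n) \<and> proj n z \<in> C \<and> z n = \<xi> i (proj n z)"
  then have "z = (proj n z)(n := \<xi> i (proj n z))" using Rn_proj_upd[of z n] by simp
  then show "z \<in> Gr i" using z unfolding Gr_def graph_over_def by blast
qed

lemma Bd_iff:
  assumes "i \<le> r"
  shows "z \<in> Bd i \<longleftrightarrow> z \<in> Rn (Suc n) \<and> proj n z \<in> C \<and> (\<forall>j<i. \<xi> j (proj n z) < z n) \<and>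
    (\<forall>j. i \<le> j \<longrightarrow> j < r \<longrightarrow> z n < \<xi> j (proj n z))"
proof -
  have "lo i x < ereal y \<longleftrightarrow> (\<forall>j<i. \<xi> j x < y)" if "x \<in> C" for x y
  proof (cases i)
    case (Suc k)
    have "\<xi> j x < y" if "\<xi> k x < y" "j < i" for j
      using sections_le[of j k x] that \<open>x \<in> C\<close> assms Suc by auto
    then show ?thesis by (auto simp: lo_def Suc)
  qed (simp add: lo_def)
  moreover have "ereal y < hi i x \<longleftrightarrow> (\<forall>j. i \<le> j \<longrightarrow> j < r \<longrightarrow> y < \<xi> j x)" if "x \<in> C" for x y
  proof (cases "i = r")
    case False
    have "y < \<xi> j x" if "y < \<xi> i x" "i \<le> j" "j < r" for j
      using sections_le[of i j x] that \<open>x \<in> C\<close> by auto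
    then show ?thesis using False assms by (auto simp: hi_def)
  qed (simp add: hi_def)
  ultimately show ?thesis unfolding Bd_def by auto
qed

lemma stack_cases:
  assumes "D \<in> stack"
  obtains (Gr) i where "i < r" "D = Gr i" | (Bd) i where "i \<le> r" "D = Bd i"
  using assms unfolding stack_def by blast

lemma stack_subset: "D \<in> stack \<Longrightarrow> z \<in> D \<Longrightarrow> z \<in> Rn (Suc n) \<and> proj n z \<in> C"
  by (elim stack_cases) (auto simp: Gr_iff Bd_iff)

lemma Gr_Bd_disjoint:
  assumes "i < r" "j \<le> r" "z \<in> Gr i" "z \<in> Bd j"
  shows False
proof -
  have "z n = \<xi> i (proj n z)" using assms(3) by (simp add: Gr_iff)
  moreover have "\<xi> i (proj n z) < z n \<or> z n < \<xi> i (proj n z)"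
    using assms by (cases "i < j") (simp_all add: Bd_iff)
  ultimately show False by simp
qed

lemma stack_disjoint:
  assumes "D \<in> stack" "D' \<in> stack" "z \<in> D" "z \<in> D'"
  shows "D = D'"
proof -
  have GG: "i = j" if "i < r" "j < r" "z \<in> Gr i" "z \<in> Gr j" for i j
  proof -
    have "\<xi> i (proj n z) = \<xi> j (proj n z)" "proj n z \<in> C" using that(3,4) unfolding Gr_iff by simp_all
    then show ?thesis
      using that(1,2) sections_less_iff[of i j "proj n z"] sections_less_iff[of j i "proj n z"]
      by (metis less_irrefl linorder_neqE_nat)
  qed
  have BB: "\<not> i < j" if "i \<le> r" "j \<le> r" "z \<in> Bd i" "z \<in> Bd j" for i j
  proof
    assume "i < j"
    then have "\<xi> i (proj n z) < z n" "z n < \<xi> i (proj n z)" using that by (simp_all add: Bd_iff)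
    then show False by simp
  qed
  show ?thesis
    using assms(1)
  proof (cases rule: stack_cases)
    case (Gr i)
    show ?thesis using assms(2)
    proof (cases rule: stack_cases)
      case (Gr j)
      then show ?thesis using GG[of i j] \<open>i < r\<close> \<open>D = Gr i\<close> assms by simp
    next
      case (Bd j)
      then show ?thesis using Gr_Bd_disjoint[of i j z] \<open>i < r\<close> \<open>D = Gr i\<close> assms by simp
    qed
  next
    case (Bd i)
    show ?thesis using assms(2)
    proof (cases rule: stack_cases)
      case (Gr j)
      then show ?thesis using Gr_Bd_disjoint[of j i z] \<open>i \<le> r\<close> \<open>D = Bd i\<close> assms by simp
    next
      case (Bd j)
      then have "i = j" using BB[of i j] BB[of j i] \<open>i \<le> r\<close> \<open>D = Bd i\<close> assms by simp
      then show ?thesis using \<open>D = Bd i\<close> \<open>D' = Bd j\<close> by simp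
    qed
  qed
qed

lemma stack_covers:
  assumes "z \<in> Rn (Suc n)" "proj n z \<in> C"
  shows "\<exists>D\<in>stack. z \<in> D"
proof (cases "\<exists>i<r. z n = \<xi> i (proj n z)")
  case True
  then obtain i where "i < r" "z \<in> Gr i" using assms by (auto simp: Gr_iff)
  then show ?thesis unfolding stack_def by blast
next
  case False
  \<comment> \<open>The index of the band is that of the first section above \<open>z\<close>, with
    \<open>r\<close> standing for none.\<close>
  define P where "P i \<longleftrightarrow> i = r \<or> (i < r \<and> z n < \<xi> i (proj n z))" for i
  define i where "i = (LEAST i. P i)"
  have "P r" by (simp add: P_def)
  then have i: "P i" "\<And>j. j < i \<Longrightarrow> \<not> P j" unfolding i_def by (auto intro: LeastI dest: not_less_Least)
  then have ir: "i \<le> r" by (auto simp: P_def)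
  have "\<xi> j (proj n z) < z n" if "j < i" for j
  proof -
    have "j < r" using that ir by simp
    then show ?thesis using i(2)[OF that] False unfolding P_def by force
  qed
  moreover have "z n < \<xi> j (proj n z)" if "i \<le> j" "j < r" for j
    using i(1) that sections_le[of i j "proj n z"] assms by (auto simp: P_def)
  ultimately have "z \<in> Bd i" using assms ir by (simp add: Bd_iff)
  then show ?thesis using ir by (auto simp: stack_def)
qed

lemma lo_less_hi: "i \<le> r \<Longrightarrow> x \<in> C \<Longrightarrow> lo i x < hi i x"
  using sections_less[of "i - 1" i x] by (auto simp: lo_def hi_def)

lemma upd_proj: "x \<in> C \<Longrightarrow> x(n := y) \<in> Rn (Suc n) \<and> proj n (x(n := y)) = x"
  using C_subset Rn_upd proj_upd by blast

lemma proj_stack: "D \<in> stack \<Longrightarrow> proj n ` D = C"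
proof
  assume D: "D \<in> stack"
  show "proj n ` D \<subseteq> C" using stack_subset[OF D] by blast
  show "C \<subseteq> proj n ` D"
  proof
    fix x assume x: "x \<in> C"
    from D have "\<exists>y. x(n := y) \<in> D"
    proof (cases rule: stack_cases)
      case (Gr i)
      then show ?thesis using upd_proj[OF x] x by (auto simp: Gr_iff)
    next
      case (Bd i)
      obtain y where "lo i x < ereal y" "ereal y < hi i x"
        using ereal_dense2[OF lo_less_hi[OF Bd(1) x]] by blast
      then show ?thesis using upd_proj[OF x] x by (auto simp: Bd(2) Bd_def)
    qed
    then show "x \<in> proj n ` D" using upd_proj[OF x] by (metis image_eqI)
  qed
qed

lemma continuous_on_upd:
  assumes "continuous_on A f" "continuous_on A g"
  shows "continuous_on A (\<lambda>x. (f x :: point)(n := g x))"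
proof (rule continuous_on_coordinatewise_then_product)
  fix i
  show "continuous_on A (\<lambda>x. ((f x)(n := g x)) i)"
    using assms continuous_on_product_then_coordinatewise[of A f i] by (cases "i = n") auto
qed

text \<open>A continuous section \<open>s\<close> inside the band serves as a connected spine that
  meets every vertical segment. It is a midpoint or, if a bound is infinite, a translate of the
  other bound.\<close>

lemma Bd_connected:
  assumes "i \<le> r"
  shows "connected (Bd i)"
proof -
  define s where "s x = (if i = 0 then (if i = r then 0 else \<xi> i x - 1)
    else if i = r then \<xi> (i - 1) x + 1 else (\<xi> (i - 1) x + \<xi> i x) / 2)" for x
  have s_cont: "continuous_on C s"
  proof -
    have a: "continuous_on C (\<xi> i)" if "i \<noteq> r" using sections_continuous[of i] assms that by simp
    have b: "continuous_on C (\<xi> (i - 1))" if "i \<noteq> 0" using sections_continuous[of "i - 1"] assms that by simp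
    consider "i = 0" "i = r" | "i = 0" "i \<noteq> r" | "i \<noteq> 0" "i = r" | "i \<noteq> 0" "i \<noteq> r" by blast
    then show ?thesis
    proof cases
      case 2
      then have "s = (\<lambda>x. \<xi> i x - 1)" by (simp add: s_def fun_eq_iff)
      then show ?thesis using a[OF 2(2)] by (simp add: continuous_on_diff)
    next
      case 3
      then have "s = (\<lambda>x. \<xi> (i - 1) x + 1)" by (simp add: s_def fun_eq_iff)
      then show ?thesis using b[OF 3(1)] by (simp add: continuous_on_add)
    next
      case 4
      then have "s = (\<lambda>x. (\<xi> (i - 1) x + \<xi> i x) / 2)" by (simp add: s_def fun_eq_iff)
      then show ?thesis using continuous_on_divide[OF continuous_on_add[OF b[OF 4(1)] a[OF 4(2)]] continuous_on_const[of C 2]] by simp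
    qed (simp add: s_def)
  qed
  have s: "lo i x < ereal (s x)" "ereal (s x) < hi i x" if "x \<in> C" for x
    using sections_less[of "i - 1" i x] that assms by (auto simp: s_def lo_def hi_def)
  define G where "G = (\<lambda>x. x(n := s x)) ` C"
  define V where "V x = (\<lambda>y. x(n := y)) ` {y. lo i x < ereal y \<and> ereal y < hi i x}" for x
  have G: "connected G" unfolding G_def
    by (intro connected_continuous_image continuous_on_upd continuous_on_id s_cont C_connected)
  have V: "connected (V x)" for x unfolding V_def
  proof (intro connected_continuous_image continuous_on_upd continuous_on_id continuous_on_const)
    have "y' \<in> {y. lo i x < ereal y \<and> ereal y < hi i x}"
      if "lo i x < ereal y" "ereal z < hi i x" "y \<le> y'" "y' \<le> z" for y y' z
    proof -
      have "lo i x < ereal y'" using less_le_trans[OF that(1), of "ereal y'"] that(3) by simp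
      moreover have "ereal y' < hi i x" using le_less_trans[OF _ that(2), of "ereal y'"] that(4) by simp
      ultimately show ?thesis by simp
    qed
    then show "connected {y. lo i x < ereal y \<and> ereal y < hi i x}"
      unfolding is_interval_connected_1[symmetric] is_interval_1 by blast
  qed
  have GV: "connected (G \<union> V x)" if "x \<in> C" for x
  proof (rule connected_Un[OF G V])
    have "x(n := s x) \<in> G \<inter> V x" using s[OF that] that by (auto simp: G_def V_def)
    then show "G \<inter> V x \<noteq> {}" by blast
  qed
  have "Bd i = (\<Union>x\<in>C. G \<union> V x)"
  proof
    show "Bd i \<subseteq> (\<Union>x\<in>C. G \<union> V x)"
    proof
      fix z assume "z \<in> Bd i"
      then have z: "z \<in> Rn (Suc n)" "proj n z \<in> C" "lo i (proj n z) < ereal (z n)" "ereal (z n) < hi i (proj n z)"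
        by (auto simp: Bd_def)
      then have "z \<in> V (proj n z)" using Rn_proj_upd[of z n] unfolding V_def by (intro image_eqI[of _ _ "z n"]) auto
      then show "z \<in> (\<Union>x\<in>C. G \<union> V x)" using z by blast
    qed
    show "(\<Union>x\<in>C. G \<union> V x) \<subseteq> Bd i"
      using s upd_proj by (auto simp: G_def V_def Bd_def)
  qed
  moreover have "connected (\<Union>x\<in>C. G \<union> V x)"
  proof (rule connected_Union)
    have "c(n := s c) \<in> \<Inter> ((\<lambda>x. G \<union> V x) ` C)" using c by (auto simp: G_def)
    then show "\<Inter> ((\<lambda>x. G \<union> V x) ` C) \<noteq> {}" by blast
  qed (use GV in blast)
  ultimately show ?thesis by simp
qed

lemma stack_connected: "D \<in> stack \<Longrightarrow> connected D"
proof (elim stack_cases)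
  fix i assume i: "i < r" "D = Gr i"
  have "Gr i = (\<lambda>x. x(n := \<xi> i x)) ` C" by (auto simp: Gr_def graph_over_def)
  then show "connected D"
    using i(2) by (simp add: connected_continuous_image continuous_on_upd continuous_on_id sections_continuous[OF i(1)] C_connected)
qed (simp add: Bd_connected)

lemma sum_sections_definable: "\<Union>Ys \<in> S (Suc n)"
  using finite_Ys Ys_definable by (induction Ys rule: finite_induct) (auto simp: empty union)

text \<open>\<open>A k\<close> is the part of \<open>\<Union>Ys\<close> over \<open>C\<close> with at least \<open>k\<close> points below.\<close>

lemma Gr_definable: "i < r \<Longrightarrow> Gr i \<in> S (Suc n)"
proof -
  assume i: "i < r"
  define A where "A k = {z \<in> Rn (Suc n). proj n z \<in> C \<and> (\<exists>j\<ge>k. j < r \<and> z n = \<xi> j (proj n z))}" for k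
  have A_upd: "(proj n z)(n := y) \<in> A k \<longleftrightarrow> (\<exists>j\<ge>k. j < r \<and> y = \<xi> j (proj n z))" if "proj n z \<in> C" for z y k
    unfolding A_def using upd_proj[OF that, of y] that by simp
  have A0: "A 0 \<in> S (Suc n)"
  proof -
    have "A 0 = {z \<in> Rn (Suc n). proj n z \<in> C \<and> z \<in> \<Union>Ys}"
    proof -
      have "z \<in> \<Union>Ys \<longleftrightarrow> (\<exists>j<r. z n = \<xi> j (proj n z))" if z: "z \<in> Rn (Suc n)" "proj n z \<in> C" for z
      proof -
        have "z \<in> \<Union>Ys \<longleftrightarrow> z n \<in> fib n (\<Union>Ys) (proj n z)" using Rn_proj_upd[OF z(1)] by (simp add: fib_def)
        then show ?thesis unfolding fib_sections[OF z(2)] by auto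
      qed
      then show ?thesis unfolding A_def by auto
    qed
    also have "\<dots> \<in> S (Suc n)" unfolding DF_iff[symmetric]
      by (intro UD_intros UD_mem[OF DF_mem[OF C_definable]] UD_mem[OF DF_mem[OF sum_sections_definable]])
        (simp_all add: UD_terms)
    finally show ?thesis .
  qed
  have A: "A k \<in> S (Suc n)" for k
  proof (induction k)
    case (Suc k)
    have "A (Suc k) = {z \<in> Rn (Suc n). z \<in> A 0 \<and> (\<exists>y. (proj n z)(n := y) \<in> A k \<and> y < z n)}"
    proof (intro set_eqI iffI)
      fix z assume z: "z \<in> A (Suc k)"
      then obtain j where j: "j \<ge> Suc k" "j < r" "z n = \<xi> j (proj n z)" and zC: "z \<in> Rn (Suc n)" "proj n z \<in> C"
        by (auto simp: A_def)
      have "(proj n z)(n := \<xi> k (proj n z)) \<in> A k"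
        unfolding A_upd[OF zC(2)] using j(1,2) by (intro exI[of _ k]) simp
      moreover have "\<xi> k (proj n z) < z n" using sections_less[of k j] j zC by simp
      ultimately show "z \<in> {z \<in> Rn (Suc n). z \<in> A 0 \<and> (\<exists>y. (proj n z)(n := y) \<in> A k \<and> y < z n)}"
        using j zC unfolding A_def[of 0] by blast
    next
      fix z assume "z \<in> {z \<in> Rn (Suc n). z \<in> A 0 \<and> (\<exists>y. (proj n z)(n := y) \<in> A k \<and> y < z n)}"
      then obtain j y where zC: "z \<in> Rn (Suc n)" "proj n z \<in> C" and j: "j < r" "z n = \<xi> j (proj n z)"
        and y: "(proj n z)(n := y) \<in> A k" "y < z n" unfolding A_def[of 0] by blast
      obtain l where "l \<ge> k" "l < r" "y = \<xi> l (proj n z)"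
        using y(1) A_upd[OF zC(2)] by blast
      then have "l < j" using y(2) j sections_less_iff[of l j] zC by simp
      then have "Suc k \<le> j" using \<open>l \<ge> k\<close> by simp
      then show "z \<in> A (Suc k)" using zC j unfolding A_def by blast
    qed
    also have "\<dots> \<in> S (Suc n)" unfolding DF_iff[symmetric]
      by (intro UD_intros UD_mem[OF DF_mem[OF A0]] UD_mem[OF DF_mem[OF Suc]]) (simp_all add: UD_terms)
    finally show ?case .
  qed (rule A0)
  have "Gr i = {z \<in> Rn (Suc n). z \<in> A i \<and> \<not> z \<in> A (Suc i)}"
  proof (intro set_eqI iffI)
    fix z assume "z \<in> Gr i"
    then have z: "z \<in> Rn (Suc n)" "proj n z \<in> C" "z n = \<xi> i (proj n z)" by (simp_all add: Gr_iff)
    have "z \<notin> A (Suc i)"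
    proof
      assume "z \<in> A (Suc i)"
      then obtain j where j: "Suc i \<le> j" "j < r" "z n = \<xi> j (proj n z)" unfolding A_def by blast
      then show False using sections_less[of i j "proj n z"] z by simp
    qed
    then show "z \<in> {z \<in> Rn (Suc n). z \<in> A i \<and> \<not> z \<in> A (Suc i)}"
      using i z unfolding A_def by blast
  next
    fix z assume "z \<in> {z \<in> Rn (Suc n). z \<in> A i \<and> \<not> z \<in> A (Suc i)}"
    then obtain j where "z \<in> Rn (Suc n)" "proj n z \<in> C" "j \<ge> i" "j < r" "z n = \<xi> j (proj n z)" "\<not> Suc i \<le> j"
      by (auto simp: A_def)
    moreover from this have "j = i" by simp
    ultimately show "z \<in> Gr i" by (simp add: Gr_iff)
  qed
  also have "\<dots> \<in> S (Suc n)" unfolding DF_iff[symmetric]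
    by (intro UD_intros UD_mem[OF DF_mem[OF A]]) (simp_all add: UD_terms)
  finally show ?thesis .
qed

lemma Bd_definable:
  assumes "i \<le> r"
  shows "Bd i \<in> S (Suc n)"
proof -
  have sec: "(proj n z)(n := y) \<in> Gr j \<longleftrightarrow> y = \<xi> j (proj n z)" if "proj n z \<in> C" for z y j
    using upd_proj[OF that] that by (simp add: Gr_iff)
  have "Bd i = {z \<in> Rn (Suc n). proj n z \<in> C \<and>
      (\<forall>j\<in>{..<i}. \<exists>y. (proj n z)(n := y) \<in> Gr j \<and> y < z n) \<and>
      (\<forall>j\<in>{i..<r}. \<exists>y. (proj n z)(n := y) \<in> Gr j \<and> z n < y)}"
    using Bd_iff[OF assms] sec by auto
  also have "\<dots> \<in> S (Suc n)" unfolding DF_iff[symmetric]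
    by (intro UD_intros UD_ball_finite UD_mem[OF DF_mem[OF C_definable]] UD_mem[OF DF_mem[OF Gr_definable]])
      (use assms in \<open>simp_all add: UD_terms\<close>)
  finally show ?thesis .
qed

lemma stack_definable: "D \<in> stack \<Longrightarrow> D \<in> S (Suc n)"
  by (elim stack_cases) (simp_all add: Gr_definable Bd_definable)

end

lemma continuous_map_Euclidean_subtopology:
  assumes "C \<subseteq> Rn n" "continuous_on C f"
  shows "continuous_map (subtopology (Euclidean_space n) C) euclideanreal f"
proof -
  have "subtopology (Euclidean_space n) C = top_of_set C"
    using assms(1) unfolding topspace_Euclidean_space Euclidean_space_def
    by (simp add: subtopology_subtopology euclidean_product_topology inf.absorb2)
  then show ?thesis using assms(2) by simp
qed

lemma bdry_fib:
  assumes "x \<in> Rn n" shows "x(n := y) \<in> bdry n X \<longleftrightarrow> y \<in> frontier (fib n X x)"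
  using Rn_upd[OF assms] proj_upd[OF assms] by (simp add: bdry_def)

section \<open>Control and compatibility of the cells in a stack\<close>

context section_stack begin

lemma section_in_family:
  assumes "i < r"
  obtains Y where "Y \<in> Ys" "Gr i \<subseteq> Y"
proof -
  have "\<xi> i c \<in> fib n (\<Union>Ys) c" using fib_sections[OF c] assms by auto
  then obtain Y where Y: "Y \<in> Ys" "c(n := \<xi> i c) \<in> Y" by (auto simp: fib_def)
  have "Gr i \<subseteq> Y"
  proof
    fix z assume "z \<in> Gr i"
    then obtain x where "x \<in> C" "z = x(n := \<xi> i x)" by (auto simp: Gr_def graph_over_def)
    then show "z \<in> Y" using sections_mem[OF assms Y(1)] Y(2) by simp
  qed
  then show ?thesis using that Y by blast
qed

lemma family_in_section:
  assumes "z \<in> Y" "Y \<in> Ys" "z \<in> Rn (Suc n)" "proj n z \<in> C"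
  obtains j where "j < r" "z \<in> Gr j"
proof -
  have "z n \<in> fib n (\<Union>Ys) (proj n z)"
    using assms Rn_proj_upd[of z n] by (auto simp: fib_def)
  then obtain j where "j < r" "z n = \<xi> j (proj n z)" unfolding fib_sections[OF assms(4)] by blast
  then show ?thesis using that assms by (simp add: Gr_iff)
qed

lemma family_section_mem:
  assumes "i < r" "Y \<in> Ys"
  shows "Gr i \<subseteq> Y \<or> Gr i \<inter> Y = {}"
proof -
  have "z \<in> Y \<longleftrightarrow> c(n := \<xi> i c) \<in> Y" if "z \<in> Gr i" for z
  proof -
    obtain x where "x \<in> C" "z = x(n := \<xi> i x)" using \<open>z \<in> Gr i\<close> by (auto simp: Gr_def graph_over_def)
    then show ?thesis using sections_mem[OF assms] by simp
  qed
  then show ?thesis by blast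
qed

lemma continuous_on_section_difference:
  assumes "i < r" "\<And>z. z \<in> K \<Longrightarrow> proj n z \<in> C"
  shows "continuous_on K (\<lambda>z. z n - \<xi> i (proj n z))"
proof (intro continuous_on_diff)
  show "continuous_on K (\<lambda>z :: point. z n)"
    by (rule continuous_on_subset[OF continuous_on_product_coordinates]) simp
  have "continuous_on (proj n ` K) (\<xi> i)"
    by (rule continuous_on_subset[OF sections_continuous[OF assms(1)]]) (use assms(2) in blast)
  then show "continuous_on K (\<lambda>z. \<xi> i (proj n z))"
    by (rule continuous_on_compose2[OF _ continuous_on_proj]) simp
qed

text \<open>A connected set inside the cylinder and inside \<open>Y\<close> is covered by finitely
  many disjoint relatively closed pieces, one for each section, and hence lies on a single
  section.\<close>

lemma Gr_controlled:
  assumes W: "controls n \<W> C" and i: "i < r" and Y: "Y \<in> Ys" "Gr i \<subseteq> Y"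
  shows "controls (Suc n) (times_R n ` \<W> \<union> {Y}) (Gr i)"
proof (rule controlsI)
  fix K z z' assume K: "connected K" "K \<subseteq> Rn (Suc n)"
    and comp: "\<And>Z. Z \<in> times_R n ` \<W> \<union> {Y} \<Longrightarrow> K \<subseteq> Z \<or> K \<inter> Z = {}"
    and z: "z \<in> K" "z \<in> Gr i" "z' \<in> K"
  have "K \<subseteq> times_R n C \<or> K \<inter> times_R n C = {}"
    by (rule controlsD[OF controls_times_R[OF W] K comp]) blast
  moreover have "z \<in> times_R n C" using z(2) by (simp add: times_R_def Gr_iff)
  ultimately have KC: "proj n w \<in> C" if "w \<in> K" for w using z(1) that by (auto simp: times_R_def)
  have KY: "K \<subseteq> Y" using comp[of Y] z Y(2) by blast
  let ?d = "\<lambda>j z. z n - \<xi> j (proj n z)"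
  let ?E1 = "{w \<in> K. ?d i w = 0}" and ?E2 = "\<Union>j\<in>{..<r} - {i}. {w \<in> K. ?d j w = 0}"
  have cl: "closedin (top_of_set K) {w \<in> K. ?d j w = 0}" if "j < r" for j
    by (rule continuous_closedin_preimage_constant[OF continuous_on_section_difference[OF that KC]])
  have "closedin (top_of_set K) ?E2"
    by (rule closedin_Union) (use cl in auto)
  moreover have "closedin (top_of_set K) ?E1" by (rule cl[OF i])
  moreover have "K \<subseteq> ?E1 \<union> ?E2"
  proof
    fix w assume w: "w \<in> K"
    obtain j where "j < r" "w \<in> Gr j"
      using family_in_section[OF _ Y(1), of w] w KY K(2) KC[OF w] by blast
    then show "w \<in> ?E1 \<union> ?E2" using w by (cases "j = i") (auto simp: Gr_iff)
  qed
  moreover have "?E1 \<inter> ?E2 = {}"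
  proof -
    have False if "w \<in> K" "?d i w = 0" "j < r" "j \<noteq> i" "?d j w = 0" for w j
      using sections_less_iff[OF i that(3) KC[OF that(1)]] sections_less_iff[OF that(3) i KC[OF that(1)]] that(2,4,5)
      by (metis diff_eq_diff_less_eq eq_iff_diff_eq_0 less_irrefl linorder_neqE_nat)
    then show ?thesis by blast
  qed
  moreover have "?E1 \<noteq> {}" using z by (auto simp: Gr_iff)
  ultimately have "?E2 = {}" using K(1) unfolding connected_closedin by blast
  then have "z' \<in> ?E1" using \<open>K \<subseteq> ?E1 \<union> ?E2\<close> z(3) by blast
  then show "z' \<in> Gr i" using K(2) KC by (auto simp: Gr_iff)
qed

text \<open>Over \<open>C\<close> the members of \<open>Ys\<close> consist of sections, so a point
  of a band lies in none of them. A compatible connected set through it therefore avoids both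
  bounding sections, and the height above each of them keeps its sign.\<close>

lemma Bd_controlled:
  assumes W: "controls n \<W> C" and i: "i \<le> r"
    and B: "B \<subseteq> Ys" "0 < i \<Longrightarrow> \<exists>Y\<in>B. Gr (i - 1) \<subseteq> Y" "i < r \<Longrightarrow> \<exists>Y\<in>B. Gr i \<subseteq> Y"
  shows "controls (Suc n) (times_R n ` \<W> \<union> B) (Bd i)"
proof (rule controlsI)
  fix K z z' assume K: "connected K" "K \<subseteq> Rn (Suc n)"
    and comp: "\<And>Z. Z \<in> times_R n ` \<W> \<union> B \<Longrightarrow> K \<subseteq> Z \<or> K \<inter> Z = {}"
    and z: "z \<in> K" "z \<in> Bd i" "z' \<in> K"
  have "K \<subseteq> times_R n C \<or> K \<inter> times_R n C = {}"
    by (rule controlsD[OF controls_times_R[OF W] K comp]) blast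
  moreover have "z \<in> times_R n C" using z(2) i by (simp add: times_R_def Bd_iff)
  ultimately have KC: "proj n w \<in> C" if "w \<in> K" for w using z(1) that by (auto simp: times_R_def)
  let ?d = "\<lambda>j z. z n - \<xi> j (proj n z)"
  have nz: "?d j w \<noteq> 0" if j: "j < r" and Y: "\<exists>Y\<in>B. Gr j \<subseteq> Y" and w: "w \<in> K" for j w
  proof -
    obtain Y where Y: "Y \<in> B" "Gr j \<subseteq> Y" using Y by blast
    have "z \<notin> Y"
    proof
      assume "z \<in> Y"
      then obtain l where "l < r" "z \<in> Gr l"
        using family_in_section[of z Y] Y(1) B(1) K(2) KC[OF z(1)] z(1) by blast
      then show False using Gr_Bd_disjoint i z(2) by blast
    qed
    then have "K \<inter> Y = {}" using comp[of Y] Y(1) z(1) by blast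
    then have "w \<notin> Gr j" using w Y(2) by blast
    then show ?thesis using w K(2) KC[OF w] by (auto simp: Gr_iff)
  qed
  have lower: "\<xi> j (proj n z') < z' n" if "j < i" for j
  proof -
    have i': "0 < i" "i - 1 < r" using that i by auto
    have "?d (i - 1) z > 0" using z(2) i' i by (simp add: Bd_iff)
    have "?d (i - 1) z' > 0"
      by (rule connected_nonzero_pos[OF K(1) continuous_on_section_difference[OF i'(2) KC]
            nz[OF i'(2) B(2)[OF i'(1)]] z(1) \<open>?d (i - 1) z > 0\<close> z(3)])
    moreover have "\<xi> j (proj n z') \<le> \<xi> (i - 1) (proj n z')"
      using sections_le[of j "i - 1"] that i' KC[OF z(3)] by simp
    ultimately show ?thesis by simp
  qed
  have upper: "z' n < \<xi> j (proj n z')" if "i \<le> j" "j < r" for j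
  proof -
    have i': "i < r" using that by simp
    have "- ?d i z > 0" using z(2) i' i by (simp add: Bd_iff)
    have "- ?d i z' > 0"
    proof (rule connected_nonzero_pos[OF K(1) continuous_on_minus[OF continuous_on_section_difference[OF i' KC]]
            _ z(1) \<open>- ?d i z > 0\<close> z(3)])
      fix w assume "w \<in> K"
      then show "- ?d i w \<noteq> 0" unfolding neg_equal_0_iff_equal by (rule nz[OF i' B(3)[OF i']])
    qed
    moreover have "\<xi> i (proj n z') \<le> \<xi> j (proj n z')"
      using sections_le[of i j] that KC[OF z(3)] by simp
    ultimately show ?thesis by simp
  qed
  show "z' \<in> Bd i" using lower upper K(2) z(3) KC[OF z(3)] i by (auto simp: Bd_iff)
qed

text \<open>The bound 2 is independent of the size of \<open>Ys\<close>; so the number of sets that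
  control a cell grows only with the dimension.\<close>

lemma stack_controlled:
  assumes W: "controls n \<W> C" and D: "D \<in> stack"
  shows "\<exists>B\<subseteq>Ys. card B \<le> 2 \<and> controls (Suc n) (times_R n ` \<W> \<union> B) D"
  using D
proof (cases rule: stack_cases)
  case (Gr i)
  obtain Y where Y: "Y \<in> Ys" "Gr i \<subseteq> Y" by (rule section_in_family[OF Gr(1)])
  from Gr_controlled[OF W Gr(1) Y] show ?thesis
    using Y Gr(2) by (intro exI[of _ "{Y}"]) auto
next
  case (Bd i)
  define B1 where "B1 = (if 0 < i then {SOME Y. Y \<in> Ys \<and> Gr (i - 1) \<subseteq> Y} else {})"
  define B2 where "B2 = (if i < r then {SOME Y. Y \<in> Ys \<and> Gr i \<subseteq> Y} else {})"
  have some: "(SOME Y. Y \<in> Ys \<and> Gr j \<subseteq> Y) \<in> Ys \<and> Gr j \<subseteq> (SOME Y. Y \<in> Ys \<and> Gr j \<subseteq> Y)" if "j < r" for j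
    by (rule someI_ex) (use section_in_family[OF that] in blast)
  have "controls (Suc n) (times_R n ` \<W> \<union> (B1 \<union> B2)) (Bd i)"
  proof (rule Bd_controlled[OF W Bd(1)])
    show "B1 \<union> B2 \<subseteq> Ys" using some[of "i - 1"] some[of i] Bd(1) by (auto simp: B1_def B2_def)
    show "\<exists>Y\<in>B1 \<union> B2. Gr (i - 1) \<subseteq> Y" if "0 < i" using some[of "i - 1"] Bd(1) that by (auto simp: B1_def)
    show "\<exists>Y\<in>B1 \<union> B2. Gr i \<subseteq> Y" if "i < r" using some[of i] that by (auto simp: B2_def)
  qed
  moreover have "B1 \<union> B2 \<subseteq> Ys" using some[of "i - 1"] some[of i] Bd(1) by (auto simp: B1_def B2_def)
  moreover have "card B1 \<le> 1" "card B2 \<le> 1" by (simp_all add: B1_def B2_def)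
  then have "card (B1 \<union> B2) \<le> 2" using card_Un_le[of B1 B2] by linarith
  ultimately show ?thesis using Bd(2) by blast
qed

lemma card_stack: "finite stack" "card stack \<le> 2 * r + 1"
proof -
  show "finite stack" by (simp add: stack_def)
  have "card stack \<le> card (Gr ` {..<r}) + card (Bd ` {..r})" unfolding stack_def by (rule card_Un_le)
  also have "\<dots> \<le> r + Suc r" using card_image_le[of "{..<r}" Gr] card_image_le[of "{..r}" Bd] by simp
  finally show "card stack \<le> 2 * r + 1" by simp
qed

lemma section_cont_definable: "i < r \<Longrightarrow> cont_definable S n C (\<xi> i)"
  unfolding cont_definable_def
  using continuous_map_Euclidean_subtopology[OF C_subset sections_continuous] Gr_definable
  by (simp add: Gr_def)

text \<open>Cells start in dimension 1, so over the one-point space \<real>^0 the stack has to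
  produce basic cells.\<close>

lemma stack_cell:
  assumes D: "D \<in> stack" and C: "n = 0 \<and> C = Rn 0 \<or> cell S n C"
  shows "cell S (Suc n) D"
  using C
proof
  assume C: "n = 0 \<and> C = Rn 0"
  then have n: "n = 0" by simp
  have R0: "x = (\<lambda>_. 0)" if "x \<in> Rn 0" for x using that by (auto simp: Rn_iff)
  have p0: "proj 0 x = (\<lambda>_. 0)" for x by (rule R0) simp
  have mem: "(\<lambda>_. 0) \<in> C" using C by (simp add: Rn_iff)
  have "basic_cell D" using D
  proof (cases rule: stack_cases)
    case (Gr i)
    have "Gr i = {x \<in> Rn 1. x 0 = \<xi> i (\<lambda>_. 0)}"
    proof -
      have "x \<in> Gr i \<longleftrightarrow> x \<in> Rn 1 \<and> x 0 = \<xi> i (\<lambda>_. 0)" for x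
        using Gr_iff[of x i] mem n p0 by simp
      then show ?thesis by blast
    qed
    then show ?thesis using basic_cell.point Gr(2) by simp
  next
    case (Bd i)
    have "Bd i = {x \<in> Rn 1. lo i (\<lambda>_. 0) < ereal (x 0) \<and> ereal (x 0) < hi i (\<lambda>_. 0)}"
    proof -
      have "x \<in> Bd i \<longleftrightarrow> x \<in> Rn 1 \<and> lo i (\<lambda>_. 0) < ereal (x 0) \<and> ereal (x 0) < hi i (\<lambda>_. 0)" for x
        unfolding Bd_def using mem n p0 by simp
      then show ?thesis by blast
    qed
    then show ?thesis using basic_cell.interval[OF lo_less_hi[OF Bd(1) mem]] Bd(2) by simp
  qed
  then show ?thesis using cell.basic n by simp
next
  assume C: "cell S n C"
  show ?thesis using D
  proof (cases rule: stack_cases)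
    case (Gr i)
    then show ?thesis using cell.graph[OF C section_cont_definable[OF Gr(1)]] by (simp add: Gr_def)
  next
    case (Bd i)
    have "lower_bound S n C (lo i)"
    proof (cases "i = 0")
      case False
      then have "cont_definable S n C (\<xi> (i - 1))" using section_cont_definable Bd(1) by simp
      then show ?thesis using False by (auto simp: lower_bound_def lo_def)
    qed (simp add: lower_bound_def lo_def)
    moreover have "upper_bound S n C (hi i)"
    proof (cases "i = r")
      case False
      then have "cont_definable S n C (\<xi> i)" using section_cont_definable Bd(1) by simp
      then show ?thesis using False by (auto simp: upper_bound_def hi_def)
    qed (simp add: upper_bound_def hi_def)
    ultimately have "cell S (n + 1) (Bd i)"
      unfolding Bd_def using lo_less_hi[OF Bd(1)] by (intro cell.band[OF C]) auto
    then show ?thesis using Bd(2) by simp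
  qed
qed

lemma stack_below:
  assumes D: "D \<in> stack" and z: "z \<in> D" "z' \<in> D" and j: "j < r" "\<xi> j (proj n z) < z n"
  shows "\<xi> j (proj n z') < z' n"
  using D
proof (cases rule: stack_cases)
  case (Gr i)
  then show ?thesis
    using z j sections_less_iff[OF j(1) Gr(1), of "proj n z"] sections_less_iff[OF j(1) Gr(1), of "proj n z'"]
    by (simp add: Gr_iff)
next
  case (Bd i)
  then have "j < i" using z(1) j by (auto simp: Bd_iff not_less[symmetric])
  then show ?thesis using z(2) Bd by (simp add: Bd_iff)
qed

text \<open>Off the fibrewise boundary of \<open>X\<close>, membership in \<open>X\<close> can be read off at the highest
  boundary point below, or at \<open>-\<infinity>\<close>.\<close>

lemma stack_compatible:
  assumes Ys: "bdry n X \<in> Ys" "bdry n X \<inter> X \<in> Ys" "rgt n X \<in> Ys"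
    and bot: "C \<subseteq> bot n X \<or> C \<inter> bot n X = {}" and D: "D \<in> stack"
  shows "D \<subseteq> X \<or> D \<inter> X = {}"
proof (cases "D \<inter> bdry n X = {}")
  case False
  then obtain z where z: "z \<in> D" "z \<in> bdry n X" by blast
  then obtain i where i: "i < r" "z \<in> Gr i"
    using family_in_section[OF z(2) Ys(1)] stack_subset[OF D z(1)] by blast
  then have "D = Gr i" using stack_disjoint[OF D _ z(1) i(2)] by (auto simp: stack_def)
  moreover from this have "D \<subseteq> bdry n X" using family_section_mem[OF i(1) Ys(1)] z by blast
  ultimately show ?thesis using family_section_mem[OF i(1) Ys(2)] by blast
next
  case True
  have "z' \<in> X" if z: "z \<in> D" "z' \<in> D" "z \<in> X" for z z'
  proof -
    \<comment> \<open>The boundary sections below a point are the same throughout a cell, so any two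
      points of the cell read off their membership at the same section.\<close>
    define J where "J w = {j. j < r \<and> Gr j \<subseteq> bdry n X \<and> \<xi> j (proj n w) < w n}" for w :: point
    have JJ: "J z = J z'" using stack_below[OF D z(1,2)] stack_below[OF D z(2,1)] by (auto simp: J_def)
    have finJ: "finite (J z)" by (rule finite_subset[of _ "{..<r}"]) (auto simp: J_def)
    have R: "w \<in> Rn (Suc n)" "proj n w \<in> C" "proj n w \<in> Rn n" if "w \<in> D" for w
      using stack_subset[OF D that] by auto
    have memX: "w \<in> X \<longleftrightarrow> w n \<in> fib n X (proj n w)" if "w \<in> D" for w
      using Rn_proj_upd[OF R(1)[OF that]] by (simp add: fib_def)
    have front: "\<exists>j\<in>J w. t = \<xi> j (proj n w)" if w: "w \<in> D" and t: "t \<in> frontier (fib n X (proj n w))" "t \<le> w n" for w t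
    proof -
      let ?p = "(proj n w)(n := t)"
      have "?p \<in> bdry n X" using bdry_fib[OF R(3)[OF w]] t(1) by simp
      then obtain j where j: "j < r" "?p \<in> Gr j"
        using family_in_section[OF _ Ys(1)] upd_proj[OF R(2)[OF w]] R(2)[OF w] by metis
      then have tj: "t = \<xi> j (proj n w)" using upd_proj[OF R(2)[OF w], of t] by (simp add: Gr_iff)
      have "w n \<noteq> t"
      proof
        assume "w n = t"
        then have "w = ?p" using Rn_proj_upd[OF R(1)[OF w]] by simp
        then show False using True w \<open>?p \<in> bdry n X\<close> by auto
      qed
      moreover have "Gr j \<subseteq> bdry n X" using family_section_mem[OF j(1) Ys(1)] j(2) \<open>?p \<in> bdry n X\<close> by blast
      ultimately have "j \<in> J w" using j(1) t(2) tj by (simp add: J_def)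
      then show ?thesis using tj by blast
    qed
    show ?thesis
    proof (cases "J z = {}")
      case True
      have dich: "{..w n} \<subseteq> fib n X (proj n w) \<or> {..w n} \<inter> fib n X (proj n w) = {}" if "w \<in> D" "J w = {}" for w
        by (rule frontier_free_dichotomy) (use front[OF that(1)] that(2) in auto)
      have iff: "w \<in> X \<longleftrightarrow> proj n w \<in> bot n X" if w: "w \<in> D" "J w = {}" for w
      proof
        assume "w \<in> X"
        then have "{..w n} \<subseteq> fib n X (proj n w)" using dich[OF w] memX[OF w(1)] by auto
        then have "\<forall>t. t < w n \<longrightarrow> (proj n w)(n := t) \<in> X" by (auto simp: fib_def subset_iff)
        then show "proj n w \<in> bot n X" unfolding bot_def by auto
      next
        assume "proj n w \<in> bot n X"
        then obtain m where m: "\<forall>t. t < m \<longrightarrow> (proj n w)(n := t) \<in> X" by (auto simp: bot_def)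
        have "min (w n) m - 1 \<in> {..w n} \<inter> fib n X (proj n w)" using m by (auto simp: fib_def)
        then show "w \<in> X" using dich[OF w] memX[OF w(1)] by auto
      qed
      have "proj n z' \<in> bot n X"
        using iff[OF z(1) True] z(3) bot R(2)[OF z(1)] R(2)[OF z(2)] by blast
      then show ?thesis using iff[OF z(2)] JJ True by simp
    next
      case False
      define k where "k = Max (J z)"
      have k: "k \<in> J z" "\<And>j. j \<in> J z \<Longrightarrow> j \<le> k" using finJ False by (auto simp: k_def)
      have kr: "k < r" "Gr k \<subseteq> bdry n X" using k(1) by (auto simp: J_def)
      have dich: "{\<xi> k (proj n w)<..w n} \<subseteq> fib n X (proj n w) \<or> {\<xi> k (proj n w)<..w n} \<inter> fib n X (proj n w) = {}"
        if w: "w \<in> D" "J w = J z" for w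
      proof (rule frontier_free_dichotomy)
        have "t \<notin> frontier (fib n X (proj n w))" if t: "\<xi> k (proj n w) < t" "t \<le> w n" for t
        proof
          assume "t \<in> frontier (fib n X (proj n w))"
          then obtain j where j: "j \<in> J z" "t = \<xi> j (proj n w)" using front[OF w(1) _ t(2)] w(2) by blast
          then show False using k(2)[OF j(1)] sections_le[of j k "proj n w"] kr(1) R(2)[OF w(1)] t(1) by simp
        qed
        then show "{\<xi> k (proj n w)<..w n} \<inter> frontier (fib n X (proj n w)) = {}" by auto
      qed simp
      have iff: "w \<in> X \<longleftrightarrow> (proj n w)(n := \<xi> k (proj n w)) \<in> rgt n X" if w: "w \<in> D" "J w = J z" for w
      proof -
        let ?p = "(proj n w)(n := \<xi> k (proj n w))"
        have p: "?p \<in> Rn (Suc n)" "proj n ?p = proj n w" "?p n = \<xi> k (proj n w)"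
          using upd_proj[OF R(2)[OF w(1)], of "\<xi> k (proj n w)"] by auto
        have pb: "?p \<in> bdry n X" using kr(2) p R(2)[OF w(1)] by (auto simp: Gr_iff)
        have kw: "\<xi> k (proj n w) < w n" using k(1) unfolding w(2)[symmetric] by (simp add: J_def)
        show ?thesis
        proof
          assume "w \<in> X"
          then have "w n \<in> {\<xi> k (proj n w)<..w n} \<inter> fib n X (proj n w)" using memX[OF w(1)] kw by simp
          then have "{\<xi> k (proj n w)<..w n} \<subseteq> fib n X (proj n w)" using dich[OF w] by blast
          then have "\<forall>t. ?p n < t \<longrightarrow> t < w n \<longrightarrow> (proj n ?p)(n := t) \<in> X" unfolding p by (auto simp: fib_def subset_iff)
          then show "?p \<in> rgt n X" unfolding rgt_def using pb kw p(3) by auto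
        next
          assume "?p \<in> rgt n X"
          then obtain b where b: "?p n < b" "\<forall>t. ?p n < t \<longrightarrow> t < b \<longrightarrow> (proj n ?p)(n := t) \<in> X"
            unfolding rgt_def by blast
          obtain t where t: "\<xi> k (proj n w) < t" "t < min b (w n)" using dense[of "\<xi> k (proj n w)" "min b (w n)"] b(1) kw p(3) by auto
          then have "t \<in> {\<xi> k (proj n w)<..w n} \<inter> fib n X (proj n w)" using b(2) unfolding p by (auto simp: fib_def)
          then show "w \<in> X" using dich[OF w] memX[OF w(1)] kw by auto
        qed
      qed
      have "(proj n z)(n := \<xi> k (proj n z)) \<in> rgt n X" using iff[OF z(1)] z(3) by simp
      then have "(proj n z')(n := \<xi> k (proj n z')) \<in> rgt n X"
        using sections_mem[OF kr(1) Ys(3) R(2)[OF z(1)]] sections_mem[OF kr(1) Ys(3) R(2)[OF z(2)]] by simp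
      then show ?thesis using iff[OF z(2)] JJ by simp
    qed
  qed
  then show ?thesis by blast
qed

end

section \<open>Decompositions into controlled cells\<close>

text \<open>One constant serves as coefficient and exponent. The added ones make the base at least
  1, so that the bound is monotone in \<open>c\<close>; actual polynomials are produced only at the
  end.\<close>

definition poly_bounded :: "(nat \<Rightarrow> nat \<Rightarrow> nat) \<Rightarrow> bool" where
  "poly_bounded f \<longleftrightarrow> (\<exists>c. \<forall>D k. f D k \<le> c * ((D + 1) * (k + 1)) ^ c)"

lemma poly_bound_mono:
  fixes c c' x :: nat
  assumes "c \<le> c'" "x \<ge> 1"
  shows "c * x ^ c \<le> c' * x ^ c'"
  using assms by (intro mult_mono power_increasing) auto

lemma poly_bounded_le:
  assumes "poly_bounded g" "\<And>D k. f D k \<le> g D k"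
  shows "poly_bounded f"
proof -
  obtain c where c: "\<forall>D k. g D k \<le> c * ((D + 1) * (k + 1)) ^ c"
    using assms(1) unfolding poly_bounded_def by (rule exE)
  show ?thesis unfolding poly_bounded_def
    by (intro exI[of _ c] allI order.trans[OF assms(2)] c[rule_format])
qed

lemma poly_bounded_const: "poly_bounded (\<lambda>D k. a)"
  unfolding poly_bounded_def
proof (intro exI[of _ a] allI)
  fix D k :: nat
  have "1 \<le> ((D + 1) * (k + 1)) ^ a" by simp
  then show "a \<le> a * ((D + 1) * (k + 1)) ^ a" by (metis mult_le_mono2 mult_1_right)
qed

lemma poly_bounded_D: "poly_bounded (\<lambda>D k. D)"
  unfolding poly_bounded_def by (intro exI[of _ 1]) auto

lemma poly_bounded_k: "poly_bounded (\<lambda>D k. k)"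
  unfolding poly_bounded_def by (intro exI[of _ 1]) auto

lemma poly_bounded_add:
  assumes "poly_bounded f" "poly_bounded g"
  shows "poly_bounded (\<lambda>D k. f D k + g D k)"
proof -
  obtain a where a: "\<And>D k. f D k \<le> a * ((D + 1) * (k + 1)) ^ a" using assms(1) by (auto simp: poly_bounded_def)
  obtain b where b: "\<And>D k. g D k \<le> b * ((D + 1) * (k + 1)) ^ b" using assms(2) by (auto simp: poly_bounded_def)
  have "f D k + g D k \<le> (a + b) * ((D + 1) * (k + 1)) ^ (a + b)" for D k
  proof -
    have "f D k \<le> a * ((D + 1) * (k + 1)) ^ (a + b)"
      by (rule order.trans[OF a]) (intro mult_left_mono power_increasing, auto)
    moreover have "g D k \<le> b * ((D + 1) * (k + 1)) ^ (a + b)"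
      by (rule order.trans[OF b]) (intro mult_left_mono power_increasing, auto)
    ultimately show ?thesis by (simp add: add_mult_distrib)
  qed
  then show ?thesis unfolding poly_bounded_def by blast
qed

lemma poly_bounded_mult:
  assumes "poly_bounded f" "poly_bounded g"
  shows "poly_bounded (\<lambda>D k. f D k * g D k)"
proof -
  obtain a where a: "\<And>D k. f D k \<le> a * ((D + 1) * (k + 1)) ^ a" using assms(1) by (auto simp: poly_bounded_def)
  obtain b where b: "\<And>D k. g D k \<le> b * ((D + 1) * (k + 1)) ^ b" using assms(2) by (auto simp: poly_bounded_def)
  have "f D k * g D k \<le> (a * b + a + b) * ((D + 1) * (k + 1)) ^ (a * b + a + b)" for D k
  proof -
    have "f D k * g D k \<le> (a * ((D + 1) * (k + 1)) ^ a) * (b * ((D + 1) * (k + 1)) ^ b)"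
      by (intro mult_mono a b) auto
    also have "\<dots> = (a * b) * ((D + 1) * (k + 1)) ^ (a + b)" by (simp add: power_add mult_ac)
    also have "\<dots> \<le> (a * b + a + b) * ((D + 1) * (k + 1)) ^ (a * b + a + b)"
      by (intro mult_mono power_increasing) auto
    finally show ?thesis .
  qed
  then show ?thesis unfolding poly_bounded_def by blast
qed

lemma poly_bounded_power:
  assumes "poly_bounded f"
  shows "poly_bounded (\<lambda>D k. f D k ^ n)"
proof (induction n)
  case 0
  show ?case using poly_bounded_const[of 1] by simp
next
  case (Suc n)
  show ?case unfolding power_Suc by (rule poly_bounded_mult[OF assms Suc])
qed

lemma poly_bounded_compose:
  assumes "poly_bounded f" "poly_bounded g" "poly_bounded h"
  shows "poly_bounded (\<lambda>D k. f (g D k) (h D k))"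
proof -
  obtain a where a: "\<And>D k. f D k \<le> a * ((D + 1) * (k + 1)) ^ a" using assms(1) by (auto simp: poly_bounded_def)
  have "poly_bounded (\<lambda>D k. a * ((g D k + 1) * (h D k + 1)) ^ a)"
    by (intro poly_bounded_mult poly_bounded_power poly_bounded_add assms poly_bounded_const)
  then show ?thesis by (rule poly_bounded_le) (rule a)
qed

lemmas poly_bounded_intros = poly_bounded_mult poly_bounded_add poly_bounded_power
  poly_bounded_const poly_bounded_D poly_bounded_k

lemma poly_nat_bounded: "poly_bounded (\<lambda>D k. poly p D)"
proof (induction p)
  case 0
  show ?case unfolding poly_0 by (rule poly_bounded_const)
next
  case (pCons a p)
  show ?case unfolding poly_pCons
    by (intro poly_bounded_add poly_bounded_const poly_bounded_mult poly_bounded_D pCons.IH)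
qed

lemma components_finite:
  assumes "finite (A :: real set)"
  shows "components A = (\<lambda>a. {a}) ` A"
proof -
  have "connected_component_set A a = {a}" if "a \<in> A" for a
  proof -
    have "finite (connected_component_set A a)"
      using connected_component_subset assms by (rule finite_subset)
    moreover have "a \<in> connected_component_set A a" using that by simp
    ultimately obtain b where "connected_component_set A a = {b}"
      using connected_finite_iff_sing[OF connected_connected_component[of A a]] by blast
    then show ?thesis using that connected_component_refl_eq[of A a] by auto
  qed
  then show ?thesis unfolding components_def by auto
qed

text \<open>The frontier in terms of the order alone, which makes \<open>bdry\<close>
  first-order.\<close>

lemma frontier_real_iff:
  fixes A :: "real set"
  shows "t \<in> frontier A \<longleftrightarrow> (\<forall>a b. a < t \<longrightarrow> t < b \<longrightarrow> (\<exists>s. a < s \<and> s < b \<and> s \<in> A) \<and> (\<exists>s. a < s \<and> s < b \<and> \<not> s \<in> A))"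
proof -
  have cl: "t \<in> closure B \<longleftrightarrow> (\<forall>a b. a < t \<longrightarrow> t < b \<longrightarrow> (\<exists>s. a < s \<and> s < b \<and> s \<in> B))" for B :: "real set"
  proof
    assume t: "t \<in> closure B"
    show "\<forall>a b. a < t \<longrightarrow> t < b \<longrightarrow> (\<exists>s. a < s \<and> s < b \<and> s \<in> B)"
    proof (intro allI impI)
      fix a b :: real assume "a < t" "t < b"
      then have "\<exists>s\<in>B. s \<in> {a<..<b}"
        using t open_greaterThanLessThan[of a b] unfolding closure_iff_nhds_not_empty
        by (metis Int_iff all_not_in_conv greaterThanLessThan_iff order_refl)
      then show "\<exists>s. a < s \<and> s < b \<and> s \<in> B" by auto
    qed
  next
    assume B: "\<forall>a b. a < t \<longrightarrow> t < b \<longrightarrow> (\<exists>s. a < s \<and> s < b \<and> s \<in> B)"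
    show "t \<in> closure B" unfolding closure_approachable
    proof (intro allI impI)
      fix e :: real assume "e > 0"
      then obtain s where "t - e < s" "s < t + e" "s \<in> B" using B[rule_format, of "t - e" "t + e"] by auto
      then show "\<exists>y\<in>B. dist y t < e" by (intro bexI[of _ s]) (auto simp: dist_real_def)
    qed
  qed
  show ?thesis unfolding frontier_closures Int_iff cl Compl_iff by blast
qed

section \<open>Complexity of boundaries, fibres and strata\<close>

context presharp begin

lemma UD_uniform:
  assumes "finite A" "\<And>a. a \<in> A \<Longrightarrow> UD I dg n (P a)"
  shows "\<exists>G K. \<forall>a\<in>A. \<forall>i\<in>I. {x \<in> Rn n. P a i x} \<in> \<Omega> G (K * Suc (dg i)) n"
  using assms
proof (induction A rule: finite_induct)
  case (insert b A)
  then obtain G K where 1: "\<And>a i. a \<in> A \<Longrightarrow> i \<in> I \<Longrightarrow> {x \<in> Rn n. P a i x} \<in> \<Omega> G (K * Suc (dg i)) n"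
    by blast
  obtain G' K' where 2: "\<And>i. i \<in> I \<Longrightarrow> {x \<in> Rn n. P b i x} \<in> \<Omega> G' (K' * Suc (dg i)) n"
    using insert.prems[of b] unfolding UD_def by blast
  have "{x \<in> Rn n. P a i x} \<in> \<Omega> (max G G') (max K K' * Suc (dg i)) n" if "a \<in> insert b A" "i \<in> I" for a i
  proof (cases "a = b")
    case True
    have "\<Omega> G' (K' * Suc (dg i)) n \<subseteq> \<Omega> (max G G') (max K K' * Suc (dg i)) n"
      by (intro Omega_mono mult_le_mono) auto
    then show ?thesis using 2[OF that(2)] True by blast
  next
    case False
    have "\<Omega> G (K * Suc (dg i)) n \<subseteq> \<Omega> (max G G') (max K K' * Suc (dg i)) n"
      by (intro Omega_mono mult_le_mono) auto
    then show ?thesis using 1[OF _ that(2), of a] False that(1) by blast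
  qed
  then show ?case by blast
qed simp

lemma UD_bdry:
  assumes X: "UD I dg (Suc n) (\<lambda>i z. z \<in> X i)"
  shows "UD I dg (Suc n) (\<lambda>i z. z \<in> bdry n (X i))"
proof -
  have "UD I dg (Suc n) (\<lambda>i z. \<forall>a b. a < z n \<longrightarrow> z n < b \<longrightarrow>
      (\<exists>s. a < s \<and> s < b \<and> (proj n z)(n := s) \<in> X i) \<and> (\<exists>s. a < s \<and> s < b \<and> \<not> (proj n z)(n := s) \<in> X i))"
    by (intro UD_intros UD_mem[OF X]) (simp_all add: UD_terms)
  then show ?thesis by (rule UD_cong) (simp add: bdry_def frontier_real_iff fib_def)
qed

lemma UD_rgt:
  assumes X: "UD I dg (Suc n) (\<lambda>i z. z \<in> X i)"
  shows "UD I dg (Suc n) (\<lambda>i z. z \<in> rgt n (X i))"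
proof -
  have "UD I dg (Suc n) (\<lambda>i z. z \<in> bdry n (X i) \<and> (\<exists>b. z n < b \<and> (\<forall>t. z n < t \<longrightarrow> t < b \<longrightarrow> (proj n z)(n := t) \<in> X i)))"
    by (intro UD_intros UD_mem[OF X] UD_mem[OF UD_bdry[OF X]]) (simp_all add: UD_terms)
  then show ?thesis by (rule UD_cong) (simp add: rgt_def)
qed

lemma UD_bot:
  assumes X: "UD I dg (Suc n) (\<lambda>i z. z \<in> X i)"
  shows "UD I dg n (\<lambda>i x. x \<in> bot n (X i))"
proof -
  have "UD I dg n (\<lambda>i x. \<exists>m. \<forall>t. t < m \<longrightarrow> x(n := t) \<in> X i)"
    by (intro UD_intros UD_mem[OF X]) (simp_all add: UD_terms)
  then show ?thesis by (rule UD_cong) (simp add: bot_def)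
qed

lemma UD_given:
  assumes "\<And>i. i \<in> I \<Longrightarrow> X i \<in> \<Omega> F (dg i) n"
  shows "UD I dg n (\<lambda>i z. z \<in> X i)"
proof (rule UD_I[of _ _ _ F 1])
  fix i assume "i \<in> I"
  then have X: "X i \<in> \<Omega> F (dg i) n" by (rule assms)
  then have "{x \<in> Rn n. x \<in> X i} = X i" using definable subset_Rn by blast
  then show "{x \<in> Rn n. x \<in> X i} \<in> \<Omega> F (1 * Suc (dg i)) n"
    using subsetD[OF Omega_mono X, of F "Suc (dg i)"] by simp
qed

text \<open>The components of a finite set are its points, so (P1) counts them. It applies with one
  format because the base point is a mere parameter of the fibre.\<close>

lemma card_fib_bound:
  "\<exists>f. poly_bounded (\<lambda>D k. f D) \<and> (\<forall>D Y x. Y \<in> \<Omega> F D (Suc n) \<longrightarrow> x \<in> Rn n \<longrightarrow> finite (fib n Y x) \<longrightarrow> card (fib n Y x) \<le> f D)"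
proof -
  define I where "I = {(Y, x, D). Y \<in> \<Omega> F D (Suc n) \<and> x \<in> Rn n}"
  have "UD I (\<lambda>i. snd (snd i)) (Suc n) (\<lambda>i z. z \<in> fst i)"
    by (rule UD_given[where F = F]) (auto simp: I_def)
  then have "UD I (\<lambda>i. snd (snd i)) 1 (\<lambda>i w. w 0 \<in> fib n (fst i) (fst (snd i)))"
    by (rule UD_fib) (auto simp: I_def)
  then obtain G K where GK: "\<And>i. i \<in> I \<Longrightarrow> {w \<in> Rn 1. w 0 \<in> fib n (fst i) (fst (snd i))} \<in> \<Omega> G (K * Suc (snd (snd i))) 1"
    unfolding UD_def by blast
  obtain P :: "nat poly" where P: "\<And>D A. A \<in> \<Omega> G D 1 \<Longrightarrow> card (components ((\<lambda>x. x 0) ` A)) \<le> poly P D"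
    using P1[of G] by blast
  have "card (fib n Y x) \<le> poly P (K * (D + 1))" if Y: "Y \<in> \<Omega> F D (Suc n)" "x \<in> Rn n" "finite (fib n Y x)" for D Y x
  proof -
    have "(Y, x, D) \<in> I" using Y by (simp add: I_def)
    from P[OF GK[OF this]]
    have "card (components ((\<lambda>x. x 0) ` {w \<in> Rn 1. w 0 \<in> fib n Y x})) \<le> poly P (K * (D + 1))" by simp
    moreover have "(\<lambda>x. x 0) ` {w \<in> Rn 1. w 0 \<in> fib n Y x} = fib n Y x"
    proof
      show "fib n Y x \<subseteq> (\<lambda>x. x 0) ` {w \<in> Rn 1. w 0 \<in> fib n Y x}"
      proof
        fix y assume "y \<in> fib n Y x"
        then show "y \<in> (\<lambda>x. x 0) ` {w \<in> Rn 1. w 0 \<in> fib n Y x}"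
          by (intro image_eqI[of _ _ "(\<lambda>_. 0)(0 := y)"]) (auto simp: Rn_iff)
      qed
    qed auto
    moreover have "card (components (fib n Y x)) = card (fib n Y x)"
      unfolding components_finite[OF Y(3)] by (rule card_image) (auto simp: inj_on_def)
    ultimately show ?thesis by simp
  qed
  moreover have "poly_bounded (\<lambda>D k. poly P (K * (D + 1)))"
    by (rule poly_bounded_compose[OF poly_nat_bounded _ poly_bounded_k]) (intro poly_bounded_intros)+
  ultimately show ?thesis by (intro exI[of _ "\<lambda>D. poly P (K * (D + 1))"]) blast
qed

lemma finite_fib_bdry:
  assumes "X \<in> S (Suc n)" "x \<in> Rn n"
  shows "finite (fib n (bdry n X) x)"
proof -
  have "fib n (bdry n X) x = frontier (fib n X x)"
    using bdry_fib[OF assms(2)] by (auto simp: fib_def)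
  then show ?thesis using fib_definable(2)[OF assms] by simp
qed

text \<open>The strata begin with \<real>^n and end with the empty set at \<open>n + 1\<close>, so
  there is a last one that contains \<open>C\<close>. As \<open>C\<close> misses the next, all its
  points are even relative to that stratum.\<close>

lemma strata_evenly:
  assumes Y: "Y \<in> S (Suc n)" "\<And>x. x \<in> Rn n \<Longrightarrow> finite (fib n Y x)" and C: "C \<subseteq> Rn n" "C \<noteq> {}"
    and comp: "\<And>j. j \<le> n \<Longrightarrow> C \<subseteq> strata n Y j \<or> C \<inter> strata n Y j = {}" and x: "x \<in> C"
  shows "evenly n C Y x"
proof -
  note strata.simps(2)[simp del]
  have comp': "C \<subseteq> strata n Y j \<or> C \<inter> strata n Y j = {}" if "j \<le> Suc n" for j
    using comp[of j] strata_empty[OF Y] that by (cases "j = Suc n") auto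
  define j where "j = (LEAST j. j \<le> Suc n \<and> C \<inter> strata n Y j = {})"
  have ex: "Suc n \<le> Suc n \<and> C \<inter> strata n Y (Suc n) = {}" using strata_empty[OF Y] by simp
  have j: "j \<le> Suc n" "C \<inter> strata n Y j = {}" using LeastI[of "\<lambda>j. j \<le> Suc n \<and> C \<inter> strata n Y j = {}", OF ex] by (simp_all add: j_def)
  have "j \<noteq> 0"
  proof
    assume "j = 0"
    then have "C \<inter> Rn n = {}" using j(2) by simp
    then show False using C by blast
  qed
  then obtain i where i: "j = Suc i" by (cases j) auto
  have "C \<inter> strata n Y i \<noteq> {}"
    using not_less_Least[of i "\<lambda>j. j \<le> Suc n \<and> C \<inter> strata n Y j = {}"] i j(1) unfolding j_def[symmetric] by simp
  then have sub: "C \<subseteq> strata n Y i" using comp'[of i] i j(1) by simp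
  have "x \<notin> strata n Y (Suc i)" using j(2) x i by blast
  then have "evenly n (strata n Y i) Y x" using sub x C unfolding strata.simps(2) by blast
  then show ?thesis using sub by (rule evenly_mono)
qed

definition stacked :: "nat \<Rightarrow> point set set \<Rightarrow> (point set \<Rightarrow> bool) \<Rightarrow> point set \<Rightarrow> point set set \<Rightarrow> bool" where
  "stacked n Xs P C T \<longleftrightarrow> finite T \<and>
     (\<forall>E\<in>T. cell S (Suc n) E \<and> E \<in> S (Suc n) \<and> connected E \<and> proj n ` E = C \<and> E \<subseteq> Rn (Suc n) \<and>
        (\<forall>X\<in>Xs. E \<subseteq> X \<or> E \<inter> X = {}) \<and> P E) \<and>
     (\<forall>z\<in>Rn (Suc n). proj n z \<in> C \<longrightarrow> (\<exists>E\<in>T. z \<in> E)) \<and>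
     (\<forall>E\<in>T. \<forall>E'\<in>T. \<forall>z. z \<in> E \<longrightarrow> z \<in> E' \<longrightarrow> E = E')"

lemma stacked_mono:
  assumes "stacked n Xs P C T" "\<And>E. P E \<Longrightarrow> Q E"
  shows "stacked n Xs Q C T"
  using assms by (simp add: stacked_def)

lemma stack_exists:
  assumes C: "C \<in> S n" "connected C" "C \<noteq> {}" "n = 0 \<and> C = Rn 0 \<or> cell S n C"
    and Ys: "finite Ys" "Ys \<subseteq> S (Suc n)" "\<And>Y x. Y \<in> Ys \<Longrightarrow> x \<in> Rn n \<Longrightarrow> finite (fib n Y x)"
    and comp: "\<And>Y Y' j. Y \<in> Ys \<Longrightarrow> Y' \<in> Ys \<Longrightarrow> j \<le> n \<Longrightarrow> C \<subseteq> strata n (Y \<union> Y') j \<or> C \<inter> strata n (Y \<union> Y') j = {}"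
    and Xs: "\<And>X. X \<in> Xs \<Longrightarrow> {bdry n X, bdry n X \<inter> X, rgt n X} \<subseteq> Ys"
      "\<And>X. X \<in> Xs \<Longrightarrow> C \<subseteq> bot n X \<or> C \<inter> bot n X = {}"
    and card: "\<And>Y x. Y \<in> Ys \<Longrightarrow> x \<in> Rn n \<Longrightarrow> card (fib n Y x) \<le> b" and W: "controls n \<W> C"
  shows "\<exists>T. card T \<le> 2 * (card Ys * b) + 1 \<and>
    stacked n Xs (\<lambda>E. \<exists>B\<subseteq>Ys. card B \<le> 2 \<and> controls (Suc n) (times_R n ` \<W> \<union> B) E) C T"
proof -
  have CR: "C \<subseteq> Rn n" by (rule subset_Rn[OF C(1)])
  obtain c where c: "c \<in> C" using C(3) by blast
  have fibU: "fib n (\<Union>Ys) x = (\<Union>Y\<in>Ys. fib n Y x)" for x by (auto simp: fib_def)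
  have "finite (fib n (\<Union>Ys) x)" if "x \<in> C" for x
    unfolding fibU using Ys(1,3) that CR by blast
  moreover have "evenly n C (Y \<union> Y') x" if Y: "Y \<in> Ys" "Y' \<in> Ys" and x: "x \<in> C" for Y Y' x
  proof (rule strata_evenly[OF _ _ CR C(3) comp[OF Y] x])
    show "Y \<union> Y' \<in> S (Suc n)" using Ys(2) Y by (intro union) auto
    fix x assume "x \<in> Rn n"
    moreover have "fib n (Y \<union> Y') x = fib n Y x \<union> fib n Y' x" by (auto simp: fib_def)
    ultimately show "finite (fib n (Y \<union> Y') x)" using Ys(3) Y by simp
  qed
  ultimately obtain \<xi> where \<xi>:
    "\<And>x. x \<in> C \<Longrightarrow> fib n (\<Union>Ys) x = (\<lambda>i. \<xi> i x) ` {..<card (fib n (\<Union>Ys) c)}"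
    "\<And>i j x. i < j \<Longrightarrow> j < card (fib n (\<Union>Ys) c) \<Longrightarrow> x \<in> C \<Longrightarrow> \<xi> i x < \<xi> j x"
    "\<And>i. i < card (fib n (\<Union>Ys) c) \<Longrightarrow> continuous_on C (\<xi> i)"
    "\<And>i Y x. i < card (fib n (\<Union>Ys) c) \<Longrightarrow> Y \<in> Ys \<Longrightarrow> x \<in> C \<Longrightarrow> x(n := \<xi> i x) \<in> Y \<longleftrightarrow> c(n := \<xi> i c) \<in> Y"
    using sections[OF Ys(1) CR C(2) c] by blast
  interpret section_stack S \<Omega> n C Ys "card (fib n (\<Union>Ys) c)" \<xi> c
    by unfold_locales (rule C(1) C(2) c Ys(1) Ys(2) \<xi>; assumption)+
  have "card (fib n (\<Union>Ys) c) \<le> (\<Sum>Y\<in>Ys. card (fib n Y c))"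
    unfolding fibU by (rule card_UN_le[OF Ys(1)])
  also have "\<dots> \<le> card Ys * b" using sum_bounded_above[of Ys "\<lambda>Y. card (fib n Y c)" b] card c CR by auto
  finally have r: "card (fib n (\<Union>Ys) c) \<le> card Ys * b" .
  show ?thesis
    unfolding stacked_def
  proof (rule exI[of _ stack], intro conjI ballI allI impI)
    show "finite stack" by (rule card_stack)
    show "card stack \<le> 2 * (card Ys * b) + 1" using card_stack(2) r by linarith
    fix D assume D: "D \<in> stack"
    show "cell S (Suc n) D" by (rule stack_cell[OF D C(4)])
    show "D \<in> S (Suc n)" by (rule stack_definable[OF D])
    show "connected D" by (rule stack_connected[OF D])
    show "proj n ` D = C" by (rule proj_stack[OF D])
    show "D \<subseteq> Rn (Suc n)" using stack_subset[OF D] by blast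
    show "\<exists>B\<subseteq>Ys. card B \<le> 2 \<and> controls (Suc n) (times_R n ` \<W> \<union> B) D" by (rule stack_controlled[OF W D])
    show "D \<subseteq> X \<or> D \<inter> X = {}" if "X \<in> Xs" for X
      using stack_compatible[OF _ _ _ Xs(2)[OF that] D] Xs(1)[OF that] by simp
    show "D = D'" if "D' \<in> stack" "z \<in> D" "z \<in> D'" for D' z by (rule stack_disjoint[OF D that])
  next
    show "\<exists>D\<in>stack. z \<in> D" if "z \<in> Rn (Suc n)" "proj n z \<in> C" for z by (rule stack_covers[OF that])
  qed
qed

end

lemma Rn_0: "Rn 0 = {\<lambda>_. 0}"
  by (auto simp: Rn_iff)

section \<open>From stacks to cell decompositions\<close>

context o_minimal begin

text \<open>The trivial partition of \<real>^0 is included to start the induction, so that dimension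
  1 becomes an ordinary step.\<close>

definition decomp :: "nat \<Rightarrow> point set set \<Rightarrow> bool" where
  "decomp n \<C> \<longleftrightarrow> n = 0 \<and> \<C> = {Rn 0} \<or> cell_decomposition S n \<C>"

lemma decomp_partition:
  assumes "decomp n \<C>"
  shows "partition_on (Rn n) \<C>" "\<And>C. C \<in> \<C> \<Longrightarrow> n = 0 \<and> C = Rn 0 \<or> cell S n C"
proof -
  have "partition_on (Rn n) \<C> \<and> (\<forall>C\<in>\<C>. n = 0 \<and> C = Rn 0 \<or> cell S n C)"
    using assms unfolding decomp_def
  proof (elim disjE conjE)
    assume "n = 0" "\<C> = {Rn 0}"
    then show ?thesis by (simp add: partition_on_def Rn_0 disjoint_def)
  next
    assume "cell_decomposition S n \<C>"
    then show ?thesis by cases auto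
  qed
  then show "partition_on (Rn n) \<C>" "\<And>C. C \<in> \<C> \<Longrightarrow> n = 0 \<and> C = Rn 0 \<or> cell S n C" by blast+
qed

lemma decomp_stacks:
  assumes \<C>: "decomp n \<C>"
    and T: "\<And>C D. C \<in> \<C> \<Longrightarrow> D \<in> T C \<Longrightarrow> cell S (Suc n) D \<and> proj n ` D = C \<and> D \<subseteq> Rn (Suc n)"
    and cover: "\<And>C z. C \<in> \<C> \<Longrightarrow> z \<in> Rn (Suc n) \<Longrightarrow> proj n z \<in> C \<Longrightarrow> \<exists>D\<in>T C. z \<in> D"
    and disj: "\<And>C D D' z. C \<in> \<C> \<Longrightarrow> D \<in> T C \<Longrightarrow> D' \<in> T C \<Longrightarrow> z \<in> D \<Longrightarrow> z \<in> D' \<Longrightarrow> D = D'"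
  shows "decomp (Suc n) (\<Union>C\<in>\<C>. T C)"
proof -
  have part: "\<Union>\<C> = Rn n" "disjoint \<C>" "{} \<notin> \<C>"
    using decomp_partition(1)[OF \<C>] by (auto simp: partition_on_def)
  have "\<Union>(\<Union>C\<in>\<C>. T C) = Rn (Suc n)"
  proof
    show "\<Union>(\<Union>C\<in>\<C>. T C) \<subseteq> Rn (Suc n)" using T by blast
    show "Rn (Suc n) \<subseteq> \<Union>(\<Union>C\<in>\<C>. T C)"
    proof
      fix z assume z: "z \<in> Rn (Suc n)"
      have "proj n z \<in> \<Union>\<C>" unfolding part(1) by simp
      then obtain C where "C \<in> \<C>" "proj n z \<in> C" by blast
      then show "z \<in> \<Union>(\<Union>C\<in>\<C>. T C)" using cover[OF _ z] by blast
    qed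
  qed
  moreover have "disjoint (\<Union>C\<in>\<C>. T C)"
  proof (rule disjointI)
    fix D D' assume D: "D \<in> (\<Union>C\<in>\<C>. T C)" "D' \<in> (\<Union>C\<in>\<C>. T C)" "D \<noteq> D'"
    then obtain C C' where C: "C \<in> \<C>" "D \<in> T C" "C' \<in> \<C>" "D' \<in> T C'" by blast
    show "D \<inter> D' = {}"
    proof (rule ccontr)
      assume "D \<inter> D' \<noteq> {}"
      then obtain z where z: "z \<in> D" "z \<in> D'" by blast
      then have "proj n z \<in> C" "proj n z \<in> C'" using T[OF C(1,2)] T[OF C(3,4)] by auto
      then have "C = C'" using part(2) C(1,3) unfolding disjoint_def by blast
      then show False using disj[OF C(1,2) _ z] C(4) D(3) by simp
    qed
  qed
  moreover have "{} \<notin> (\<Union>C\<in>\<C>. T C)"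
  proof
    assume "{} \<in> (\<Union>C\<in>\<C>. T C)"
    then obtain C where "C \<in> \<C>" "{} \<in> T C" by blast
    then have "C = {}" using T[of C "{}"] by simp
    then show False using part(3) \<open>C \<in> \<C>\<close> by simp
  qed
  ultimately have P: "partition_on (Rn (n + 1)) (\<Union>C\<in>\<C>. T C)" by (simp add: partition_on_def)
  have cells: "\<forall>D\<in>(\<Union>C\<in>\<C>. T C). cell S (n + 1) D" using T by auto
  show ?thesis
  proof (cases "n = 0")
    case True
    then show ?thesis using cell_decomposition.line[of "\<Union>C\<in>\<C>. T C" S] P cells by (simp add: decomp_def)
  next
    case False
    have "(\<lambda>D. proj n ` D) ` (\<Union>C\<in>\<C>. T C) = \<C>"
    proof
      show "(\<lambda>D. proj n ` D) ` (\<Union>C\<in>\<C>. T C) \<subseteq> \<C>" using T by auto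
      show "\<C> \<subseteq> (\<lambda>D. proj n ` D) ` (\<Union>C\<in>\<C>. T C)"
      proof
        fix C assume C: "C \<in> \<C>"
        then obtain x where x: "x \<in> C" using part(3) by (metis ex_in_conv)
        then have xR: "x \<in> Rn n" using C part(1) by blast
        obtain D where "D \<in> T C"
          using cover[OF C Rn_upd[OF xR, of 0]] proj_upd[OF xR, of 0] x by auto
        then show "C \<in> (\<lambda>D. proj n ` D) ` (\<Union>C\<in>\<C>. T C)" using T[OF C] C by (intro image_eqI[of _ _ D]) auto
      qed
    qed
    moreover have "cell_decomposition S n \<C>" using \<C> False by (simp add: decomp_def)
    ultimately have "cell_decomposition S (n + 1) (\<Union>C\<in>\<C>. T C)"
      using cell_decomposition.step[OF P cells] by simp
    then show ?thesis by (simp add: decomp_def)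
  qed
qed

end

section \<open>Induction on the dimension\<close>

context presharp begin

text \<open>Degree and number of the controlling sets are bounded separately: for cells the number
  is constant while the degree is linear in \<open>D\<close>.\<close>

definition controllable :: "nat \<Rightarrow> nat \<Rightarrow> nat \<Rightarrow> nat \<Rightarrow> point set \<Rightarrow> bool" where
  "controllable G d m n C \<longleftrightarrow> (\<exists>\<W>. \<W> \<subseteq> \<Omega> G d n \<and> finite \<W> \<and> card \<W> \<le> m \<and> controls n \<W> C)"

lemma controllable_mono:
  assumes "controllable G d m n C" "G \<le> G'" "d \<le> d'" "m \<le> m'"
  shows "controllable G' d' m' n C"
proof -
  obtain \<W> where "\<W> \<subseteq> \<Omega> G d n" "finite \<W>" "card \<W> \<le> m" "controls n \<W> C"
    using assms(1) unfolding controllable_def by blast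
  then show ?thesis
    using Omega_mono[OF assms(2,3), of n] assms(4) unfolding controllable_def by (intro exI[of _ \<W>]) auto
qed

text \<open>Control of the base is recorded as well, because the projection of a union of cells is
  the union of their bases.\<close>

definition good_cell :: "nat \<Rightarrow> nat \<Rightarrow> nat \<Rightarrow> nat \<Rightarrow> point set \<Rightarrow> bool" where
  "good_cell G d m n C \<longleftrightarrow> C \<in> S n \<and> connected C \<and> controllable G d m n C \<and>
     (\<forall>l. n = Suc l \<longrightarrow> controllable G d m l (proj l ` C))"

lemma good_cellD:
  assumes "good_cell G d m n C"
  shows "C \<in> S n" "connected C" "controllable G d m n C" "n = Suc l \<Longrightarrow> controllable G d m l (proj l ` C)"
  using assms unfolding good_cell_def by blast+

definition decomposes :: "nat \<Rightarrow> nat \<Rightarrow> nat \<Rightarrow> nat \<Rightarrow> nat \<Rightarrow> nat \<Rightarrow> bool" where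
  "decomposes n F G c L m \<longleftrightarrow> (\<forall>D Xs. finite Xs \<longrightarrow> Xs \<subseteq> \<Omega> F D n \<longrightarrow>
     (\<exists>\<C>. decomp n \<C> \<and> finite \<C> \<and> card \<C> \<le> c * ((D + 1) * (card Xs + 1)) ^ c \<and>
       (\<forall>X\<in>Xs. compatible \<C> X) \<and>
       (\<forall>C\<in>\<C>. good_cell G (L * Suc D) m n C)))"

lemma decomposes_0: "decomposes 0 F 0 1 0 0"
  unfolding decomposes_def
proof (intro allI impI)
  fix D Xs assume "Xs \<subseteq> \<Omega> F D 0"
  then have Xs: "X \<subseteq> Rn 0" if "X \<in> Xs" for X using definable subset_Rn that by blast
  show "\<exists>\<C>. decomp 0 \<C> \<and> finite \<C> \<and> card \<C> \<le> 1 * ((D + 1) * (card Xs + 1)) ^ 1 \<and>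
       (\<forall>X\<in>Xs. compatible \<C> X) \<and>
       (\<forall>C\<in>\<C>. good_cell 0 (0 * Suc D) 0 0 C)"
  proof (rule exI[of _ "{Rn 0}"], intro conjI)
    show "decomp 0 {Rn 0}" by (simp add: decomp_def)
    show "\<forall>X\<in>Xs. compatible {Rn 0} X" using Xs unfolding compatible_def Rn_0 by blast
    have "controls 0 {} (Rn 0)" unfolding controls_def by blast
    then have "controllable 0 (0 * Suc D) 0 0 (Rn 0)" unfolding controllable_def
      by (intro exI[of _ "{}"]) simp
    moreover have "connected (Rn 0)" by (simp add: Rn_0)
    moreover have "Rn 0 \<in> S 0" using compl[OF empty, of 0] by simp
    ultimately show "\<forall>C\<in>{Rn 0}. good_cell 0 (0 * Suc D) 0 0 C" by (simp add: good_cell_def)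
  qed simp_all
qed

lemma boundary_family_complexity:
  "\<exists>G K. \<forall>D. \<forall>X\<in>\<Omega> F D (Suc n). {bdry n X, bdry n X \<inter> X, rgt n X} \<subseteq> \<Omega> G (K * Suc D) (Suc n) \<and>
     bot n X \<in> \<Omega> G (K * Suc D) n"
proof -
  define I where "I = {(X, D). X \<in> \<Omega> F D (Suc n)}"
  have X: "UD I snd (Suc n) (\<lambda>i z. z \<in> fst i)" by (rule UD_given[where F = F]) (auto simp: I_def)
  obtain G1 K1 where 1: "\<And>i. i \<in> I \<Longrightarrow> {z \<in> Rn (Suc n). z \<in> bdry n (fst i)} \<in> \<Omega> G1 (K1 * Suc (snd i)) (Suc n)"
    using UD_bdry[OF X] unfolding UD_def by blast
  obtain G2 K2 where 2: "\<And>i. i \<in> I \<Longrightarrow> {z \<in> Rn (Suc n). z \<in> bdry n (fst i) \<and> z \<in> fst i} \<in> \<Omega> G2 (K2 * Suc (snd i)) (Suc n)"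
    using UD_conj[OF UD_bdry[OF X] X] unfolding UD_def by blast
  obtain G3 K3 where 3: "\<And>i. i \<in> I \<Longrightarrow> {z \<in> Rn (Suc n). z \<in> rgt n (fst i)} \<in> \<Omega> G3 (K3 * Suc (snd i)) (Suc n)"
    using UD_rgt[OF X] unfolding UD_def by blast
  obtain G4 K4 where 4: "\<And>i. i \<in> I \<Longrightarrow> {x \<in> Rn n. x \<in> bot n (fst i)} \<in> \<Omega> G4 (K4 * Suc (snd i)) n"
    using UD_bot[OF X] unfolding UD_def by blast
  define G where "G = G1 + G2 + G3 + G4"
  define K where "K = K1 + K2 + K3 + K4"
  have mono: "\<Omega> G1 (K1 * d) l \<subseteq> \<Omega> G (K * d) l" "\<Omega> G2 (K2 * d) l \<subseteq> \<Omega> G (K * d) l"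
    "\<Omega> G3 (K3 * d) l \<subseteq> \<Omega> G (K * d) l" "\<Omega> G4 (K4 * d) l \<subseteq> \<Omega> G (K * d) l" for d l
    by (intro Omega_mono mult_le_mono; simp add: G_def K_def)+
  have "{bdry n X, bdry n X \<inter> X, rgt n X} \<subseteq> \<Omega> G (K * Suc D) (Suc n) \<and> bot n X \<in> \<Omega> G (K * Suc D) n"
    if "X \<in> \<Omega> F D (Suc n)" for D X
  proof -
    have i: "(X, D) \<in> I" using that by (simp add: I_def)
    have "bdry n X = {z \<in> Rn (Suc n). z \<in> bdry n X}" by (auto simp: bdry_def)
    then have "bdry n X \<in> \<Omega> G (K * Suc D) (Suc n)" using 1[OF i] mono(1)[of "Suc D" "Suc n"] by auto
    moreover have "bdry n X \<inter> X = {z \<in> Rn (Suc n). z \<in> bdry n X \<and> z \<in> X}" by (auto simp: bdry_def)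
    then have "bdry n X \<inter> X \<in> \<Omega> G (K * Suc D) (Suc n)" using 2[OF i] mono(2)[of "Suc D" "Suc n"] by auto
    moreover have "rgt n X = {z \<in> Rn (Suc n). z \<in> rgt n X}" by (auto simp: rgt_def bdry_def)
    then have "rgt n X \<in> \<Omega> G (K * Suc D) (Suc n)" using 3[OF i] mono(3)[of "Suc D" "Suc n"] by auto
    moreover have "bot n X = {x \<in> Rn n. x \<in> bot n X}" by (auto simp: bot_def)
    then have "bot n X \<in> \<Omega> G (K * Suc D) n" using 4[OF i] mono(4)[of "Suc D" n] by auto
    ultimately show ?thesis by blast
  qed
  then show ?thesis by blast
qed

lemma strata_complexity:
  "\<exists>G K. \<forall>D. \<forall>Y\<in>\<Omega> F D (Suc n). \<forall>Y'\<in>\<Omega> F D (Suc n). \<forall>j\<le>n. strata n (Y \<union> Y') j \<in> \<Omega> G (K * Suc D) n"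
proof -
  define I where "I = {(Y, Y', D). Y \<in> \<Omega> F D (Suc n) \<and> Y' \<in> \<Omega> F D (Suc n)}"
  have 1: "UD I (\<lambda>i. snd (snd i)) (Suc n) (\<lambda>i z. z \<in> fst i)"
    by (rule UD_given[where F = F]) (auto simp: I_def)
  have 2: "UD I (\<lambda>i. snd (snd i)) (Suc n) (\<lambda>i z. z \<in> fst (snd i))"
    by (rule UD_given[where F = F]) (auto simp: I_def)
  have "UD I (\<lambda>i. snd (snd i)) (Suc n) (\<lambda>i z. z \<in> fst i \<union> fst (snd i))"
    using UD_disj[OF 1 2] by (rule UD_cong) simp
  then have "\<And>j. UD I (\<lambda>i. snd (snd i)) n (\<lambda>i x. x \<in> strata n (fst i \<union> fst (snd i)) j)"
    by (rule UD_strata)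
  then have "\<exists>G K. \<forall>j\<in>{..n}. \<forall>i\<in>I. {x \<in> Rn n. x \<in> strata n (fst i \<union> fst (snd i)) j} \<in> \<Omega> G (K * Suc (snd (snd i))) n"
    by (intro UD_uniform) auto
  then obtain G K where GK: "\<And>j i. j \<le> n \<Longrightarrow> i \<in> I \<Longrightarrow>
      {x \<in> Rn n. x \<in> strata n (fst i \<union> fst (snd i)) j} \<in> \<Omega> G (K * Suc (snd (snd i))) n"
    by blast
  have "strata n (Y \<union> Y') j \<in> \<Omega> G (K * Suc D) n"
    if "Y \<in> \<Omega> F D (Suc n)" "Y' \<in> \<Omega> F D (Suc n)" "j \<le> n" for D Y Y' j
  proof -
    have "(Y, Y', D) \<in> I" using that by (simp add: I_def)
    from GK[OF that(3) this] have "{x \<in> Rn n. x \<in> strata n (Y \<union> Y') j} \<in> \<Omega> G (K * Suc D) n" by simp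
    moreover have "{x \<in> Rn n. x \<in> strata n (Y \<union> Y') j} = strata n (Y \<union> Y') j" using strata_subset_Rn by blast
    ultimately show ?thesis by simp
  qed
  then show ?thesis by blast
qed

text \<open>The base is decomposed compatibly with the strata of the pairwise unions of the boundary
  sets. These have larger format than the given sets, which is why the induction hypothesis is
  required for all formats.\<close>

lemma decomposes_Suc:
  assumes IH: "\<And>F. \<exists>G c L m. decomposes n F G c L m"
  shows "\<exists>G c L m. decomposes (Suc n) F G c L m"
proof -
  obtain G1 K1 where b1': "\<forall>D. \<forall>X\<in>\<Omega> F D (Suc n). {bdry n X, bdry n X \<inter> X, rgt n X} \<subseteq> \<Omega> G1 (K1 * Suc D) (Suc n) \<and>
     bot n X \<in> \<Omega> G1 (K1 * Suc D) n"
    using boundary_family_complexity[of F n] by (elim exE)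
  note b1 = b1'[rule_format]
  obtain G2 K2 where b2': "\<forall>D. \<forall>Y\<in>\<Omega> G1 D (Suc n). \<forall>Y'\<in>\<Omega> G1 D (Suc n). \<forall>j\<le>n.
      strata n (Y \<union> Y') j \<in> \<Omega> G2 (K2 * Suc D) n"
    using strata_complexity[of G1 n] by (elim exE)
  note b2 = b2'[rule_format]
  obtain f where f': "poly_bounded (\<lambda>D k. f D) \<and> (\<forall>D Y x. Y \<in> \<Omega> G1 D (Suc n) \<longrightarrow> x \<in> Rn n \<longrightarrow>
      finite (fib n Y x) \<longrightarrow> card (fib n Y x) \<le> f D)"
    using card_fib_bound[of G1 n] by (elim exE)
  note f = f'[THEN conjunct1] f'[THEN conjunct2, rule_format]
  define F' where "F' = max G1 G2"
  define D1 where "D1 D = K1 * Suc D" for D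
  define D' where "D' D = D1 D + K2 * Suc (D1 D)" for D
  obtain G4 c4 L4 m4 where IH': "decomposes n F' G4 c4 L4 m4" using IH by blast
  \<comment> \<open>The first factor bounds the base cells: there are at most \<open>3 * k\<close>
    boundary sets, \<open>n + 1\<close> strata for each pair of them, and \<open>k\<close> sets
    \<open>bot\<close>. The second bounds a stack by \<open>2 * r + 1\<close> cells, where
    \<open>r\<close> is at most the number of boundary sets times the size of a fibre.\<close>
  define h where "h D k = c4 * ((D' D + 1) * ((3 * k) * (3 * k) * Suc n + k + 1)) ^ c4 * (2 * ((3 * k) * f (D1 D)) + 1)" for D k
  have D1_bd: "poly_bounded (\<lambda>D k. D1 D)" unfolding D1_def Suc_eq_plus1 by (intro poly_bounded_intros)
  have D'_bd: "poly_bounded (\<lambda>D k. D' D)" unfolding D'_def Suc_eq_plus1 by (intro poly_bounded_intros D1_bd)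
  have fD1_bd: "poly_bounded (\<lambda>D k. f (D1 D))" by (rule poly_bounded_compose[OF f(1) D1_bd poly_bounded_k])
  have "poly_bounded h" unfolding h_def by (intro poly_bounded_intros D'_bd fD1_bd)
  then obtain c where c: "\<And>D k. h D k \<le> c * ((D + 1) * (k + 1)) ^ c" unfolding poly_bounded_def by blast
  \<comment> \<open>The format rises by one for the products of the base's controlling sets with
    \<real>. In \<open>L\<close> the first summand absorbs the degree of the strata and the second
    that of the boundary sets; \<open>m\<close> grows by the two sets of
    \<open>stack_controlled\<close>.\<close>
  define G where "G = max (G4 + 1) G1"
  define L where "L = L4 * (K1 + K2 * (K1 + 1) + 1) + K1"
  define m where "m = m4 + 2"
  have L1: "D1 D \<le> L * Suc D" for D unfolding D1_def L_def by (intro mult_le_mono) auto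
  have L2: "L4 * Suc (D' D) \<le> L * Suc D" for D
  proof -
    have "Suc (D1 D) \<le> (K1 + 1) * Suc D" by (simp add: D1_def)
    then have "K2 * Suc (D1 D) \<le> K2 * ((K1 + 1) * Suc D)" by (rule mult_le_mono2)
    then have "Suc (D' D) \<le> K1 * Suc D + K2 * ((K1 + 1) * Suc D) + Suc D" unfolding D'_def D1_def by linarith
    also have "\<dots> = (K1 + K2 * (K1 + 1) + 1) * Suc D" by (simp add: algebra_simps)
    finally have "L4 * Suc (D' D) \<le> L4 * ((K1 + K2 * (K1 + 1) + 1) * Suc D)" by (rule mult_le_mono2)
    also have "\<dots> = (L4 * (K1 + K2 * (K1 + 1) + 1)) * Suc D" by (rule mult.assoc[symmetric])
    also have "\<dots> \<le> L * Suc D" unfolding L_def by (rule mult_le_mono1) simp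
    finally show ?thesis .
  qed
  have "decomposes (Suc n) F G c L m"
    unfolding decomposes_def
  proof (intro allI impI)
    fix D Xs assume Xs: "finite Xs" "Xs \<subseteq> \<Omega> F D (Suc n)"
    define k where "k = card Xs"
    define Ys where "Ys = bdry n ` Xs \<union> (\<lambda>X. bdry n X \<inter> X) ` Xs \<union> rgt n ` Xs"
    have Ys_fin: "finite Ys" using Xs(1) by (simp add: Ys_def)
    have Ys_\<Omega>: "Ys \<subseteq> \<Omega> G1 (D1 D) (Suc n)" using b1 Xs(2) unfolding Ys_def D1_def by blast
    then have Ys_S: "Ys \<subseteq> S (Suc n)" using definable by blast
    have Ys_card: "card Ys \<le> 3 * k"
    proof -
      have "card Ys \<le> card (bdry n ` Xs) + card ((\<lambda>X. bdry n X \<inter> X) ` Xs) + card (rgt n ` Xs)"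
        unfolding Ys_def by (meson add_le_mono1 card_Un_le order.trans)
      also have "\<dots> \<le> k + k + k" unfolding k_def by (intro add_mono card_image_le Xs(1))
      finally show ?thesis by simp
    qed
    have Ys_sub: "{bdry n X, bdry n X \<inter> X, rgt n X} \<subseteq> Ys" if "X \<in> Xs" for X
      using that unfolding Ys_def by blast
    have Ys_fib: "finite (fib n Y x)" if Y: "Y \<in> Ys" and x: "x \<in> Rn n" for Y x
    proof -
      obtain X where X: "X \<in> Xs" "Y \<subseteq> bdry n X" using Y unfolding Ys_def rgt_def by blast
      have "X \<in> S (Suc n)" using X(1) Xs(2) definable by blast
      then have "finite (fib n (bdry n X) x)" using x by (rule finite_fib_bdry)
      moreover have "fib n Y x \<subseteq> fib n (bdry n X) x" using X(2) unfolding fib_def by blast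
      ultimately show ?thesis by (rule finite_subset[rotated])
    qed
    have Ys_fib_card: "card (fib n Y x) \<le> f (D1 D)" if "Y \<in> Ys" "x \<in> Rn n" for Y x
      using f(2)[OF _ that(2) Ys_fib[OF that]] that(1) Ys_\<Omega> by blast
    define Zs where "Zs = (\<lambda>((Y, Y'), j). strata n (Y \<union> Y') j) ` ((Ys \<times> Ys) \<times> {..n}) \<union> bot n ` Xs"
    have Zs_fin: "finite Zs" using Xs(1) Ys_fin by (simp add: Zs_def)
    have Zs_\<Omega>: "Zs \<subseteq> \<Omega> F' (D' D) n"
    proof
      fix Z assume "Z \<in> Zs"
      then consider Y Y' j where "Y \<in> Ys" "Y' \<in> Ys" "j \<le> n" "Z = strata n (Y \<union> Y') j" | X where "X \<in> Xs" "Z = bot n X"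
        unfolding Zs_def by auto
      then show "Z \<in> \<Omega> F' (D' D) n"
      proof cases
        case 1
        have "strata n (Y \<union> Y') j \<in> \<Omega> G2 (K2 * Suc (D1 D)) n"
          by (rule b2[OF _ _ 1(3)]) (use 1(1,2) Ys_\<Omega> in blast)+
        moreover have "\<Omega> G2 (K2 * Suc (D1 D)) n \<subseteq> \<Omega> F' (D' D) n"
          by (rule Omega_mono) (simp_all add: F'_def D'_def)
        ultimately show ?thesis using 1(4) by blast
      next
        case 2
        have "bot n X \<in> \<Omega> G1 (D1 D) n" using b1 2(1) Xs(2) unfolding D1_def by blast
        moreover have "\<Omega> G1 (D1 D) n \<subseteq> \<Omega> F' (D' D) n"
          by (rule Omega_mono) (simp_all add: F'_def D'_def)
        ultimately show ?thesis using 2(2) by blast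
      qed
    qed
    have Zs_card: "card Zs \<le> (3 * k) * (3 * k) * Suc n + k"
    proof -
      have "card Zs \<le> card ((Ys \<times> Ys) \<times> {..n}) + card Xs"
        unfolding Zs_def using Ys_fin Xs(1)
        by (intro order.trans[OF card_Un_le] add_mono card_image_le) auto
      also have "card ((Ys \<times> Ys) \<times> {..n}) = card Ys * card Ys * Suc n"
        by (simp add: card_cartesian_product)
      also have "\<dots> \<le> (3 * k) * (3 * k) * Suc n" by (intro mult_le_mono Ys_card order_refl)
      finally show ?thesis by (simp add: k_def)
    qed
    obtain \<C> where \<C>: "decomp n \<C>" "finite \<C>" "card \<C> \<le> c4 * ((D' D + 1) * (card Zs + 1)) ^ c4"
      "\<forall>Z\<in>Zs. compatible \<C> Z" and \<C>': "\<forall>C\<in>\<C>. good_cell G4 (L4 * Suc (D' D)) m4 n C"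
      using IH'[unfolded decomposes_def, rule_format, OF Zs_fin Zs_\<Omega>] by (elim exE conjE)
    have cells: "C \<in> S n" "connected C" "controllable G4 (L4 * Suc (D' D)) m4 n C" if "C \<in> \<C>" for C
      by (rule good_cellD[OF bspec[OF \<C>' that]])+
    have "\<forall>C\<in>\<C>. \<exists>T. card T \<le> 2 * (card Ys * f (D1 D)) + 1 \<and>
        stacked n Xs (controllable G (L * Suc D) m (Suc n)) C T"
    proof
      fix C assume C: "C \<in> \<C>"
      obtain \<W> where W: "\<W> \<subseteq> \<Omega> G4 (L4 * Suc (D' D)) n" "finite \<W>" "card \<W> \<le> m4" "controls n \<W> C"
        using cells(3)[OF C] unfolding controllable_def by (elim exE conjE)
      have C_ne: "C \<noteq> {}" using decomp_partition(1)[OF \<C>(1)] C unfolding partition_on_def by blast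
      have comp1: "C \<subseteq> strata n (Y \<union> Y') j \<or> C \<inter> strata n (Y \<union> Y') j = {}" if "Y \<in> Ys" "Y' \<in> Ys" "j \<le> n" for Y Y' j
      proof -
        have "strata n (Y \<union> Y') j \<in> Zs" unfolding Zs_def using that by (intro UnI1 image_eqI[of _ _ "((Y, Y'), j)"]) auto
        then show ?thesis using \<C>(4) C unfolding compatible_def by blast
      qed
      have comp2: "C \<subseteq> bot n X \<or> C \<inter> bot n X = {}" if "X \<in> Xs" for X
        using \<C>(4) C that unfolding compatible_def Zs_def by blast
      have good: "controllable G (L * Suc D) m (Suc n) E"
        if E: "\<exists>B\<subseteq>Ys. card B \<le> 2 \<and> controls (Suc n) (times_R n ` \<W> \<union> B) E" for E
      proof -
        obtain B where B: "B \<subseteq> Ys" "card B \<le> 2" "controls (Suc n) (times_R n ` \<W> \<union> B) E" using E by blast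
        have "times_R n ` \<W> \<subseteq> \<Omega> (G4 + 1) (L4 * Suc (D' D)) (Suc n)" using P3_times_R W(1) by auto
        moreover have "\<Omega> (G4 + 1) (L4 * Suc (D' D)) (Suc n) \<subseteq> \<Omega> G (L * Suc D) (Suc n)"
          by (rule Omega_mono[OF _ L2]) (simp add: G_def)
        moreover have "\<Omega> G1 (D1 D) (Suc n) \<subseteq> \<Omega> G (L * Suc D) (Suc n)"
          by (rule Omega_mono[OF _ L1]) (simp add: G_def)
        ultimately have "times_R n ` \<W> \<union> B \<subseteq> \<Omega> G (L * Suc D) (Suc n)" using B(1) Ys_\<Omega> by blast
        moreover have "finite (times_R n ` \<W> \<union> B)" using W(2) finite_subset[OF B(1) Ys_fin] by simp
        moreover have "card (times_R n ` \<W> \<union> B) \<le> m"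
          using card_Un_le[of "times_R n ` \<W>" B] card_image_le[OF W(2), of "times_R n"] W(3) B(2)
          unfolding m_def by linarith
        ultimately show ?thesis using B(3) unfolding controllable_def by blast
      qed
      have "\<exists>T. card T \<le> 2 * (card Ys * f (D1 D)) + 1 \<and>
        stacked n Xs (\<lambda>E. \<exists>B\<subseteq>Ys. card B \<le> 2 \<and> controls (Suc n) (times_R n ` \<W> \<union> B) E) C T"
        by (rule stack_exists[OF cells(1,2)[OF C] C_ne decomp_partition(2)[OF \<C>(1) C] Ys_fin Ys_S Ys_fib
            comp1 Ys_sub comp2 Ys_fib_card W(4)])
      then obtain T where T: "card T \<le> 2 * (card Ys * f (D1 D)) + 1"
        "stacked n Xs (\<lambda>E. \<exists>B\<subseteq>Ys. card B \<le> 2 \<and> controls (Suc n) (times_R n ` \<W> \<union> B) E) C T"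
        by (elim exE conjE)
      show "\<exists>T. card T \<le> 2 * (card Ys * f (D1 D)) + 1 \<and>
          stacked n Xs (controllable G (L * Suc D) m (Suc n)) C T"
        by (rule exI[of _ T], rule conjI[OF T(1)], rule stacked_mono[OF T(2)], rule good)
    qed
    then obtain T where "\<forall>C\<in>\<C>. card (T C) \<le> 2 * (card Ys * f (D1 D)) + 1 \<and>
        stacked n Xs (controllable G (L * Suc D) m (Suc n)) C (T C)"
      by (rule bchoice[THEN exE])
    then have T: "finite (T C)" "card (T C) \<le> 2 * (card Ys * f (D1 D)) + 1"
      "\<forall>E\<in>T C. cell S (Suc n) E \<and> E \<in> S (Suc n) \<and> connected E \<and> proj n ` E = C \<and> E \<subseteq> Rn (Suc n) \<and>
         (\<forall>X\<in>Xs. E \<subseteq> X \<or> E \<inter> X = {}) \<and> controllable G (L * Suc D) m (Suc n) E"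
      "\<forall>z\<in>Rn (Suc n). proj n z \<in> C \<longrightarrow> (\<exists>E\<in>T C. z \<in> E)"
      "\<forall>E\<in>T C. \<forall>E'\<in>T C. \<forall>z. z \<in> E \<longrightarrow> z \<in> E' \<longrightarrow> E = E'" if "C \<in> \<C>" for C
      using that unfolding stacked_def by simp_all
    have dec: "decomp (Suc n) (\<Union>C\<in>\<C>. T C)"
    proof (rule decomp_stacks[OF \<C>(1)])
      fix C E assume "C \<in> \<C>" "E \<in> T C"
      then show "cell S (Suc n) E \<and> proj n ` E = C \<and> E \<subseteq> Rn (Suc n)" using T(3) by simp
    qed (use T(4,5) in blast)+
    have "card (\<Union>C\<in>\<C>. T C) \<le> (\<Sum>C\<in>\<C>. card (T C))" by (rule card_UN_le[OF \<C>(2)])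
    also have "\<dots> \<le> card \<C> * (2 * (card Ys * f (D1 D)) + 1)"
      using sum_bounded_above[of \<C> "\<lambda>C. card (T C)" "2 * (card Ys * f (D1 D)) + 1"] T(2) by simp
    also have "\<dots> \<le> h D k" unfolding h_def
    proof (rule mult_le_mono)
      have "c4 * ((D' D + 1) * (card Zs + 1)) ^ c4 \<le> c4 * ((D' D + 1) * (3 * k * (3 * k) * Suc n + k + 1)) ^ c4"
        using Zs_card by (intro mult_le_mono2 power_mono) auto
      with \<C>(3) show "card \<C> \<le> c4 * ((D' D + 1) * (3 * k * (3 * k) * Suc n + k + 1)) ^ c4" by (rule order.trans)
      show "2 * (card Ys * f (D1 D)) + 1 \<le> 2 * (3 * k * f (D1 D)) + 1"
        using mult_le_mono1[OF Ys_card, of "f (D1 D)"] by linarith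
    qed
    also have "\<dots> \<le> c * ((D + 1) * (k + 1)) ^ c" by (rule c)
    finally have card: "card (\<Union>C\<in>\<C>. T C) \<le> c * ((D + 1) * (card Xs + 1)) ^ c" by (simp add: k_def)
    show "\<exists>\<C>. decomp (Suc n) \<C> \<and> finite \<C> \<and> card \<C> \<le> c * ((D + 1) * (card Xs + 1)) ^ c \<and>
       (\<forall>X\<in>Xs. compatible \<C> X) \<and>
       (\<forall>C\<in>\<C>. good_cell G (L * Suc D) m (Suc n) C)"
    proof (rule exI[of _ "\<Union>C\<in>\<C>. T C"], intro conjI dec card)
      show "finite (\<Union>C\<in>\<C>. T C)" using \<C>(2) T(1) by blast
      show "\<forall>X\<in>Xs. compatible (\<Union>C\<in>\<C>. T C) X" unfolding compatible_def
      proof (intro ballI)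
        fix X E assume "X \<in> Xs" "E \<in> (\<Union>C\<in>\<C>. T C)"
        then show "E \<subseteq> X \<or> E \<inter> X = {}" using T(3) by (elim UN_E) simp
      qed
      show "\<forall>E\<in>\<Union>C\<in>\<C>. T C. good_cell G (L * Suc D) m (Suc n) E"
      proof
        fix E assume "E \<in> (\<Union>C\<in>\<C>. T C)"
        then obtain C where C: "C \<in> \<C>" "E \<in> T C" by (rule UN_E)
        have "controllable G4 (L4 * Suc (D' D)) m4 n C" by (rule cells(3)[OF C(1)])
        then have "controllable G (L * Suc D) m n C"
          by (rule controllable_mono[OF _ _ L2]) (simp_all add: G_def m_def)
        then show "good_cell G (L * Suc D) m (Suc n) E"
          using T(3)[OF C(1)] C(2) by (simp add: good_cell_def)
      qed
    qed
  qed
  then show ?thesis by blast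
qed

theorem decomposes_exists: "\<exists>G c L m. decomposes n F G c L m"
proof (induction n arbitrary: F)
  case 0
  show ?case using decomposes_0 by blast
next
  case (Suc n)
  then show ?case by (rule decomposes_Suc)
qed

end

section \<open>The filtration of controlled sets\<close>

lemma connected_Rn: "connected (Rn n)"
proof -
  define l where "l x = (\<lambda>t i. t * x i) ` {0..1}" for x :: point
  have "connected (l x)" for x unfolding l_def
    by (intro connected_continuous_image continuous_on_coordinatewise_then_product continuous_intros) simp
  moreover have "(\<lambda>_. 0) \<in> l x" for x unfolding l_def by (rule image_eqI[of _ _ 0]) auto
  then have "\<Inter>(l ` Rn n) \<noteq> {}" by blast
  ultimately have "connected (\<Union>x\<in>Rn n. l x)" by (intro connected_Union) auto
  moreover have "(\<Union>x\<in>Rn n. l x) = Rn n"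
  proof
    show "(\<Union>x\<in>Rn n. l x) \<subseteq> Rn n" by (auto simp: l_def Rn_iff)
    have "x \<in> l x" for x unfolding l_def by (rule image_eqI[of _ _ 1]) auto
    then show "Rn n \<subseteq> (\<Union>x\<in>Rn n. l x)" by blast
  qed
  ultimately show ?thesis by simp
qed

section \<open>Operations on controlled sets\<close>

lemma controls_self: "controls n {A} A"
  unfolding controls_def by simp

lemma controls_compl: "controls n \<Z> A \<Longrightarrow> controls n \<Z> (Rn n - A)"
proof (rule controlsI)
  fix K z z' assume "controls n \<Z> A" and K: "connected K" "K \<subseteq> Rn n" "\<And>Z. Z \<in> \<Z> \<Longrightarrow> K \<subseteq> Z \<or> K \<inter> Z = {}"
    and z: "z \<in> K" "z \<in> Rn n - A" "z' \<in> K"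
  then have "K \<subseteq> A \<or> K \<inter> A = {}" by (intro controlsD[of n \<Z> A K])
  then show "z' \<in> Rn n - A" using z K(2) by blast
qed

lemma controls_UN:
  assumes "\<And>i. i \<in> I \<Longrightarrow> controls n (\<Z> i) (A i)"
  shows "controls n (\<Union>i\<in>I. \<Z> i) (\<Union>i\<in>I. A i)"
proof (rule controlsI)
  fix K z z' assume K: "connected K" "K \<subseteq> Rn n" "\<And>Z. Z \<in> (\<Union>i\<in>I. \<Z> i) \<Longrightarrow> K \<subseteq> Z \<or> K \<inter> Z = {}"
    and z: "z \<in> K" "z \<in> (\<Union>i\<in>I. A i)" "z' \<in> K"
  obtain i where i: "i \<in> I" "z \<in> A i" using z(2) by blast
  have "K \<subseteq> A i \<or> K \<inter> A i = {}"
    by (rule controlsD[OF assms[OF i(1)] K(1,2) K(3)]) (use i(1) in blast)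
  then show "z' \<in> (\<Union>i\<in>I. A i)" using z(1,3) i by blast
qed

text \<open>A connected cell is itself a test set for \<open>controls\<close>, so compatibility
  passes from the controlling sets to \<open>A\<close>.\<close>

lemma controls_Union_cells:
  assumes "partition_on (Rn n) \<C>" "\<And>C. C \<in> \<C> \<Longrightarrow> connected C" "\<And>Z. Z \<in> \<Z> \<Longrightarrow> compatible \<C> Z"
    and A: "controls n \<Z> A" "A \<subseteq> Rn n"
  shows "compatible \<C> A" "A = \<Union>{C \<in> \<C>. C \<subseteq> A}"
proof -
  have U: "\<Union>\<C> = Rn n" using assms(1) by (simp add: partition_on_def)
  show comp: "compatible \<C> A" unfolding compatible_def
  proof
    fix C assume C: "C \<in> \<C>"
    show "C \<subseteq> A \<or> C \<inter> A = {}"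
    proof (rule controlsD[OF A(1) assms(2)[OF C]])
      show "C \<subseteq> Rn n" using U C by blast
      show "C \<subseteq> Z \<or> C \<inter> Z = {}" if "Z \<in> \<Z>" for Z using assms(3)[OF that] C by (simp add: compatible_def)
    qed
  qed
  show "A = \<Union>{C \<in> \<C>. C \<subseteq> A}"
  proof
    show "A \<subseteq> \<Union>{C \<in> \<C>. C \<subseteq> A}"
    proof
      fix x assume x: "x \<in> A"
      then obtain C where C: "C \<in> \<C>" "x \<in> C" using U A(2) by blast
      then have "C \<subseteq> A" using comp x unfolding compatible_def by blast
      then show "x \<in> \<Union>{C \<in> \<C>. C \<subseteq> A}" using C by blast
    qed
  qed blast
qed

lemma components_Union_connected:
  assumes "finite \<D>" "\<And>C. C \<in> \<D> \<Longrightarrow> connected C"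
  shows "finite (components (\<Union>\<D>)) \<and> card (components (\<Union>\<D>)) \<le> card \<D>"
proof -
  define comp where "comp C = connected_component_set (\<Union>\<D>) (SOME x. x \<in> C)" for C :: "'a set"
  have "components (\<Union>\<D>) \<subseteq> comp ` \<D>"
  proof
    fix c assume "c \<in> components (\<Union>\<D>)"
    then obtain x where x: "x \<in> \<Union>\<D>" "c = connected_component_set (\<Union>\<D>) x" by (auto simp: components_def)
    then obtain C where C: "C \<in> \<D>" "x \<in> C" by blast
    have "(SOME x. x \<in> C) \<in> C" using C(2) by (rule someI)
    then have "connected_component (\<Union>\<D>) x (SOME x. x \<in> C)"
      unfolding connected_component_def using C assms(2)[OF C(1)] by (intro exI[of _ C]) auto
    then have "c = comp C" unfolding comp_def x(2) by (rule connected_component_eq[OF CollectI, symmetric])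
    then show "c \<in> comp ` \<D>" using C(1) by blast
  qed
  then show ?thesis
    using assms(1) by (meson card_image_le card_mono finite_imageI finite_subset order.trans)
qed

lemma poly_bounded_poly:
  assumes "poly_bounded f"
  shows "\<exists>N :: nat poly poly. \<forall>D k. f D k \<le> poly (poly N [:k:]) D"
proof -
  obtain c where c: "\<And>D k. f D k \<le> c * ((D + 1) * (k + 1)) ^ c" using assms by (auto simp: poly_bounded_def)
  \<comment> \<open>The outer variable is \<open>k\<close>: \<open>[:1, 1:]\<close> is k + 1, while
    the constant polynomial \<open>[:[:1, 1:]:]\<close> is D + 1.\<close>
  have eq: "poly (poly ([:[:c:]:] * ([:[:1, 1:]:] * [:1, 1:]) ^ c) [:k:]) D = c * ((D + 1) * (k + 1)) ^ c" for D k
    by (simp add: poly_mult poly_power algebra_simps)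
  show ?thesis
  proof (intro exI allI)
    show "f D k \<le> poly (poly ([:[:c:]:] * ([:[:1, 1:]:] * [:1, 1:]) ^ c) [:k:]) D" for D k
      unfolding eq by (rule c)
  qed
qed

lemma poly_bounded_poly1:
  assumes "poly_bounded (\<lambda>D k. f D)"
  shows "\<exists>P :: nat poly. \<forall>D. f D \<le> poly P D"
proof -
  obtain N :: "nat poly poly" where "\<forall>D k. f D \<le> poly (poly N [:k:]) D"
    using poly_bounded_poly[OF assms] by (rule exE)
  then show ?thesis by (intro exI[of _ "poly N [:0:]"]) blast
qed

lemma poly_bounded_sum:
  "finite A \<Longrightarrow> (\<And>a. a \<in> A \<Longrightarrow> poly_bounded (f a)) \<Longrightarrow> poly_bounded (\<lambda>D k. \<Sum>a\<in>A. f a D k)"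
proof (induction A rule: finite_induct)
  case empty
  show ?case unfolding sum.empty by (rule poly_bounded_const)
next
  case (insert b A)
  have "poly_bounded (\<lambda>D k. f b D k + (\<Sum>a\<in>A. f a D k))"
    by (intro poly_bounded_add insert.prems insert.IH) simp_all
  then show ?case using insert.hyps by simp
qed

lemma power_add_le:
  fixes a b m :: nat
  assumes "m \<ge> 1"
  shows "a ^ m + b ^ m \<le> (a + b) ^ m"
proof -
  obtain k where k: "m = Suc k" using assms by (cases m) auto
  have "a ^ m + b ^ m = a * a ^ k + b * b ^ k" by (simp add: k)
  also have "\<dots> \<le> a * (a + b) ^ k + b * (a + b) ^ k"
    by (intro add_mono mult_le_mono2 power_mono) auto
  finally show ?thesis by (simp add: k algebra_simps)
qed

text \<open>In (#4) degrees add, so the sizes of the united controlling families have to fit under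
  the bound for the sum of the degrees.\<close>

lemma sum_power_le:
  fixes f :: "nat \<Rightarrow> nat"
  assumes "m \<ge> 1"
  shows "(\<Sum>i<k. f i ^ m) \<le> (\<Sum>i<k. f i) ^ m"
proof (induction k)
  case (Suc k)
  have "(\<Sum>i<Suc k. f i ^ m) \<le> (\<Sum>i<k. f i) ^ m + f k ^ m" using Suc by simp
  also have "\<dots> \<le> (\<Sum>i<Suc k. f i) ^ m" using power_add_le[OF assms] by simp
  finally show ?case .
qed simp

context presharp begin

lemma decomposes_mono:
  assumes "decomposes n F G c L m" "G \<le> g" "c \<le> g" "L \<le> g" "m \<le> g"
  shows "decomposes n F g g g g"
  unfolding decomposes_def
proof (intro allI impI)
  fix D Xs assume Xs: "finite Xs" "Xs \<subseteq> \<Omega> F D n"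
  obtain \<C> where \<C>: "decomp n \<C>" "finite \<C>" "card \<C> \<le> c * ((D + 1) * (card Xs + 1)) ^ c"
    "\<forall>X\<in>Xs. compatible \<C> X" and \<C>': "\<forall>C\<in>\<C>. good_cell G (L * Suc D) m n C"
    using assms(1)[unfolded decomposes_def, rule_format, OF Xs] by (elim exE conjE)
  have mono: "controllable G (L * Suc D) m l C \<Longrightarrow> controllable g (g * Suc D) g l C" for l C
    using assms by (elim controllable_mono) (auto intro: add_mono mult_le_mono)
  have "card \<C> \<le> g * ((D + 1) * (card Xs + 1)) ^ g"
    by (rule order.trans[OF \<C>(3) poly_bound_mono[OF assms(3)]]) simp
  moreover have "\<forall>C\<in>\<C>. good_cell g (g * Suc D) g n C"
  proof
    fix C assume "C \<in> \<C>"
    from bspec[OF \<C>' this] show "good_cell g (g * Suc D) g n C"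
      unfolding good_cell_def by (elim conjE) (intro conjI allI impI mono; simp)
  qed
  ultimately show "\<exists>\<C>. decomp n \<C> \<and> finite \<C> \<and> card \<C> \<le> g * ((D + 1) * (card Xs + 1)) ^ g \<and>
       (\<forall>X\<in>Xs. compatible \<C> X) \<and>
       (\<forall>C\<in>\<C>. good_cell g (g * Suc D) g n C)"
    using \<C>(1,2,4) by (intro exI[of _ \<C>] conjI)
qed

section \<open>Choice of the formats and degrees\<close>

definition dec_bound :: "nat \<Rightarrow> nat \<Rightarrow> nat" where
  "dec_bound n F = (SOME g. decomposes n F g g g g)"

lemma dec_bound: "decomposes n F (dec_bound n F) (dec_bound n F) (dec_bound n F) (dec_bound n F)"
proof -
  obtain G c L m where "decomposes n F G c L m" using decomposes_exists by blast
  then have "decomposes n F (G + c + L + m) (G + c + L + m) (G + c + L + m) (G + c + L + m)"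
    by (rule decomposes_mono) simp_all
  then show ?thesis unfolding dec_bound_def by (rule someI)
qed

text \<open>If the bounds \<open>M * D ^ M\<close> are in force before a projection, then those with
  \<open>proj_bound g M\<close> in place of \<open>M\<close> are in force afterwards.\<close>

definition proj_bound :: "nat \<Rightarrow> nat \<Rightarrow> nat" where
  "proj_bound g M = g + g * g * (M + 1) ^ (2 * g) + 2 * M * g + g * (M + 1) + M"

text \<open>\<open>dec_bound\<close> is chosen without any monotonicity, so the sum over all
  \<open>n, M \<le> x\<close> serves to dominate the one value that matters; by
  \<open>fmt_ge\<close> the dimension lies in its range. The summand 1 pays for products with
  \<real>.\<close>

definition next_bound :: "nat \<Rightarrow> nat" where
  "next_bound x = x + 1 + (\<Sum>n\<le>x. \<Sum>M\<le>x. proj_bound (dec_bound n M) M)"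

text \<open>\<open>2 * F - n\<close> grows by one under a projection as well as under a product with \<open>\<real>\<close>, and in both
  cases the controlling sets get worse.\<close>

definition fmt :: "nat \<Rightarrow> nat \<Rightarrow> nat" where
  "fmt F n = (next_bound ^^ (2 * F - n)) 1"

text \<open>The form is superadditive in \<open>D\<close> and vanishes at \<open>D = 0\<close>. The
  latter matters because (#4) puts arbitrarily long unions of sets of degree 0 into degree 0, with a
  fixed bound on the components.\<close>

definition deg :: "nat \<Rightarrow> nat \<Rightarrow> nat \<Rightarrow> nat" where
  "deg F D n = fmt F n * D ^ fmt F n"

definition star :: filtration where
  "star F D n = {A \<in> S n. n \<le> F \<and> controllable (fmt F n) (deg F D n) (deg F D n) n A}"

lemma funpow_next_bound: "(next_bound ^^ k) 1 \<ge> k + 1"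
proof (induction k)
  case (Suc k)
  have "next_bound x \<ge> x + 1" for x by (simp add: next_bound_def)
  from this[of "(next_bound ^^ k) 1"] show ?case using Suc by simp
qed simp

lemma funpow_next_bound_mono: "k \<le> l \<Longrightarrow> (next_bound ^^ k) 1 \<le> (next_bound ^^ l) 1"
proof (rule lift_Suc_mono_le[of "\<lambda>k. (next_bound ^^ k) 1"])
  show "(next_bound ^^ k) 1 \<le> (next_bound ^^ Suc k) 1" for k by (simp add: next_bound_def)
qed

lemma fmt_ge: "n \<le> F \<Longrightarrow> fmt F n \<ge> F + 1"
  unfolding fmt_def by (rule order.trans[OF _ funpow_next_bound]) simp

lemma fmt_ge_1: "fmt F n \<ge> 1"
  unfolding fmt_def by (rule order.trans[OF _ funpow_next_bound]) simp

lemma fmt_mono: "F \<le> F' \<Longrightarrow> fmt F n \<le> fmt F' n"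
  unfolding fmt_def by (rule funpow_next_bound_mono) simp

lemma fmt_product: "n \<le> F \<Longrightarrow> fmt F n + 1 \<le> fmt (F + 1) (n + 1)"
proof -
  assume "n \<le> F"
  then have "2 * (F + 1) - (n + 1) = Suc (2 * F - n)" by simp
  then show ?thesis unfolding fmt_def by (simp add: next_bound_def)
qed

lemma fmt_proj: "n + 1 \<le> F \<Longrightarrow> proj_bound (dec_bound (n + 1) (fmt F (n + 1))) (fmt F (n + 1)) \<le> fmt F n"
proof -
  assume n: "n + 1 \<le> F"
  let ?M = "fmt F (n + 1)"
  have "2 * F - n = Suc (2 * F - (n + 1))" using n by simp
  then have F: "fmt F n = next_bound ?M" unfolding fmt_def by simp
  have n': "n + 1 \<le> ?M" using fmt_ge[OF n] n by simp
  have "proj_bound (dec_bound (n + 1) ?M) ?M \<le> (\<Sum>M\<le>?M. proj_bound (dec_bound (n + 1) M) M)"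
    by (rule member_le_sum[of _ _ "\<lambda>M. proj_bound (dec_bound (n + 1) M) M"]) auto
  also have "\<dots> \<le> (\<Sum>n\<le>?M. \<Sum>M\<le>?M. proj_bound (dec_bound n M) M)"
    by (rule member_le_sum[of _ _ "\<lambda>n. \<Sum>M\<le>?M. proj_bound (dec_bound n M) M"]) (use n' in auto)
  also have "\<dots> \<le> next_bound ?M" by (simp add: next_bound_def)
  finally show ?thesis by (simp add: F)
qed

lemma bound_mono:
  fixes M M' D D' :: nat
  assumes "1 \<le> M" "M \<le> M'" "D \<le> D'"
  shows "M * D ^ M \<le> M' * D' ^ M'"
proof (cases "D = 0")
  case False
  then have "D ^ M \<le> D' ^ M" using assms by (intro power_mono) auto
  also have "\<dots> \<le> D' ^ M'" using assms False by (intro power_increasing) auto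
  finally show ?thesis using assms by (intro mult_le_mono)
qed (use assms in \<open>simp add: power_0_left\<close>)

lemma deg_mono: "F \<le> F' \<Longrightarrow> D \<le> D' \<Longrightarrow> deg F D n \<le> deg F' D' n"
  unfolding deg_def by (intro bound_mono fmt_ge_1 fmt_mono)

lemma deg_0: "deg F 0 n = 0"
  unfolding deg_def using fmt_ge_1[of F n] by simp

lemma deg_ge: "deg F D n \<ge> D"
proof (cases "D = 0")
  case False
  have "1 * D ^ 1 \<le> fmt F n * D ^ fmt F n" by (rule bound_mono) (use fmt_ge_1 in auto)
  then show ?thesis by (simp add: deg_def)
qed simp

lemma starI: "A \<in> S n \<Longrightarrow> n \<le> F \<Longrightarrow> controllable (fmt F n) (deg F D n) (deg F D n) n A \<Longrightarrow> A \<in> star F D n"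
  by (simp add: star_def)

section \<open>Closure properties of the new filtration\<close>

lemma star_mono:
  assumes "A \<in> star F D n" "F \<le> F'" "D \<le> D'"
  shows "A \<in> star F' D' n"
proof (rule starI)
  show "A \<in> S n" "n \<le> F'" using assms by (auto simp: star_def)
  have "controllable (fmt F n) (deg F D n) (deg F D n) n A" using assms(1) by (simp add: star_def)
  then show "controllable (fmt F' n) (deg F' D' n) (deg F' D' n) n A"
    by (rule controllable_mono) (intro fmt_mono deg_mono assms(2,3))+
qed

text \<open>A set controls itself; positive degree is what admits this one controlling set.\<close>

lemma star_base:
  assumes "A \<in> \<Omega> F0 D0 n" "F0 \<le> F" "n \<le> F" "D0 \<le> D" "1 \<le> D"
  shows "A \<in> star F D n"
proof (rule starI[OF _ assms(3)])
  show "A \<in> S n" using assms(1) definable by blast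
  have "\<Omega> F0 D0 n \<subseteq> \<Omega> (fmt F n) (deg F D n) n"
    using fmt_ge[OF assms(3)] deg_ge[of D F n] assms(2,4) by (intro Omega_mono) auto
  then have "{A} \<subseteq> \<Omega> (fmt F n) (deg F D n) n" using assms(1) by blast
  moreover have "card {A} \<le> deg F D n" using deg_ge[of D F n] assms(5) by simp
  ultimately show "controllable (fmt F n) (deg F D n) (deg F D n) n A"
    unfolding controllable_def using controls_self by (intro exI[of _ "{A}"]) simp
qed

lemma Rn_definable: "Rn n \<in> S n"
  using compl[OF empty, of n] by simp

lemma star_trivial:
  assumes "n \<le> F" "A = {} \<or> A = Rn n"
  shows "A \<in> star F D n"
proof (rule starI[OF _ assms(1)])
  show "A \<in> S n" using assms(2) empty Rn_definable by blast
  have "controls n {} A" unfolding controls_def using assms(2) by blast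
  then show "controllable (fmt F n) (deg F D n) (deg F D n) n A"
    unfolding controllable_def by (intro exI[of _ "{}"]) simp
qed

lemma star_degree_0:
  assumes "A \<in> star F 0 n"
  shows "A = {} \<or> A = Rn n"
proof -
  obtain \<Z> where "finite \<Z>" "card \<Z> \<le> 0" "controls n \<Z> A"
    using assms unfolding star_def controllable_def deg_0 by blast
  then have "controls n {} A" by simp
  then have "Rn n \<subseteq> A \<or> Rn n \<inter> A = {}" by (rule controlsD[OF _ connected_Rn]) auto
  moreover have "A \<subseteq> Rn n" using assms subset_Rn by (simp add: star_def)
  ultimately show ?thesis by blast
qed

sublocale star: FD_filtration S star
proof
  show "star F D n \<subseteq> S n" for F D n by (auto simp: star_def)
  show "star F D n \<subseteq> star (F + 1) D n \<inter> star F (D + 1) n" for F D n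
    using star_mono[of _ F D n "F + 1" D] star_mono[of _ F D n F "D + 1"] by auto
  fix A n assume "A \<in> S n"
  then obtain F D where "A \<in> \<Omega> F D n" using exhaustive by blast
  then have "A \<in> star (F + n) (D + 1) n" by (rule star_base) simp_all
  then show "\<exists>F D. A \<in> star F D n" by blast
qed

lemma reduces_star: "reduces \<Omega> star"
  unfolding reduces_def
proof (intro exI[of _ "\<lambda>F. F"] allI)
  fix F
  show "\<exists>P :: nat poly. \<forall>D n. \<Omega> F D n \<subseteq> star F (poly P D) n"
  \<comment> \<open>The degree is raised by one since nontrivial sets may have degree 0 in the given
    filtration.\<close>
  proof (intro exI[of _ "[:1, 1:]"] allI subsetI)
    fix D n A assume "A \<in> \<Omega> F D n"
    then show "A \<in> star F (poly [:1, 1:] D) n" using P2 by (intro star_base) auto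
  qed
qed

lemma star_decomposition:
  assumes X: "\<forall>j<k. X j \<in> star F D n" and n: "n \<le> F"
  defines "g \<equiv> dec_bound n (fmt F n)"
  shows "\<exists>\<C>. decomp n \<C> \<and> finite \<C> \<and> card \<C> \<le> g * ((deg F D n + 1) * (k * deg F D n + 1)) ^ g \<and>
    (\<forall>j<k. compatible \<C> (X j) \<and> X j = \<Union>{C \<in> \<C>. C \<subseteq> X j}) \<and>
    (\<forall>C\<in>\<C>. good_cell g (g * Suc (deg F D n)) g n C)"
proof -
  have "\<forall>j\<in>{..<k}. \<exists>\<Z>. \<Z> \<subseteq> \<Omega> (fmt F n) (deg F D n) n \<and> finite \<Z> \<and> card \<Z> \<le> deg F D n \<and> controls n \<Z> (X j)"
    using X unfolding star_def controllable_def by simp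
  then obtain \<Z> where "\<forall>j\<in>{..<k}. \<Z> j \<subseteq> \<Omega> (fmt F n) (deg F D n) n \<and> finite (\<Z> j) \<and> card (\<Z> j) \<le> deg F D n \<and> controls n (\<Z> j) (X j)"
    by (rule bchoice[THEN exE])
  then have Z: "\<Z> j \<subseteq> \<Omega> (fmt F n) (deg F D n) n" "finite (\<Z> j)" "card (\<Z> j) \<le> deg F D n" "controls n (\<Z> j) (X j)"
    if "j < k" for j using that by simp_all
  define Zs where "Zs = (\<Union>j<k. \<Z> j)"
  have Zs: "finite Zs" "Zs \<subseteq> \<Omega> (fmt F n) (deg F D n) n" using Z(1,2) unfolding Zs_def by auto
  have "card Zs \<le> (\<Sum>j<k. card (\<Z> j))" unfolding Zs_def by (rule card_UN_le) simp
  also have "\<dots> \<le> k * deg F D n" using sum_bounded_above[of "{..<k}" "\<lambda>j. card (\<Z> j)" "deg F D n"] Z(3) by simp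
  finally have card_Zs: "card Zs \<le> k * deg F D n" .
  obtain \<C> where \<C>: "decomp n \<C>" "finite \<C>" "card \<C> \<le> g * ((deg F D n + 1) * (card Zs + 1)) ^ g"
    "\<forall>Z\<in>Zs. compatible \<C> Z" and \<C>': "\<forall>C\<in>\<C>. good_cell g (g * Suc (deg F D n)) g n C"
    using dec_bound[of n "fmt F n", folded g_def, unfolded decomposes_def, rule_format, OF Zs] by (elim exE conjE)
  have "compatible \<C> (X j) \<and> X j = \<Union>{C \<in> \<C>. C \<subseteq> X j}" if j: "j < k" for j
  proof
    have *: "connected C" if "C \<in> \<C>" for C by (rule good_cellD(2)[OF bspec[OF \<C>' that]])
    have **: "compatible \<C> Z" if "Z \<in> \<Z> j" for Z using \<C>(4) that j unfolding Zs_def by blast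
    have "X j \<subseteq> Rn n" using X[rule_format, OF j] subset_Rn by (simp add: star_def)
    note controls_Union_cells[OF decomp_partition(1)[OF \<C>(1)] * ** Z(4)[OF j] this]
    then show "compatible \<C> (X j)" "X j = \<Union>{C \<in> \<C>. C \<subseteq> X j}" by blast+
  qed
  moreover have "card \<C> \<le> g * ((deg F D n + 1) * (k * deg F D n + 1)) ^ g"
    by (rule order.trans[OF \<C>(3)]) (intro mult_le_mono2 power_mono add_le_mono1 card_Zs le0)
  ultimately show ?thesis using \<C>(1,2) \<C>' by (intro exI[of _ \<C>] conjI allI impI) auto
qed

text \<open>The decomposition cuts \<open>A\<close> into polynomially many cells whose bases have
  bounded controlling families. Their union controls the projection, and the increase of
  \<open>fmt\<close> with falling dimension pays for it.\<close>

lemma star_proj: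
  assumes A: "A \<in> star F D (n + 1)"
  shows "proj n ` A \<in> star F D n"
proof (cases "D = 0")
  case True
  have n: "n \<le> F" using A by (simp add: star_def)
  have "proj n ` Rn (n + 1) = Rn n"
  proof
    show "Rn n \<subseteq> proj n ` Rn (n + 1)"
    proof
      fix x assume "x \<in> Rn n"
      then show "x \<in> proj n ` Rn (n + 1)" by (intro image_eqI[of _ _ x]) (auto simp: proj_id Rn_iff)
    qed
  qed auto
  then have "proj n ` A = {} \<or> proj n ` A = Rn n" using star_degree_0[of A F "n + 1"] A True by auto
  then show ?thesis by (rule star_trivial[OF n])
next
  case False
  have n: "n + 1 \<le> F" and AS: "A \<in> S (n + 1)" using A by (simp_all add: star_def)
  define M where "M = fmt F (n + 1)"
  define g where "g = dec_bound (n + 1) M"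
  define d where "d = deg F D (n + 1)"
  have M1: "proj_bound g M \<le> fmt F n" unfolding g_def M_def by (rule fmt_proj[OF n])
  \<comment> \<open>The summands of \<open>proj_bound\<close> are the new format, coefficient and
    exponent of the number of controlling sets, and coefficient and exponent of their
    degree.\<close>
  have M2: "g \<le> fmt F n" "g * g * (M + 1) ^ (2 * g) \<le> fmt F n" "2 * M * g \<le> fmt F n"
    "g * (M + 1) \<le> fmt F n" "M \<le> fmt F n"
    using M1 unfolding proj_bound_def by linarith+
  \<comment> \<open>Here \<open>D\<close> is positive, so the 1 can be absorbed into the
    coefficient; this fails for \<open>D = 0\<close>, which is why that case is separate.\<close>
  have d: "d + 1 \<le> (M + 1) * D ^ M"
    using False by (simp add: d_def deg_def M_def)
  have A1: "\<forall>j<(1 :: nat). A \<in> star F D (n + 1)" using A by simp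
  obtain \<C> where "decomp (n + 1) \<C>" and \<C>: "finite \<C>" "card \<C> \<le> g * ((d + 1) * (1 * d + 1)) ^ g"
    "\<forall>j<(1 :: nat). compatible \<C> A \<and> A = \<Union>{C \<in> \<C>. C \<subseteq> A}"
    and \<C>': "\<forall>C\<in>\<C>. good_cell g (g * Suc d) g (n + 1) C"
    using star_decomposition[of 1 "\<lambda>_. A" F D "n + 1", folded M_def, folded g_def d_def, OF A1 n] by (elim exE conjE)
  define \<D> where "\<D> = {C \<in> \<C>. C \<subseteq> A}"
  have \<D>: "finite \<D>" "card \<D> \<le> card \<C>" using \<C>(1) by (auto simp: \<D>_def intro: card_mono)
  have "\<forall>C\<in>\<D>. \<exists>\<W>. \<W> \<subseteq> \<Omega> g (g * Suc d) n \<and> finite \<W> \<and> card \<W> \<le> g \<and> controls n \<W> (proj n ` C)"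
  proof
    fix C assume "C \<in> \<D>"
    then have "C \<in> \<C>" by (simp add: \<D>_def)
    have "controllable g (g * Suc d) g n (proj n ` C)"
      by (rule good_cellD(4)[OF bspec[OF \<C>' \<open>C \<in> \<C>\<close>]]) simp
    then show "\<exists>\<W>. \<W> \<subseteq> \<Omega> g (g * Suc d) n \<and> finite \<W> \<and> card \<W> \<le> g \<and> controls n \<W> (proj n ` C)"
      by (simp add: controllable_def)
  qed
  then obtain \<W> where "\<forall>C\<in>\<D>. \<W> C \<subseteq> \<Omega> g (g * Suc d) n \<and> finite (\<W> C) \<and> card (\<W> C) \<le> g \<and> controls n (\<W> C) (proj n ` C)"
    by (rule bchoice[THEN exE])
  then have W: "\<W> C \<subseteq> \<Omega> g (g * Suc d) n" "finite (\<W> C)" "card (\<W> C) \<le> g" "controls n (\<W> C) (proj n ` C)"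
    if "C \<in> \<D>" for C using that by simp_all
  have "A = \<Union>\<D>" using \<C>(3) unfolding \<D>_def by blast
  then have "proj n ` A = (\<Union>C\<in>\<D>. proj n ` C)" by blast
  moreover have "controls n (\<Union>C\<in>\<D>. \<W> C) (\<Union>C\<in>\<D>. proj n ` C)" by (rule controls_UN[OF W(4)])
  ultimately have ctrl: "controls n (\<Union>C\<in>\<D>. \<W> C) (proj n ` A)" by simp
  have "card (\<Union>C\<in>\<D>. \<W> C) \<le> (\<Sum>C\<in>\<D>. card (\<W> C))" by (rule card_UN_le[OF \<D>(1)])
  also have "\<dots> \<le> card \<D> * g" using sum_bounded_above[of \<D> "\<lambda>C. card (\<W> C)" g] W(3) by simp
  also have "\<dots> \<le> g * ((d + 1) * (d + 1)) ^ g * g" using \<D>(2) \<C>(2) by (intro mult_le_mono1) simp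
  also have "\<dots> \<le> g * (((M + 1) * D ^ M) * ((M + 1) * D ^ M)) ^ g * g"
    by (intro mult_le_mono1 mult_le_mono2 power_mono mult_le_mono d) simp
  also have "\<dots> = g * g * (M + 1) ^ (2 * g) * D ^ (2 * M * g)"
  proof -
    have "(((M + 1) * D ^ M) * ((M + 1) * D ^ M)) ^ g = (((M + 1) * D ^ M) ^ 2) ^ g" by (simp add: power2_eq_square)
    also have "\<dots> = (M + 1) ^ (2 * g) * D ^ (2 * M * g)"
      by (simp only: power_mult_distrib power_mult[symmetric] mult_ac)
    finally show ?thesis by (simp only: mult_ac)
  qed
  also have "\<dots> \<le> fmt F n * D ^ fmt F n"
    using False by (intro mult_le_mono power_increasing M2) simp
  finally have card_W: "card (\<Union>C\<in>\<D>. \<W> C) \<le> deg F D n" by (simp add: deg_def)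
  have "g * Suc d \<le> g * ((M + 1) * D ^ M)" using d by (intro mult_le_mono2) simp
  also have "\<dots> = (g * (M + 1)) * D ^ M" by (simp only: mult_ac)
  also have "\<dots> \<le> fmt F n * D ^ fmt F n"
    using False by (intro mult_le_mono power_increasing M2) simp
  finally have "\<Omega> g (g * Suc d) n \<subseteq> \<Omega> (fmt F n) (deg F D n) n"
    unfolding deg_def by (rule Omega_mono[OF M2(1)])
  then have sub: "(\<Union>C\<in>\<D>. \<W> C) \<subseteq> \<Omega> (fmt F n) (deg F D n) n" using W(1) by blast
  show ?thesis
  proof (rule starI)
    show "proj n ` A \<in> S n" by (rule proj[OF AS])
    show "n \<le> F" using n by simp
    show "controllable (fmt F n) (deg F D n) (deg F D n) n (proj n ` A)"
      unfolding controllable_def using sub card_W ctrl \<D>(1) W(2) by (intro exI[of _ "\<Union>C\<in>\<D>. \<W> C"]) simp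
  qed
qed

lemma star_compl:
  assumes "A \<in> star F D n"
  shows "Rn n - A \<in> star F D n"
proof -
  obtain \<Z> where "\<Z> \<subseteq> \<Omega> (fmt F n) (deg F D n) n" "finite \<Z>" "card \<Z> \<le> deg F D n" "controls n \<Z> A"
    using assms unfolding star_def controllable_def by blast
  then have "controllable (fmt F n) (deg F D n) (deg F D n) n (Rn n - A)"
    unfolding controllable_def by (intro exI[of _ \<Z>] conjI controls_compl)
  then show ?thesis using assms compl by (simp add: star_def)
qed

lemma star_product:
  assumes A: "A \<in> star F D n" and f: "\<And>G E Z. Z \<in> \<Omega> G E n \<Longrightarrow> f Z \<in> \<Omega> (G + 1) E (n + 1)" "A \<in> S n \<Longrightarrow> f A \<in> S (n + 1)"
    "\<And>\<Z>. controls n \<Z> A \<Longrightarrow> controls (n + 1) (f ` \<Z>) (f A)"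
  shows "f A \<in> star (F + 1) D (n + 1)"
proof -
  have AS: "A \<in> S n" and n: "n \<le> F" using A by (simp_all add: star_def)
  obtain \<Z> where Z: "\<Z> \<subseteq> \<Omega> (fmt F n) (deg F D n) n" "finite \<Z>" "card \<Z> \<le> deg F D n" "controls n \<Z> A"
    using A unfolding star_def controllable_def by blast
  have M: "fmt F n + 1 \<le> fmt (F + 1) (n + 1)" by (rule fmt_product[OF n])
  then have d: "deg F D n \<le> deg (F + 1) D (n + 1)"
    unfolding deg_def using fmt_ge_1[of F n] by (intro bound_mono) auto
  have "f ` \<Z> \<subseteq> \<Omega> (fmt F n + 1) (deg F D n) (n + 1)" using f(1) Z(1) by blast
  also have "\<dots> \<subseteq> \<Omega> (fmt (F + 1) (n + 1)) (deg (F + 1) D (n + 1)) (n + 1)" by (rule Omega_mono[OF M d])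
  finally have "f ` \<Z> \<subseteq> \<Omega> (fmt (F + 1) (n + 1)) (deg (F + 1) D (n + 1)) (n + 1)" .
  moreover have "card (f ` \<Z>) \<le> deg (F + 1) D (n + 1)" using card_image_le[OF Z(2), of f] Z(3) d by linarith
  ultimately have "controllable (fmt (F + 1) (n + 1)) (deg (F + 1) D (n + 1)) (deg (F + 1) D (n + 1)) (n + 1) (f A)"
    unfolding controllable_def using Z(2) f(3)[OF Z(4)] by (intro exI[of _ "f ` \<Z>"]) simp
  then show ?thesis using f(2)[OF AS] n by (intro starI) simp_all
qed

text \<open>All families are raised to the largest format and then united. The degree of each member
  is bounded by monotonicity, their total number by superadditivity.\<close>

lemma star_UN:
  assumes k: "(k :: nat) \<ge> 1" and A: "\<And>i. i < k \<Longrightarrow> As i \<in> star (Fs i) (Ds i) n"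
  shows "(\<Union>i<k. As i) \<in> star (Max (Fs ` {..<k})) (\<Sum>i<k. Ds i) n"
proof -
  define F where "F = Max (Fs ` {..<k})"
  define M where "M = fmt F n"
  have F: "Fs i \<le> F" if "i < k" for i unfolding F_def using that by (intro Max_ge) auto
  have n: "n \<le> F" using A[of 0] F[of 0] k by (auto simp: star_def)
  have "\<forall>i\<in>{..<k}. \<exists>\<Z>. \<Z> \<subseteq> \<Omega> M (deg F (Ds i) n) n \<and> finite \<Z> \<and> card \<Z> \<le> deg F (Ds i) n \<and> controls n \<Z> (As i)"
  proof
    fix i assume "i \<in> {..<k}"
    then have "As i \<in> star F (Ds i) n" using star_mono[OF A F] by simp
    then show "\<exists>\<Z>. \<Z> \<subseteq> \<Omega> M (deg F (Ds i) n) n \<and> finite \<Z> \<and> card \<Z> \<le> deg F (Ds i) n \<and> controls n \<Z> (As i)"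
      by (simp add: star_def controllable_def M_def)
  qed
  then obtain \<Z> where "\<forall>i\<in>{..<k}. \<Z> i \<subseteq> \<Omega> M (deg F (Ds i) n) n \<and> finite (\<Z> i) \<and> card (\<Z> i) \<le> deg F (Ds i) n \<and> controls n (\<Z> i) (As i)"
    by (rule bchoice[THEN exE])
  then have Z: "\<Z> i \<subseteq> \<Omega> M (deg F (Ds i) n) n" "finite (\<Z> i)" "card (\<Z> i) \<le> deg F (Ds i) n" "controls n (\<Z> i) (As i)"
    if "i < k" for i using that by simp_all
  define D where "D = (\<Sum>i<k. Ds i)"
  have "\<Omega> M (deg F (Ds i) n) n \<subseteq> \<Omega> M (deg F D n) n" if "i < k" for i
    unfolding D_def using that by (intro Omega_mono deg_mono order_refl member_le_sum) auto
  then have "(\<Union>i<k. \<Z> i) \<subseteq> \<Omega> M (deg F D n) n" using Z(1) by blast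
  moreover have "card (\<Union>i<k. \<Z> i) \<le> deg F D n"
  proof -
    have "card (\<Union>i<k. \<Z> i) \<le> (\<Sum>i<k. card (\<Z> i))" by (rule card_UN_le) simp
    also have "\<dots> \<le> (\<Sum>i<k. M * Ds i ^ M)" using Z(3) by (intro sum_mono) (simp add: deg_def M_def)
    also have "\<dots> = M * (\<Sum>i<k. Ds i ^ M)" by (rule sum_distrib_left[symmetric])
    also have "\<dots> \<le> M * D ^ M" unfolding D_def using fmt_ge_1[of F n] by (intro mult_le_mono2 sum_power_le) (simp add: M_def)
    finally show ?thesis by (simp add: deg_def M_def)
  qed
  moreover have "controls n (\<Union>i<k. \<Z> i) (\<Union>i<k. As i)" by (rule controls_UN) (use Z(4) in simp)
  ultimately have "controllable M (deg F D n) (deg F D n) n (\<Union>i<k. As i)"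
    unfolding controllable_def using Z(2) by (intro exI[of _ "\<Union>i<k. \<Z> i"]) simp
  moreover have "(\<Union>i<l. As i) \<in> S n" if "l \<le> k" for l
    using that
  proof (induction l)
    case 0
    show ?case by (simp add: empty)
  next
    case (Suc l)
    have "(\<Union>i<Suc l. As i) = (\<Union>i<l. As i) \<union> As l" by (auto simp: less_Suc_eq)
    moreover have "As l \<in> S n" using A[of l] Suc.prems by (simp add: star_def)
    ultimately show ?case using union Suc by simp
  qed
  ultimately show ?thesis unfolding F_def[symmetric] D_def[symmetric] using n by (intro starI) (simp_all add: M_def)
qed

lemma star_INT:
  assumes k: "(k :: nat) \<ge> 1" and A: "\<And>i. i < k \<Longrightarrow> As i \<in> star (Fs i) (Ds i) n"
  shows "(\<Inter>i<k. As i) \<in> star (Max (Fs ` {..<k})) (\<Sum>i<k. Ds i) n"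
proof -
  have "Rn n - (\<Union>i<k. Rn n - As i) \<in> star (Max (Fs ` {..<k})) (\<Sum>i<k. Ds i) n"
    by (intro star_compl star_UN k A)
  moreover have "As i \<subseteq> Rn n" if "i < k" for i using A[OF that] subset_Rn by (simp add: star_def)
  \<comment> \<open>\<open>k \<ge> 1\<close> matters here: an empty intersection would be the set of
    all functions instead of \<real>^n.\<close>
  then have "Rn n - (\<Union>i<k. Rn n - As i) = (\<Inter>i<k. As i)" using k by fastforce
  ultimately show ?thesis by simp
qed

section \<open>Components, zero sets and sharp cell decomposition\<close>

lemma poly_bounded_deg: "poly_bounded (\<lambda>D k. deg F D n)"
  unfolding deg_def by (intro poly_bounded_intros)

text \<open>\<open>A\<close> is a union of connected cells, so the number of cells bounds the number
  of components.\<close>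

lemma star_components:
  "\<exists>P :: nat poly. \<forall>D. \<forall>A \<in> star F D 1.
      finite (components ((\<lambda>x. x 0) ` A)) \<and> card (components ((\<lambda>x. x 0) ` A)) \<le> poly P D"
proof -
  define g where "g = dec_bound 1 (fmt F 1)"
  have "poly_bounded (\<lambda>D k. g * ((deg F D 1 + 1) * (1 * deg F D 1 + 1)) ^ g)"
    by (intro poly_bounded_intros poly_bounded_deg)
  then obtain P :: "nat poly" where P: "\<forall>D. g * ((deg F D 1 + 1) * (1 * deg F D 1 + 1)) ^ g \<le> poly P D"
    by (rule poly_bounded_poly1[THEN exE])
  have "finite (components ((\<lambda>x. x 0) ` A)) \<and> card (components ((\<lambda>x. x 0) ` A)) \<le> poly P D"
    if A: "A \<in> star F D 1" for D A
  proof -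
    have F: "1 \<le> F" using A by (simp add: star_def)
    have A1: "\<forall>j<(1 :: nat). A \<in> star F D 1" using A by simp
    obtain \<C> where "decomp 1 \<C>" and \<C>: "finite \<C>" "card \<C> \<le> g * ((deg F D 1 + 1) * (1 * deg F D 1 + 1)) ^ g"
      "\<forall>j<(1 :: nat). compatible \<C> A \<and> A = \<Union>{C \<in> \<C>. C \<subseteq> A}"
      and \<C>': "\<forall>C\<in>\<C>. good_cell g (g * Suc (deg F D 1)) g 1 C"
      using star_decomposition[of 1 "\<lambda>_. A" F D 1, folded g_def, OF A1 F] by (elim exE conjE)
    define \<D> where "\<D> = (\<lambda>C. (\<lambda>x. x 0) ` C) ` {C \<in> \<C>. C \<subseteq> A}"
    have "A = \<Union>{C \<in> \<C>. C \<subseteq> A}" using \<C>(3) by simp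
    then have "(\<lambda>x. x 0) ` A = \<Union>\<D>" unfolding \<D>_def by blast
    moreover have "finite \<D>" using \<C>(1) by (simp add: \<D>_def)
    moreover have "connected E" if E: "E \<in> \<D>" for E
    proof -
      obtain C where C: "C \<in> \<C>" "E = (\<lambda>x. x 0) ` C" using E unfolding \<D>_def by blast
      have "connected C" by (rule good_cellD(2)[OF bspec[OF \<C>' C(1)]])
      then show ?thesis unfolding C(2)
        by (rule connected_continuous_image[rotated]) (rule continuous_on_subset[OF continuous_on_product_coordinates], simp)
    qed
    moreover have "card \<D> \<le> card {C \<in> \<C>. C \<subseteq> A}" "card {C \<in> \<C>. C \<subseteq> A} \<le> card \<C>"
      unfolding \<D>_def using \<C>(1) by (auto intro: card_image_le card_mono)
    then have "card \<D> \<le> card \<C>" by linarith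
    ultimately have "finite (components ((\<lambda>x. x 0) ` A))" "card (components ((\<lambda>x. x 0) ` A)) \<le> card \<C>"
      using components_Union_connected[of \<D>] by auto
    then show ?thesis using \<C>(2) P by (meson order.trans)
  qed
  then show ?thesis by blast
qed

text \<open>In degree 0 the polynomial is constant and its zero set trivial, in accordance with
  \<open>star_degree_0\<close>.\<close>

lemma star_zero_set:
  assumes "in_vars n P"
  shows "{x \<in> Rn n. mpoly_eval P x = 0} \<in> star n (mpoly_degree P) n"
proof (cases "mpoly_degree P = 0")
  case False
  then show ?thesis by (intro star_base[OF P6[OF assms]]) auto
next
  case True
  have zero: "m = 0" if m: "m \<in> Poly_Mapping.keys P" for m
  proof -
    have "(\<Sum>i\<in>Poly_Mapping.keys m. Poly_Mapping.lookup m i) \<le> mpoly_degree P"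
      unfolding mpoly_degree_def using m by (intro Max_ge) auto
    then have "\<forall>i\<in>Poly_Mapping.keys m. Poly_Mapping.lookup m i = 0" using True by simp
    then have "Poly_Mapping.keys m = {}" using in_keys_iff[of _ m] by blast
    then show ?thesis by simp
  qed
  have "mpoly_eval P x = (\<Sum>m\<in>Poly_Mapping.keys P. Poly_Mapping.lookup P m)" for x
    unfolding mpoly_eval_def
  proof (rule sum.cong[OF refl])
    fix m assume "m \<in> Poly_Mapping.keys P"
    from zero[OF this] show "Poly_Mapping.lookup P m * (\<Prod>i\<in>Poly_Mapping.keys m. x i ^ Poly_Mapping.lookup m i) =
        Poly_Mapping.lookup P m" by simp
  qed
  then have "{x \<in> Rn n. mpoly_eval P x = 0} = {} \<or> {x \<in> Rn n. mpoly_eval P x = 0} = Rn n" by auto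
  then show ?thesis by (rule star_trivial[OF order_refl])
qed

lemma sharply_o_minimal_star: "sharply_o_minimal S star"
proof
  show "\<exists>P :: nat poly. \<forall>D. \<forall>A \<in> star F D 1.
      finite (components ((\<lambda>x. x 0) ` A)) \<and> card (components ((\<lambda>x. x 0) ` A)) \<le> poly P D" for F
    by (rule star_components)
  show "A \<in> star F D n \<Longrightarrow> n \<le> F" for A F D n by (simp add: star_def)
  show "in_vars n P \<Longrightarrow> {x \<in> Rn n. mpoly_eval P x = 0} \<in> star n (mpoly_degree P) n" for n P
    by (rule star_zero_set)
  show "A \<in> star F D (n + 1) \<Longrightarrow> proj n ` A \<in> star F D n" for A F D n by (rule star_proj)
  show "A \<in> star F D n \<Longrightarrow> Rn n - A \<in> star F D n" for A F D n by (rule star_compl)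
  show "times_R n A \<in> star (F + 1) D (n + 1)" if "A \<in> star F D n" for A F D n
    by (rule star_product[OF that P3_times_R times_R]) (simp_all add: controls_times_R)
  show "R_times n A \<in> star (F + 1) D (n + 1)" if "A \<in> star F D n" for A F D n
    by (rule star_product[OF that P3_R_times R_times]) (simp_all add: controls_R_times)
qed (rule star_UN star_INT; assumption)+

lemma sharp_cell_decomposition_star: "sharp_cell_decomposition S star"
proof -
  define g where "g F n = dec_bound n (fmt F n)" for F n
  \<comment> \<open>Membership in \<open>star\<close> forces \<open>n \<le> F\<close>, so summing
    over these dimensions removes the dependence on \<open>n\<close>; the summand \<open>F\<close>
    secures \<open>n \<le> c F\<close>.\<close>
  define c where "c F = F + (\<Sum>n\<le>F. g F n)" for F
  have "\<exists>(N :: nat poly poly) (Q :: nat poly). \<forall>D k n (X :: nat \<Rightarrow> point set).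
          k \<ge> 1 \<longrightarrow> n \<ge> 1 \<longrightarrow> (\<forall>j<k. X j \<in> star F D n) \<longrightarrow>
          (\<exists>\<C>. cell_decomposition S n \<C> \<and> (\<forall>j<k. compatible \<C> (X j)) \<and>
                finite \<C> \<and> card \<C> \<le> poly (poly N [:k:]) D \<and> \<C> \<subseteq> star (c F) (poly Q D) n)" for F
  proof -
    define h where "h n D k = g F n * ((deg F D n + 1) * (k * deg F D n + 1)) ^ g F n" for n D k
    \<comment> \<open>Covers both the degree and the number of the sets that control a cell, as
      \<open>star\<close> bounds the two by the same quantity.\<close>
    define e where "e n D = g F n * (deg F D n + 1) + g F n" for n D
    have "poly_bounded (\<lambda>D k. \<Sum>n\<le>F. h n D k)" unfolding h_def
      by (intro poly_bounded_sum poly_bounded_intros poly_bounded_deg) simp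
    then obtain N :: "nat poly poly" where N: "\<forall>D k. (\<Sum>n\<le>F. h n D k) \<le> poly (poly N [:k:]) D"
      by (rule poly_bounded_poly[THEN exE])
    have "poly_bounded (\<lambda>D k. \<Sum>n\<le>F. e n D)" unfolding e_def
      by (intro poly_bounded_sum poly_bounded_intros poly_bounded_deg) simp
    then obtain Q :: "nat poly" where Q: "\<forall>D. (\<Sum>n\<le>F. e n D) \<le> poly Q D"
      by (rule poly_bounded_poly1[THEN exE])
    have "\<exists>\<C>. cell_decomposition S n \<C> \<and> (\<forall>j<k. compatible \<C> (X j)) \<and>
                finite \<C> \<and> card \<C> \<le> poly (poly N [:k:]) D \<and> \<C> \<subseteq> star (c F) (poly Q D) n"
      if k: "k \<ge> 1" and n: "n \<ge> 1" and X: "\<forall>j<k. X j \<in> star F D n" for D k n and X :: "nat \<Rightarrow> point set"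
    proof -
      have nF: "n \<le> F" using X k by (auto simp: star_def)
      obtain \<C> where \<C>: "decomp n \<C>" "finite \<C>" "card \<C> \<le> h n D k"
        "\<forall>j<k. compatible \<C> (X j) \<and> X j = \<Union>{C \<in> \<C>. C \<subseteq> X j}"
        and \<C>': "\<forall>C\<in>\<C>. good_cell (g F n) (g F n * Suc (deg F D n)) (g F n) n C"
        using star_decomposition[of k X F D n, folded g_def, folded h_def, OF X nF] by (elim exE conjE)
      have "cell_decomposition S n \<C>" using \<C>(1) n by (simp add: decomp_def)
      moreover have "h n D k \<le> (\<Sum>n\<le>F. h n D k)" using nF by (intro member_le_sum[of _ _ "\<lambda>n. h n D k"]) auto
      then have "card \<C> \<le> poly (poly N [:k:]) D" using \<C>(3) N by (meson order.trans)
      moreover have "C \<in> star (c F) (poly Q D) n" if "C \<in> \<C>" for C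
      proof (rule starI)
        show "n \<le> c F" using nF by (simp add: c_def)
        have "e n D \<le> (\<Sum>n\<le>F. e n D)" using nF by (intro member_le_sum[of _ _ "\<lambda>n. e n D"]) auto
        also have "\<dots> \<le> poly Q D" using Q by blast
        also have "\<dots> \<le> deg (c F) (poly Q D) n" by (rule deg_ge)
        finally have e: "e n D \<le> deg (c F) (poly Q D) n" .
        have "g F n \<le> (\<Sum>n\<le>F. g F n)" using nF by (intro member_le_sum[of _ _ "\<lambda>n. g F n"]) auto
        also have "\<dots> \<le> c F" by (simp add: c_def)
        also have "\<dots> \<le> fmt (c F) n" using fmt_ge[OF \<open>n \<le> c F\<close>] by simp
        finally have f: "g F n \<le> fmt (c F) n" .
        note C = good_cellD(1,3)[OF bspec[OF \<C>' that]]
        show "C \<in> S n" by (rule C(1))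
        show "controllable (fmt (c F) n) (deg (c F) (poly Q D) n) (deg (c F) (poly Q D) n) n C"
          by (rule controllable_mono[OF C(2) f]) (use e in \<open>simp_all add: e_def\<close>)
      qed
      ultimately show ?thesis using \<C>(2,4) by (intro exI[of _ \<C>]) auto
    qed
    then show ?thesis by blast
  qed
  then show ?thesis unfolding sharp_cell_decomposition_def by blast
qed

end

theorem theorem1p9:
  fixes S :: "nat \<Rightarrow> point set set" and \<Omega> :: filtration
  assumes "presharp S \<Omega>"
  shows "\<exists>\<Omega>' :: filtration. FD_filtration S \<Omega>' \<and> reduces \<Omega> \<Omega>' \<and>
           sharply_o_minimal S \<Omega>' \<and> sharp_cell_decomposition S \<Omega>'"
proof -
  interpret presharp S \<Omega> by (rule assms)
  show ?thesis
    using star.FD_filtration_axioms reduces_star sharply_o_minimal_star sharp_cell_decomposition_star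
    by (intro exI[of _ star] conjI)
qed

end
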